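(* Let $G_m$ be a bounded Vilenkin group and let $0<p<1/2$. (a) The maximal operator $\widetilde R_p^{\ast}f:=\sup_{n\in\mathbf{P}_+}\dfrac{\log(n+1)\,|R_nf|}{(n+1)^{1/p-2}}$ is bounded from the martingale Hardy space $H_p(G_m)$ to the space $L_p(G_m)$; that is, there is a constant $c_p$ (depending only on $p$ and $m$) such that $\|\widetilde R_p^{\ast}f\|_p\le c_p\|f\|_{H_p}$ for every martingale $f\in H_p(G_m)$. (b) Let $\varphi:\mathbf{P}_+\to[1,\infty)$ be a nondecreasing function satisfying $$\limsup_{n\to\infty}\frac{(n+1)^{1/p-2}}{\log(n+1)\,\varphi(n)}=+\infty .$$ Then the maximal operator $f\mapsto\sup_{n\in\mathbf{P}_+}\dfrac{|R_nf|}{\varphi(n)}$ is not bounded from $H_p(G_m)$ to $L_{p,\infty}(G_m)$; that is, there is no constant $C<\infty$ such that $\left\|\sup_{n\in\mathbf{P}_+}\frac{|R_nf|}{\varphi(n)}\right\|_{L_{p,\infty}}\le C\|f\|_{H_p}$ for all $f\in H_p(G_m)$.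
   Context: $\mathbf{P}_+$ is the set of positive integers and $\mathbf{P}:=\mathbf{P}_+\cup\{0\}$. Let $m=(m_0,m_1,\dots)$ be a sequence of integers $\ge 2$ with $\sup_n m_n<\infty$. $Z_{m_k}=\{0,1,\dots,m_k-1\}$ is the additive group of integers modulo $m_k$ (discrete topology), and $G_m:=\prod_{k\ge 0}Z_{m_k}$ is the complete direct product with the product topology, called a bounded Vilenkin group because $\sup_n m_n<\infty$. $\mu$ is the product of the uniform probability measures on the $Z_{m_k}$, i.e. the normalized Haar measure on $G_m$. Elements are $x=(x_0,x_1,\dots)$ with $x_k\in Z_{m_k}$. Put $I_0(x):=G_m$ and $I_n(x):=\{y\in G_m: y_0=x_0,\dots,y_{n-1}=x_{n-1}\}$. Generalized number system: $M_0:=1$, $M_{k+1}:=m_kM_k$; every $n\in\mathbf{P}$ is uniquely $n=\sum_{j\ge0}n_jM_j$ with $n_j\in Z_{m_j}$, only finitely many nonzero. Generalized Rademacher functions: $r_k(x):=\exp(2\pi i x_k/m_k)$. Vilenkin system: $\psi_n(x):=\prod_{k\ge0}r_k^{n_k}(x)$, $n\in\mathbf{P}$. $\mathcal F_n$ is the $\sigma$-algebra generated by $\{I_n(x):x\in G_m\}$. Martingales $f=(f^{(n)},n\in\mathbf{P})$ are with respect to $(\mathcal F_n)$. The maximal function is $f^{\ast}:=\sup_{n\in\mathbf{P}}|f^{(n)}|$, and for $0<p<\infty$ the Hardy space $H_p(G_m)$ consists of all martingales with $\|f\|_{H_p}:=\|f^{\ast}\|_p<\infty$, where $\|g\|_p:=\left(\int_{G_m}|g|^pd\mu\right)^{1/p}$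 is the (quasi-)norm of $L_p(G_m)$. The weak space $L_{p,\infty}(G_m)$ consists of measurable $g$ with $\|g\|_{L_{p,\infty}}:=\sup_{\lambda>0}\lambda\,\mu(|g|>\lambda)^{1/p}<\infty$. For a martingale $f$: the Vilenkin–Fourier coefficients are $\widehat f(i):=\lim_{k\to\infty}\int_{G_m}f^{(k)}\overline{\psi_i}\,d\mu$; the partial sums are $S_nf:=\sum_{k=0}^{n-1}\widehat f(k)\psi_k$; the $n$-th Riesz logarithmic mean is $R_nf:=\frac1{l_n}\sum_{k=1}^n\frac{S_kf}{k}$ with $l_n:=\sum_{k=1}^n\frac1k$, for $n\in\mathbf{P}_+$. *)

theory Defs
  imports
    "HOL-Probability.Probability"
    "HOL-Algebra.Elementary_Groups"
    "HOL-Algebra.Product_Groups"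
begin

definition vilenkin_group :: "(nat \<Rightarrow> nat) \<Rightarrow> (nat \<Rightarrow> int) monoid" where
  "vilenkin_group m = product_group UNIV (\<lambda>k. integer_mod_group (m k))"

text \<open>The factors are finite and discrete, so the product \<sigma>-algebra is the Borel
  \<sigma>-algebra of the product topology.\<close>

definition vilenkin_measure :: "(nat \<Rightarrow> nat) \<Rightarrow> (nat \<Rightarrow> int) measure" where
  "vilenkin_measure m =
     Pi\<^sub>M UNIV (\<lambda>k. uniform_count_measure (carrier (integer_mod_group (m k))))"

lemma space_vilenkin_measure [simp]:
  "space (vilenkin_measure m) = carrier (vilenkin_group m)"
  by (simp add: vilenkin_measure_def vilenkin_group_def space_PiM space_uniform_count_measure)

lemma prob_space_vilenkin_measure:
  assumes "\<And>k. m k \<ge> 2"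
  shows "prob_space (vilenkin_measure m)"
  unfolding vilenkin_measure_def
proof (rule prob_space_PiM)
  fix k
  have "m k \<noteq> 0" using assms[of k] by auto
  then show "prob_space (uniform_count_measure (carrier (integer_mod_group (m k))))"
    by (intro prob_space_uniform_count_measure) (auto simp: carrier_integer_mod_group)
qed

definition vilenkin_interval :: "(nat \<Rightarrow> nat) \<Rightarrow> nat \<Rightarrow> (nat \<Rightarrow> int) \<Rightarrow> (nat \<Rightarrow> int) set" where
  "vilenkin_interval m n x = {y \<in> carrier (vilenkin_group m). \<forall>j<n. y j = x j}"

primrec gen_pow :: "(nat \<Rightarrow> nat) \<Rightarrow> nat \<Rightarrow> nat" where
  "gen_pow m 0 = 1"
| "gen_pow m (Suc k) = m k * gen_pow m k"

definition gen_digit :: "(nat \<Rightarrow> nat) \<Rightarrow> nat \<Rightarrow> nat \<Rightarrow> nat" where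
  "gen_digit m n j = (n div gen_pow m j) mod m j"

lemma gen_pow_pos: "(\<And>k. m k \<ge> 2) \<Longrightarrow> gen_pow m k > 0"
proof (induction k)
  case (Suc k)
  then have "m k > 0" by (intro less_le_trans[of 0 2 "m k"]) simp_all
  with Suc show ?case by simp
qed simp

lemma less_gen_pow:
  assumes "\<And>k. m k \<ge> 2"
  shows "k < gen_pow m k"
proof (induction k)
  case (Suc k)
  have "2 * gen_pow m k \<le> m k * gen_pow m k"
    using assms[of k] by (rule mult_le_mono1)
  with Suc show ?case unfolding gen_pow.simps by linarith
qed simp

lemma gen_digit_less: "(\<And>k. m k \<ge> 2) \<Longrightarrow> gen_digit m n j < m j"
  unfolding gen_digit_def by (rule mod_less_divisor) (rule less_le_trans[of 0 2], simp_all)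

lemma gen_digit_eq_0:
  assumes "\<And>k. m k \<ge> 2" "n \<le> j"
  shows "gen_digit m n j = 0"
  using less_gen_pow[of m j] assms by (simp add: gen_digit_def)

lemma sum_gen_digit_mod: "(\<Sum>j<k. gen_digit m n j * gen_pow m j) = n mod gen_pow m k"
proof (induction k)
  case (Suc k)
  then show ?case
    using mod_mult2_eq[of n "gen_pow m k" "m k"]
    by (simp add: gen_digit_def mult.commute)
qed simp

lemma gen_digit_expansion:
  assumes "\<And>k. m k \<ge> 2"
  shows "n = (\<Sum>j<n. gen_digit m n j * gen_pow m j)"
  using less_gen_pow[of m n] assms by (simp add: sum_gen_digit_mod)

lemma gen_digit_unique:
  assumes m: "\<And>k. m k \<ge> 2" and a: "\<And>j. a j < m j"
    and n: "n = (\<Sum>j<N. a j * gen_pow m j)" and "j < N"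
  shows "gen_digit m n j = a j"
proof -
  have *: "(\<Sum>i<k. a i * gen_pow m i) < gen_pow m k" for k
  proof (induction k)
    case (Suc k)
    have "(\<Sum>i<Suc k. a i * gen_pow m i) < (a k + 1) * gen_pow m k"
      using Suc by simp
    also have "\<dots> \<le> m k * gen_pow m k"
      using a[of k] by (intro mult_le_mono1) simp
    finally show ?case by simp
  qed simp
  have dvd: "gen_pow m k dvd gen_pow m i" if "k \<le> i" for k i
    using that by (induction i rule: dec_induct) auto
  have md: "n mod gen_pow m k = (\<Sum>i<k. a i * gen_pow m i)" if "k \<le> N" for k
  proof -
    have "n = (\<Sum>i<k. a i * gen_pow m i) + (\<Sum>i\<in>{k..<N}. a i * gen_pow m i)"
      unfolding n using that by (subst sum.union_disjoint[symmetric]) (auto intro!: sum.cong)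
    moreover have "gen_pow m k dvd (\<Sum>i\<in>{k..<N}. a i * gen_pow m i)"
      by (intro dvd_sum) (auto intro!: dvd_mult dvd)
    ultimately show ?thesis using *[of k] by (auto elim!: dvdE)
  qed
  have "gen_digit m n j * gen_pow m j + n mod gen_pow m j = n mod gen_pow m (Suc j)"
    using sum_gen_digit_mod[of m n j] sum_gen_digit_mod[of m n "Suc j"] by simp
  with md[of j] md[of "Suc j"] \<open>j < N\<close> have "gen_digit m n j * gen_pow m j = a j * gen_pow m j"
    by simp
  with gen_pow_pos[where m = m and k = j, OF m] show ?thesis by simp
qed

definition gen_rademacher :: "(nat \<Rightarrow> nat) \<Rightarrow> nat \<Rightarrow> (nat \<Rightarrow> int) \<Rightarrow> complex" where
  "gen_rademacher m k x = exp (2 * of_real pi * \<i> * of_int (x k) / of_nat (m k))"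

text \<open>The index set is finite because only finitely many digits are nonzero
  (\<open>gen_digit_eq_0\<close>); all other factors of the infinite product are 1.\<close>

definition vilenkin_fun :: "(nat \<Rightarrow> nat) \<Rightarrow> nat \<Rightarrow> (nat \<Rightarrow> int) \<Rightarrow> complex" where
  "vilenkin_fun m n x =
     (\<Prod>k | gen_digit m n k \<noteq> 0. gen_rademacher m k x ^ gen_digit m n k)"

definition vilenkin_algebra :: "(nat \<Rightarrow> nat) \<Rightarrow> nat \<Rightarrow> (nat \<Rightarrow> int) measure" where
  "vilenkin_algebra m n =
     sigma (carrier (vilenkin_group m)) (vilenkin_interval m n ` carrier (vilenkin_group m))"

lemma subalgebra_vilenkin_algebra: "subalgebra (vilenkin_measure m) (vilenkin_algebra m n)"
proof -
  let ?M = "vilenkin_measure m"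
  have "vilenkin_interval m n x \<in> sets ?M" if "x \<in> space ?M" for x
  proof -
    have [measurable]: "(\<lambda>y. y j) \<in> measurable ?M (count_space UNIV)" for j
    proof -
      let ?U = "uniform_count_measure (carrier (integer_mod_group (m j)))"
      have "(\<lambda>y. y j) \<in> measurable ?M ?U"
        unfolding vilenkin_measure_def by (rule measurable_component_singleton) simp
      moreover have "(\<lambda>i. i) \<in> measurable ?U (count_space UNIV)"
        by (auto simp: measurable_def sets_uniform_count_measure space_uniform_count_measure)
      ultimately show ?thesis
        by (rule measurable_compose)
    qed
    have "vilenkin_interval m n x = {y \<in> space ?M. \<forall>j<n. y j = x j}"
      by (simp add: vilenkin_interval_def)
    also have "\<dots> \<in> sets ?M" by measurable
    finally show ?thesis .
  qed
  moreover have "vilenkin_interval m n ` carrier (vilenkin_group m) \<subseteq> Pow (carrier (vilenkin_group m))"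
    by (auto simp: vilenkin_interval_def)
  ultimately show ?thesis
    using sets.sigma_sets_subset[of "vilenkin_interval m n ` carrier (vilenkin_group m)" ?M]
    by (simp add: subalgebra_def vilenkin_algebra_def space_measure_of_conv image_subset_iff)
qed

text \<open>The conditional expectation of a complex function is taken componentwise.\<close>

definition vilenkin_martingale :: "(nat \<Rightarrow> nat) \<Rightarrow> (nat \<Rightarrow> (nat \<Rightarrow> int) \<Rightarrow> complex) \<Rightarrow> bool" where
  "vilenkin_martingale m f \<longleftrightarrow>
     (\<forall>n. f n \<in> borel_measurable (vilenkin_algebra m n)) \<and>
     (\<forall>n. integrable (vilenkin_measure m) (f n)) \<and>
     (\<forall>n k. n \<le> k \<longrightarrow>
        (AE x in vilenkin_measure m.
           f n x =
           Complex
             (real_cond_exp (vilenkin_measure m) (vilenkin_algebra m n) (\<lambda>y. Re (f k y)) x)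
             (real_cond_exp (vilenkin_measure m) (vilenkin_algebra m n) (\<lambda>y. Im (f k y)) x)))"

text \<open>Power of an extended nonnegative real, for exponents \<open>p > 0\<close> only.\<close>

definition enn_powr :: "ennreal \<Rightarrow> real \<Rightarrow> ennreal" where
  "enn_powr x p = (if x = \<infinity> then \<infinity> else ennreal (enn2real x powr p))"

definition Lp_qnorm :: "'a measure \<Rightarrow> real \<Rightarrow> ('a \<Rightarrow> ennreal) \<Rightarrow> ennreal" where
  "Lp_qnorm M p g = enn_powr (\<integral>\<^sup>+ x. enn_powr (g x) p \<partial>M) (1 / p)"

definition weak_Lp_qnorm :: "'a measure \<Rightarrow> real \<Rightarrow> ('a \<Rightarrow> ennreal) \<Rightarrow> ennreal" where
  "weak_Lp_qnorm M p g =
     (SUP t\<in>{0<..}. ennreal t * enn_powr (emeasure M {x \<in> space M. g x > ennreal t}) (1 / p))"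

definition mart_maximal :: "(nat \<Rightarrow> 'a \<Rightarrow> complex) \<Rightarrow> 'a \<Rightarrow> ennreal" where
  "mart_maximal f x = (SUP n. ennreal (cmod (f n x)))"

definition Hp_qnorm :: "(nat \<Rightarrow> nat) \<Rightarrow> real \<Rightarrow> (nat \<Rightarrow> (nat \<Rightarrow> int) \<Rightarrow> complex) \<Rightarrow> ennreal" where
  "Hp_qnorm m p f = Lp_qnorm (vilenkin_measure m) p (mart_maximal f)"

definition hardy_space :: "(nat \<Rightarrow> nat) \<Rightarrow> real \<Rightarrow> (nat \<Rightarrow> (nat \<Rightarrow> int) \<Rightarrow> complex) set" where
  "hardy_space m p = {f. vilenkin_martingale m f \<and> Hp_qnorm m p f < \<infinity>}"

definition vilenkin_coeff :: "(nat \<Rightarrow> nat) \<Rightarrow> (nat \<Rightarrow> (nat \<Rightarrow> int) \<Rightarrow> complex) \<Rightarrow> nat \<Rightarrow> complex" where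
  "vilenkin_coeff m f i =
     lim (\<lambda>k. \<integral>x. f k x * cnj (vilenkin_fun m i x) \<partial>vilenkin_measure m)"

definition vilenkin_partial_sum ::
    "(nat \<Rightarrow> nat) \<Rightarrow> nat \<Rightarrow> (nat \<Rightarrow> (nat \<Rightarrow> int) \<Rightarrow> complex) \<Rightarrow> (nat \<Rightarrow> int) \<Rightarrow> complex" where
  "vilenkin_partial_sum m n f x = (\<Sum>k<n. vilenkin_coeff m f k * vilenkin_fun m k x)"

definition riesz_mean ::
    "(nat \<Rightarrow> nat) \<Rightarrow> nat \<Rightarrow> (nat \<Rightarrow> (nat \<Rightarrow> int) \<Rightarrow> complex) \<Rightarrow> (nat \<Rightarrow> int) \<Rightarrow> complex" where
  "riesz_mean m n f x =
     (\<Sum>k=1..n. vilenkin_partial_sum m k f x / of_nat k) / of_real (harm n)"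

end

theory Submission
  imports Defs
begin

text \<open>Boundedness. Since \<open>ln (n + 1) \<le> l\<^sub>n\<close>, it suffices to bound
  \<open>sup\<^sub>q (q + 1) powr - (1/p - 2) * |\<Sum>k\<le>q. S\<^sub>k f / k|\<close>. For a fixed level \<open>N\<close> the function \<open>f\<^sup>(\<^sup>N\<^sup>)\<close> is
  split, by dyadic stopping of a predictable majorant of \<open>f\<close>, into finitely many mean-zero atoms
  \<open>a\<close> supported on cells \<open>I\<^sub>n(c)\<close>; by \<open>p\<close>-subadditivity only atoms matter, and \<open>N \<rightarrow> \<infinity>\<close> is taken by
  monotone convergence. For an atom \<open>S\<^sub>k a = 0\<close> for \<open>k \<le> M\<^sub>n\<close>. If \<open>y = x - t\<close> has its first two nonzero
  coordinates at \<open>s < u\<close>, then full blocks of characters cancel, giving \<open>|D\<^sub>k(y)| \<le> M\<^sub>s\<^sub>+\<^sub>1\<close> and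
  \<open>|\<Sum>j<k. D\<^sub>j(y)| \<le> M\<^sub>s\<^sub>+\<^sub>1 M\<^sub>u\<^sub>+\<^sub>1\<close>. Abel summation against \<open>1/k\<close> turns this into a pointwise bound off
  the support whose \<open>p\<close>-th power is summable over \<open>s < u\<close> exactly because \<open>p < 1/2\<close>.

  Sharpness. For \<open>f = M\<^sub>K 1\<^bsub>I\<^sub>K(0)\<^esub> r\<^sub>K\<close> all coefficients below \<open>M\<^sub>K\<close> vanish and the one at \<open>M\<^sub>K\<close> is
  \<open>1\<close>, so \<open>|R\<^sub>n f| = 1 / (n l\<^sub>n)\<close> everywhere for \<open>n = M\<^sub>K + 1\<close>, while
  \<open>\<parallel>f\<parallel> \<le> M\<^sub>K powr (1 - 1/p)\<close> in \<open>H\<^sub>p\<close>.\<close>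

section \<open>Auxiliary inequalities\<close>

text \<open>For \<open>p < 1\<close> an element of \<open>H_p\<close> need not be a function, so no
  kernel integral can be written for it directly. But the partial sums of order at most
  \<open>P N\<close> see only \<open>f N\<close>, which is constant on finitely many cells;
  integrals become finite sums, and only the independence of all constants from \<open>N\<close>
  needs care.

  The weight matches the scale of an atom. Put \<open>B = P n\<close>. Off its support, Abel
  summation over \<open>k > B\<close> gains \<open>1 / B\<close>, integration over the cell gains
  another \<open>1 / B\<close>, and the weight gives \<open>B powr - eps\<close>. As
  \<open>eps + 2 = 1 / p\<close>, the p-th power of the product is \<open>1 / B\<close>, the measure
  of the cell. If no second differing coordinate is available below \<open>n\<close>, Abel summation
  has no bounded sums to work with; the resulting \<open>ln (q / B)\<close> is absorbed by the
  weight because \<open>eps > 0\<close>.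

  Boundedness of \<open>m\<close> is needed outside the kernels as well: a stopping cell must
  contain a child on which the martingale really is large, and that child carries at least the
  fraction \<open>1 / R\<close> of its measure.

  The test functions only probe the indices \<open>P K + 1\<close>; monotonicity of the denominator
  and bounded ratios of consecutive \<open>P K\<close> carry the comparison to every index.\<close>

lemma sum_lessThan_add: "(\<Sum>j<a + (b::nat). f j) = (\<Sum>j<a. f j) + (\<Sum>j<b. f (a + j))"
  for f :: "nat \<Rightarrow> complex"
  by (induction b) (auto simp: add.assoc)

lemma geometric_root_sum:
  fixes z :: complex
  assumes "z ^ k = 1" "z \<noteq> 1"
  shows "(\<Sum>d<k. z ^ d) = 0"
  using assms by (simp add: geometric_sum)

text \<open>Summation by parts: the weights \<open>1 / k\<close> decrease, so their successive
  differences are nonnegative and telescope.\<close>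

lemma abel_bound:
  fixes z :: "nat \<Rightarrow> complex"
  assumes "\<And>j. norm (\<Sum>k=Suc a..j. z k) \<le> X"
  shows "norm (\<Sum>k=Suc a..q. z k / of_nat k) \<le> X / real (Suc a)"
proof (cases "Suc a \<le> q")
  case True
  let ?Z = "\<lambda>j. \<Sum>k=Suc a..j. z k"
  have X: "0 \<le> X" using assms[of 0] norm_ge_zero order_trans by blast
  \<comment> \<open>With the boundary term removed the estimate telescopes; the deficit
    \<open>X / q\<close> on the right is what the boundary term later uses up.\<close>
  have eq: "norm ((\<Sum>k=Suc a..q. z k / of_nat k) - ?Z q / of_nat q) \<le> X * (1 / real (Suc a) - 1 / real q)"
    using True
  proof (induction q rule: dec_induct)
    case (step n)
    let ?T = "(\<Sum>k=Suc a..n. z k / of_nat k)"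
    have n: "n \<noteq> 0" using step by simp
    have e1: "(\<Sum>k=Suc a..Suc n. z k / of_nat k) = ?T + z (Suc n) / of_nat (Suc n)"
      and e2: "?Z (Suc n) = ?Z n + z (Suc n)"
      using step by (simp_all add: sum.atLeast_Suc_atMost)
    have "(\<Sum>k=Suc a..Suc n. z k / of_nat k) - ?Z (Suc n) / of_nat (Suc n) =
      (?T - ?Z n / of_nat n) + ?Z n * of_real (1 / real n - 1 / real (Suc n))"
      unfolding e1 e2 using n by (simp add: field_simps del: of_nat_Suc)
    also have "norm \<dots> \<le> X * (1 / real (Suc a) - 1 / real n) + X * (1 / real n - 1 / real (Suc n))"
    proof (rule order_trans[OF norm_triangle_ineq add_mono[OF step.IH]])
      have "0 \<le> 1 / real n - 1 / real (Suc n)" using n by (simp add: field_simps)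
      then show "norm (?Z n * of_real (1 / real n - 1 / real (Suc n))) \<le> X * (1 / real n - 1 / real (Suc n))"
        unfolding norm_mult norm_of_real using assms[of n] by (intro mult_mono) (auto simp: X)
    qed
    also have "\<dots> = X * (1 / real (Suc a) - 1 / real (Suc n))"
      by (simp add: algebra_simps)
    finally show ?case .
  qed auto
  have "norm (?Z q / of_nat q) \<le> X * (1 / real q)"
    using assms[of q] True by (simp add: norm_divide divide_right_mono)
  with eq norm_triangle_sub[of "(\<Sum>k=Suc a..q. z k / of_nat k)" "?Z q / of_nat q"]
  show ?thesis by (simp add: algebra_simps)
next
  case False
  then show ?thesis using assms[of 0] by (simp add: order_trans[OF norm_ge_zero])
qed

text \<open>With \<open>S\<close> the whole sum, write \<open>S powr p\<close> as the sum of
  \<open>f i * S powr (p - 1)\<close>. Since \<open>p - 1 \<le> 0\<close> and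
  \<open>f i \<le> S\<close>, the factor \<open>S powr (p - 1)\<close> may be replaced by
  \<open>f i powr (p - 1)\<close>.\<close>

lemma powr_sum_le:
  fixes f :: "'a \<Rightarrow> real"
  assumes "finite A" "\<And>i. i \<in> A \<Longrightarrow> 0 \<le> f i" "0 < p" "p \<le> 1"
  shows "(\<Sum>i\<in>A. f i) powr p \<le> (\<Sum>i\<in>A. f i powr p)"
proof (cases "(\<Sum>i\<in>A. f i) = 0")
  case True
  then show ?thesis using assms(3) by (simp add: sum_nonneg)
next
  case False
  define S where "S = (\<Sum>i\<in>A. f i)"
  have S: "S > 0" using False assms(2) sum_nonneg[of A f] by (simp add: S_def less_le)
  have "S powr p = (\<Sum>i\<in>A. f i * S powr (p - 1))"
    unfolding sum_distrib_right[symmetric] S_def[symmetric] using S by (simp add: powr_diff)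
  also have "\<dots> \<le> (\<Sum>i\<in>A. f i powr p)"
  proof (rule sum_mono)
    fix i assume i: "i \<in> A"
    show "f i * S powr (p - 1) \<le> f i powr p"
    proof (cases "f i = 0")
      case False
      then have fi: "f i > 0" using assms(2)[OF i] by simp
      have "f i \<le> S" unfolding S_def using assms(1,2) i by (intro member_le_sum) auto
      then have "S powr (p - 1) \<le> f i powr (p - 1)"
        using fi assms(4) by (intro powr_mono2') auto
      then have "f i * S powr (p - 1) \<le> f i * f i powr (p - 1)" using fi by (intro mult_left_mono) auto
      then show ?thesis using fi by (simp add: powr_diff)
    qed (use assms(3) in simp)
  qed
  finally show ?thesis by (simp add: S_def)
qed

lemma powr_add_le:
  fixes a b :: real
  assumes "0 \<le> a" "0 \<le> b" "0 < p" "p \<le> 1"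
  shows "(a + b) powr p \<le> a powr p + b powr p"
  using powr_sum_le[of UNIV "\<lambda>i. if i then a else b" p] assms by (simp add: UNIV_bool add.commute)

lemma sum_power_le:
  fixes z :: real
  assumes "0 \<le> z" "z < 1" "finite A"
  shows "(\<Sum>s\<in>A. z ^ s) \<le> 1 / (1 - z)"
  using assms sum_le_suminf[of "\<lambda>s. z ^ s" A] by (simp add: suminf_geometric)

lemma sum_inverse_le_ln:
  assumes "1 \<le> a" "a \<le> q"
  shows "(\<Sum>k=Suc a..q. 1 / real k) \<le> ln (real q) - ln (real a)"
  using assms(2)
proof (induction q rule: dec_induct)
  case (step n)
  have n: "real n > 0" using step assms(1) by simp
  have "ln (real n / real (Suc n)) \<le> real n / real (Suc n) - 1"
    using n by (intro ln_le_minus_one) simp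
  also have "ln (real n / real (Suc n)) = ln (real n) - ln (real (Suc n))"
    using n by (simp add: ln_div del: of_nat_Suc)
  finally have "1 / real (Suc n) \<le> ln (real (Suc n)) - ln (real n)"
    by (simp add: field_simps)
  with step show ?case by simp
qed simp

lemma harm_le_ln: "1 \<le> q \<Longrightarrow> harm q \<le> 1 + ln (real q)"
  using sum_inverse_le_ln[of 1 q] sum.atLeast_Suc_atMost[of 1 q "\<lambda>k. 1 / real k"]
  by (simp add: harm_def inverse_eq_divide)

text \<open>A discrete layer-cake bound. The sum is a part of a geometric series of ratio
  \<open>2 powr - p\<close>, counted downwards from the last \<open>k\<close> with
  \<open>2 powr k \<le> v\<close>; hence the bound does not depend on \<open>K\<close>.\<close>

lemma dyadic_sum_le:
  fixes v p :: real
  assumes "0 \<le> v" "0 < p" "finite K"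
  shows "(\<Sum>k\<in>K. if 2 powr real_of_int k \<le> v then (2 powr real_of_int k) powr p else 0)
    \<le> v powr p / (1 - 2 powr - p)"
proof (cases "v = 0")
  case True
  have "\<not> 2 powr real_of_int k \<le> v" for k using True by (simp add: not_le)
  then show ?thesis using True by simp
next
  case False
  then have v: "0 < v" using assms(1) by simp
  define z :: real where "z = 2 powr - p"
  have z: "0 \<le> z" "z < 1" using assms(2) by (auto simp: z_def powr_less_one)
  define k0 where "k0 = \<lfloor>log 2 v\<rfloor>"
  have iff: "2 powr real_of_int k \<le> v \<longleftrightarrow> k \<le> k0" for k
    using v by (simp add: k0_def le_floor_iff le_log_iff)
  let ?K = "{k \<in> K. k \<le> k0}"
  have "(\<Sum>k\<in>K. if 2 powr real_of_int k \<le> v then (2 powr real_of_int k) powr p else 0)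
      = (\<Sum>k\<in>?K. (2 powr real_of_int k) powr p)"
    unfolding iff using assms(3) by (simp add: sum.inter_filter)
  also have "\<dots> = (\<Sum>k\<in>?K. (2 powr real_of_int k0) powr p * z ^ nat (k0 - k))"
  proof (rule sum.cong[OF refl])
    fix k assume "k \<in> ?K"
    then have k: "k \<le> k0" by simp
    have "z ^ nat (k0 - k) = 2 powr (- p * real_of_int (k0 - k))"
      using k z by (simp add: z_def powr_realpow[symmetric] powr_powr)
    then have "(2 powr real_of_int k0) powr p * z ^ nat (k0 - k) = 2 powr (real_of_int k0 * p + - p * real_of_int (k0 - k))"
      by (simp only: powr_powr powr_add)
    also have "real_of_int k0 * p + - p * real_of_int (k0 - k) = real_of_int k * p"
      by (simp add: algebra_simps)
    finally show "(2 powr real_of_int k) powr p = (2 powr real_of_int k0) powr p * z ^ nat (k0 - k)"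
      by (simp add: powr_powr)
  qed
  also have "\<dots> = (2 powr real_of_int k0) powr p * (\<Sum>j\<in>(\<lambda>k. nat (k0 - k)) ` ?K. z ^ j)"
    by (subst sum.reindex) (auto simp: inj_on_def sum_distrib_left)
  also have "\<dots> \<le> v powr p * (1 / (1 - z))"
  proof (rule mult_mono)
    show "(2 powr real_of_int k0) powr p \<le> v powr p"
      using iff[of k0] assms(2) by (intro powr_mono2) auto
    show "(\<Sum>j\<in>(\<lambda>k. nat (k0 - k)) ` ?K. z ^ j) \<le> 1 / (1 - z)"
      using assms(3) by (intro sum_power_le z) auto
  qed (use z in \<open>auto intro: sum_nonneg\<close>)
  finally show ?thesis by (simp add: z_def)
qed

section \<open>Powers of extended nonnegative reals\<close>

lemma enn_powr_ennreal: "0 \<le> x \<Longrightarrow> enn_powr (ennreal x) r = ennreal (x powr r)"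
  by (simp add: enn_powr_def)

lemma enn_powr_mono:
  assumes "x \<le> y" "0 < r"
  shows "enn_powr x r \<le> enn_powr y r"
proof (cases "y = \<infinity>")
  case False
  then obtain b where b: "y = ennreal b" "0 \<le> b" by (cases y) auto
  with assms(1) obtain a where a: "x = ennreal a" "0 \<le> a" by (cases x) (auto simp: top_unique)
  show ?thesis
    using assms(1) assms(2) unfolding a(1) b(1) enn_powr_ennreal[OF a(2)] enn_powr_ennreal[OF b(2)]
    by (intro ennreal_leI powr_mono2) (auto simp: a b)
qed (simp add: enn_powr_def)

lemma enn_powr_inverse:
  assumes "0 < r"
  shows "enn_powr (enn_powr x r) (1 / r) = x"
proof (cases "x = \<infinity>")
  case False
  then obtain a where a: "x = ennreal a" "0 \<le> a" by (cases x) auto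
  show ?thesis using assms a by (simp add: enn_powr_ennreal powr_powr)
qed (simp add: enn_powr_def)

text \<open>The power has the monotone inverse \<open>1 / r\<close>, so the bound can be moved
  across the supremum without any continuity argument.\<close>

lemma enn_powr_SUP_le:
  assumes "0 < r"
  shows "enn_powr (SUP i\<in>A. g i) r \<le> (SUP i\<in>A. enn_powr (g i) r)"
proof -
  let ?S = "SUP i\<in>A. enn_powr (g i) r"
  have "(SUP i\<in>A. g i) \<le> enn_powr ?S (1 / r)"
  proof (rule SUP_least)
    fix i assume "i \<in> A"
    then have "enn_powr (g i) r \<le> ?S" by (rule SUP_upper)
    then have "enn_powr (enn_powr (g i) r) (1 / r) \<le> enn_powr ?S (1 / r)"
      using assms by (intro enn_powr_mono) auto
    then show "g i \<le> enn_powr ?S (1 / r)" by (simp add: enn_powr_inverse[OF assms])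
  qed
  then have "enn_powr (SUP i\<in>A. g i) r \<le> enn_powr (enn_powr ?S (1 / r)) r"
    using assms by (intro enn_powr_mono)
  also have "\<dots> = ?S" using enn_powr_inverse[of "1 / r" ?S] assms by simp
  finally show ?thesis .
qed

lemma enn_powr_cmult:
  assumes "0 < c" "0 < r"
  shows "enn_powr (ennreal c * x) r = ennreal (c powr r) * enn_powr x r"
proof (cases "x = \<infinity>")
  case True
  then show ?thesis using assms by (simp add: enn_powr_def ennreal_mult_top)
next
  case False
  then obtain a where a: "x = ennreal a" "0 \<le> a" by (cases x) auto
  then show ?thesis
    using assms by (simp add: enn_powr_ennreal ennreal_mult'[symmetric] powr_mult)
qed

section \<open>Vilenkin--Dirichlet kernels\<close>

locale vilenkin =
  fixes m :: "nat \<Rightarrow> nat" and R :: nat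
  assumes m_ge: "m k \<ge> 2" and m_le: "m k \<le> R"
begin

abbreviation P :: "nat \<Rightarrow> nat" where "P \<equiv> gen_pow m"

section \<open>Generalised powers, digits, and characters of a sequence\<close>

lemma P_pos: "P k > 0"
  using m_ge by (rule gen_pow_pos)

lemma P_pos_real [simp]: "real (P k) > 0"
  using P_pos by simp

lemma P_ge_1: "1 \<le> P k"
  using P_pos[of k] by simp

lemma less_P: "k < P k"
  using m_ge by (rule less_gen_pow)

lemma P_dvd: "i \<le> j \<Longrightarrow> P i dvd P j"
  by (induction j rule: dec_induct) auto

lemma P_mono: "i \<le> j \<Longrightarrow> P i \<le> P j"
  using P_dvd P_pos by (simp add: dvd_imp_le)

lemma P_Suc_le: "P (Suc k) \<le> R * P k"
  using m_le by simp

lemma two_power_le_P: "2 ^ k \<le> P k"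
  by (induction k) (use m_ge in \<open>auto intro: mult_le_mono\<close>)

lemma R_ge: "2 \<le> R"
  using m_ge[of 0] m_le[of 0] by simp

text \<open>Together with \<open>digit_high\<close> this says that no carry occurs between a number
  below \<open>P n\<close> and a multiple of \<open>P n\<close>; the factorisation
  \<open>chi_add\<close> rests on it.\<close>

lemma digit_low:
  assumes "j < n"
  shows "gen_digit m (b + a * P n) j = gen_digit m b j"
proof -
  have "P (Suc j) dvd P n" using assms by (intro P_dvd) simp
  then obtain c where "P n = P (Suc j) * c" by (rule dvdE)
  then have c: "P n = P j * (m j * c)" by (simp add: ac_simps)
  have "b + a * P n = b + (a * m j * c) * P j" by (simp add: c ac_simps)
  then have "(b + a * P n) div P j = b div P j + a * m j * c"
    using P_pos[of j] by (simp only: div_mult_self1)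
  then show ?thesis
    by (metis gen_digit_def mod_mult_self1 mult.assoc mult.commute)
qed

lemma digit_high:
  assumes "b < P n" "n \<le> j"
  shows "gen_digit m (b + a * P n) j = gen_digit m (a * P n) j"
proof -
  obtain c where c: "P j = P n * c" using P_dvd[OF assms(2)] by (auto elim: dvdE)
  show ?thesis using assms(1) by (simp add: gen_digit_def c div_mult2_eq)
qed

lemma digit_eq_0: "b < P n \<Longrightarrow> n \<le> j \<Longrightarrow> gen_digit m b j = 0"
  using P_mono[of n j] by (simp add: gen_digit_def)

text \<open>The Vilenkin function with an arbitrary sequence in place of the Rademacher values.
  Inserting quotients of Rademacher values evaluates characters at a group difference without ever
  forming that difference.\<close>

definition chi :: "(nat \<Rightarrow> complex) \<Rightarrow> nat \<Rightarrow> complex" where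
  "chi \<rho> n = (\<Prod>k | gen_digit m n k \<noteq> 0. \<rho> k ^ gen_digit m n k)"

lemma vilenkin_fun_chi: "vilenkin_fun m n x = chi (\<lambda>k. gen_rademacher m k x) n"
  by (simp add: chi_def vilenkin_fun_def)

lemma chi_eq:
  assumes "n < P J"
  shows "chi \<rho> n = (\<Prod>k<J. \<rho> k ^ gen_digit m n k)"
  unfolding chi_def
proof (rule prod.mono_neutral_cong_left)
  show "{k. gen_digit m n k \<noteq> 0} \<subseteq> {..<J}"
    using digit_eq_0[OF assms] by (metis (mono_tags, lifting) lessThan_iff mem_Collect_eq not_less subsetI)
qed auto

lemma chi_0 [simp]: "chi \<rho> 0 = 1"
  by (simp add: chi_def gen_digit_def)

lemma chi_mult: "chi \<rho> n * chi \<sigma> n = chi (\<lambda>k. \<rho> k * \<sigma> k) n"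
  by (simp add: chi_def prod.distrib power_mult_distrib)

lemma cnj_chi: "cnj (chi \<rho> n) = chi (\<lambda>k. cnj (\<rho> k)) n"
  by (simp add: chi_def)

lemma norm_chi: "(\<And>k. norm (\<rho> k) = 1) \<Longrightarrow> norm (chi \<rho> n) = 1"
  by (simp add: chi_def norm_power flip: prod_norm)

lemma chi_cong: "n < P J \<Longrightarrow> (\<And>k. k < J \<Longrightarrow> \<rho> k = \<sigma> k) \<Longrightarrow> chi \<rho> n = chi \<sigma> n"
  by (simp add: chi_eq)

lemma chi_add:
  assumes "b < P n"
  shows "chi \<rho> (b + a * P n) = chi \<rho> b * chi \<rho> (a * P n)"
proof -
  \<comment> \<open>Any level above \<open>n\<close> and above all digits of the index would do;
    this one qualifies because \<open>k < P k\<close>.\<close>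
  define J where "J = n + (b + a * P n)"
  have J: "b + a * P n < P J" "n \<le> J"
    using less_P[of J] by (auto simp: J_def)
  have split: "{..<J} = {..<n} \<union> {n..<J}" using J(2) by auto
  have "chi \<rho> (b + a * P n) = (\<Prod>k<n. \<rho> k ^ gen_digit m b k) * (\<Prod>k=n..<J. \<rho> k ^ gen_digit m (a * P n) k)"
    unfolding chi_eq[OF J(1)] split using assms
    by (subst prod.union_disjoint) (auto simp: digit_low digit_high)
  also have "(\<Prod>k<n. \<rho> k ^ gen_digit m b k) = chi \<rho> b"
    using assms by (simp add: chi_eq)
  also have "(\<Prod>k=n..<J. \<rho> k ^ gen_digit m (a * P n) k) = chi \<rho> (a * P n)"
  proof -
    have "a * P n < P J" using J(1) by simp
    then show ?thesis
      unfolding chi_eq[OF \<open>a * P n < P J\<close>] split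
      using digit_low[of _ n 0 a] by (subst prod.union_disjoint) (auto simp: gen_digit_def)
  qed
  finally show ?thesis .
qed

lemma chi_mult_P:
  assumes "d < m n"
  shows "chi \<rho> (d * P n) = \<rho> n ^ d"
proof -
  have lt: "d * P n < P (Suc n)" using assms P_pos[of n] by simp
  have "gen_digit m (d * P n) k = 0" if "k < n" for k
    using digit_low[OF that, of 0 d] by (simp add: gen_digit_def)
  moreover have "gen_digit m (d * P n) n = d"
    using assms P_pos[of n] by (simp add: gen_digit_def)
  ultimately show ?thesis by (simp add: chi_eq[OF lt])
qed

lemma chi_P: "chi \<rho> (P n) = \<rho> n"
  using chi_mult_P[of 1 n \<rho>] m_ge[of n] by simp

definition dirichlet :: "(nat \<Rightarrow> complex) \<Rightarrow> nat \<Rightarrow> complex" where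
  "dirichlet \<rho> k = (\<Sum>j<k. chi \<rho> j)"

lemma norm_dirichlet_le:
  assumes "\<And>k. norm (\<rho> k) = 1"
  shows "norm (dirichlet \<rho> k) \<le> real k"
proof -
  have "norm (dirichlet \<rho> k) \<le> (\<Sum>j<k. norm (chi \<rho> j))"
    unfolding dirichlet_def by (rule norm_sum)
  then show ?thesis by (simp add: norm_chi[OF assms])
qed

lemma dirichlet_add_block:
  assumes "b \<le> P n"
  shows "dirichlet \<rho> (a * P n + b) = dirichlet \<rho> (a * P n) + chi \<rho> (a * P n) * dirichlet \<rho> b"
proof -
  have "(\<Sum>j<b. chi \<rho> (a * P n + j)) = (\<Sum>j<b. chi \<rho> (a * P n) * chi \<rho> j)"
    using assms by (intro sum.cong) (auto simp: chi_add[symmetric] mult.commute add.commute)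
  then show ?thesis
    unfolding dirichlet_def sum_lessThan_add by (simp add: sum_distrib_left)
qed

lemma dirichlet_mult_P_eq_0:
  assumes "dirichlet \<rho> (P n) = 0"
  shows "dirichlet \<rho> (a * P n) = 0"
proof (induction a)
  case (Suc a)
  then show ?case
    using dirichlet_add_block[of "P n" n \<rho> a] assms by (simp add: add.commute)
qed (simp add: dirichlet_def)

text \<open>The indices below \<open>P n\<close> run through all digit strings of length
  \<open>n\<close> independently, so the sum of characters splits into one geometric sum per digit.
  A single nontrivial \<open>m s\<close>-th root of unity makes it vanish.\<close>

lemma dirichlet_P_prod: "dirichlet \<rho> (P n) = (\<Prod>i<n. \<Sum>d<m i. \<rho> i ^ d)"
proof (induction n)
  case (Suc n)
  have "dirichlet \<rho> (d * P n) = (\<Sum>e<d. \<rho> n ^ e) * dirichlet \<rho> (P n)" if "d \<le> m n" for d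
    using that
  proof (induction d)
    case (Suc d)
    then show ?case
      using dirichlet_add_block[of "P n" n \<rho> d] chi_mult_P[of d n \<rho>]
      by (simp add: algebra_simps)
  qed (simp add: dirichlet_def)
  from this[of "m n"] Suc show ?case by simp
qed (simp add: dirichlet_def)

lemma dirichlet_P_eq_0:
  assumes "\<rho> s ^ m s = 1" "\<rho> s \<noteq> 1" "s < n"
  shows "dirichlet \<rho> (P n) = 0"
  unfolding dirichlet_P_prod using assms geometric_root_sum[OF assms(1,2)]
  by (intro prod_zero) auto

lemma dirichlet_reduce:
  assumes "\<rho> s ^ m s = 1" "\<rho> s \<noteq> 1" "s < n" "b \<le> P n"
  shows "dirichlet \<rho> (a * P n + b) = chi \<rho> (a * P n) * dirichlet \<rho> b"
  using dirichlet_add_block[OF assms(4)] dirichlet_mult_P_eq_0[OF dirichlet_P_eq_0[where \<rho> = \<rho> and s = s, OF assms(1-3)]]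
  by simp

text \<open>Full blocks of length \<open>P (Suc s)\<close> cancel, and the remainder consists of
  fewer than \<open>P (Suc s)\<close> unimodular terms.\<close>

lemma norm_dirichlet_le_P:
  assumes "\<And>k. norm (\<rho> k) = 1" "\<rho> s ^ m s = 1" "\<rho> s \<noteq> 1"
  shows "norm (dirichlet \<rho> k) \<le> real (P (Suc s))"
proof -
  define a where "a = k div P (Suc s)"
  define b where "b = k mod P (Suc s)"
  have b: "b \<le> P (Suc s)" using P_pos[of "Suc s"] unfolding b_def by (intro less_imp_le mod_less_divisor)
  have k: "k = a * P (Suc s) + b" unfolding a_def b_def by (rule div_mult_mod_eq[symmetric])
  have "dirichlet \<rho> k = chi \<rho> (a * P (Suc s)) * dirichlet \<rho> b"
    unfolding k by (rule dirichlet_reduce[where \<rho> = \<rho> and s = s, OF assms(2,3) lessI b])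
  then have "norm (dirichlet \<rho> k) \<le> real b"
    using norm_dirichlet_le[OF assms(1)] by (simp add: norm_mult norm_chi[OF assms(1)])
  with b show ?thesis by linarith
qed

text \<open>The coordinate \<open>s\<close> makes the kernel itself multiplicative over blocks, so
  its running sums obey the same block recursion as the kernel did. The second coordinate
  \<open>t\<close> then supplies a vanishing geometric sum, and only a remainder of at most
  \<open>P (Suc t)\<close> kernels, each at most \<open>P (Suc s)\<close>, survives.\<close>

lemma norm_sum_dirichlet_le:
  assumes "\<And>k. norm (\<rho> k) = 1" "\<rho> s ^ m s = 1" "\<rho> s \<noteq> 1" "\<rho> t ^ m t = 1" "\<rho> t \<noteq> 1" "s < t"
  shows "norm (\<Sum>j<k. dirichlet \<rho> j) \<le> real (P (Suc s)) * real (P (Suc t))"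
proof -
  let ?E = "\<lambda>k. \<Sum>j<k. dirichlet \<rho> j"
  \<comment> \<open>By \<open>dirichlet_reduce\<close> a kernel in the block starting at
    \<open>a * P n\<close> is the kernel of its remainder times one common factor; the condition
    \<open>s < n\<close> is what removes the contribution of the earlier blocks.\<close>
  have red: "?E (a * P n + b) = ?E (a * P n) + chi \<rho> (a * P n) * ?E b"
    if "s < n" "b \<le> P n" for a b n
    unfolding sum_lessThan_add using dirichlet_reduce[where \<rho> = \<rho> and s = s, OF assms(2,3) that(1)] that(2)
    by (simp add: sum_distrib_left)
  have "?E (d * P t) = (\<Sum>e<d. \<rho> t ^ e) * ?E (P t)" if "d \<le> m t" for d
    using that
  proof (induction d)
    case (Suc d)
    then show ?case
      using red[OF \<open>s < t\<close>, of "P t" d] chi_mult_P[of d t \<rho>] by (simp add: algebra_simps)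
  qed simp
  from this[of "m t"] have *: "?E (P (Suc t)) = 0"
    using geometric_root_sum[OF assms(4,5)] by simp
  have st: "s < Suc t" using \<open>s < t\<close> by simp
  have **: "?E (a * P (Suc t)) = 0" for a
  proof (induction a)
    case (Suc a)
    then show ?case
      using red[OF st, of "P (Suc t)" a] * by (simp add: add.commute del: gen_pow.simps)
  qed simp
  define a where "a = k div P (Suc t)"
  define b where "b = k mod P (Suc t)"
  have b: "b \<le> P (Suc t)" using P_pos[of "Suc t"] unfolding b_def by (intro less_imp_le mod_less_divisor)
  have k: "k = a * P (Suc t) + b" unfolding a_def b_def by (rule div_mult_mod_eq[symmetric])
  have "?E k = chi \<rho> (a * P (Suc t)) * ?E b"
    unfolding k red[OF st b] ** by simp
  then have "norm (?E k) = norm (?E b)" by (simp add: norm_mult norm_chi[OF assms(1)])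
  also have "\<dots> \<le> (\<Sum>j<b. real (P (Suc s)))"
    using norm_dirichlet_le_P[where \<rho> = \<rho> and s = s, OF assms(1-3)] by (intro order_trans[OF norm_sum] sum_mono)
  also have "\<dots> \<le> real (P (Suc s)) * real (P (Suc t))"
    using b by (simp add: mult.commute[of "real b"] mult_left_mono del: gen_pow.simps)
  finally show ?thesis .
qed

section \<open>Cells, cell-wise constant functions and martingales\<close>

abbreviation G :: "(nat \<Rightarrow> int) set" where "G \<equiv> carrier (vilenkin_group m)"
abbreviation \<mu> :: "(nat \<Rightarrow> int) measure" where "\<mu> \<equiv> vilenkin_measure m"
abbreviation I :: "nat \<Rightarrow> (nat \<Rightarrow> int) \<Rightarrow> (nat \<Rightarrow> int) set" where "I \<equiv> vilenkin_interval m"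
abbreviation \<F> :: "nat \<Rightarrow> (nat \<Rightarrow> int) measure" where "\<F> \<equiv> vilenkin_algebra m"

sublocale prob_space \<mu>
  using m_ge by (rule prob_space_vilenkin_measure)

section \<open>Cells and their measure\<close>

lemma G_eq: "G = PiE UNIV (\<lambda>k. {0..<int (m k)})"
proof -
  have "m k \<noteq> 0" for k using m_ge[of k] by auto
  then have "carrier (integer_mod_group (m k)) = {0..<int (m k)}" for k
    by (simp add: carrier_integer_mod_group)
  then show ?thesis by (simp add: vilenkin_group_def)
qed

lemma G_iff: "x \<in> G \<longleftrightarrow> (\<forall>k. 0 \<le> x k \<and> x k < int (m k))"
  by (auto simp: G_eq PiE_iff)

lemma mem_I: "y \<in> I n x \<longleftrightarrow> y \<in> G \<and> (\<forall>j<n. y j = x j)"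
  by (simp add: vilenkin_interval_def)

lemma self_mem_I: "x \<in> G \<Longrightarrow> x \<in> I n x"
  by (simp add: mem_I)

lemma I_subset_G: "I n x \<subseteq> G"
  by (auto simp: mem_I)

lemma I_eq: "y \<in> I n x \<Longrightarrow> I n y = I n x"
  by (auto simp: mem_I)

lemma I_antimono: "k \<le> n \<Longrightarrow> I n x \<subseteq> I k x"
  by (auto simp: mem_I)

lemma space_F [simp]: "space (\<F> n) = G"
  by (simp add: vilenkin_algebra_def space_measure_of_conv)

lemma sets_F: "sets (\<F> n) = sigma_sets G (I n ` G)"
  unfolding vilenkin_algebra_def using I_subset_G by (subst sets_measure_of) auto

lemma sets_F_subset: "A \<in> sets (\<F> n) \<Longrightarrow> A \<in> sets \<mu>"
  using subalgebra_vilenkin_algebra[of m n] by (auto simp: subalgebra_def)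

lemma I_in_F: "x \<in> G \<Longrightarrow> I n x \<in> sets (\<F> n)"
  by (auto simp: sets_F)

lemma I_in_sets: "x \<in> G \<Longrightarrow> I n x \<in> sets \<mu>"
  by (rule sets_F_subset[OF I_in_F])

lemma emeasure_I:
  assumes "x \<in> G"
  shows "emeasure \<mu> (I n x) = ennreal (1 / real (P n))"
proof -
  let ?U = "\<lambda>k. uniform_count_measure (carrier (integer_mod_group (m k)))"
  have m0: "m k \<noteq> 0" for k using m_ge[of k] by auto
  have U: "prob_space (?U k)" for k
    using m0 by (intro prob_space_uniform_count_measure) (auto simp: carrier_integer_mod_group)
  then interpret product_prob_space ?U UNIV
    by (simp add: product_prob_space_def product_sigma_finite_def product_prob_space_axioms_def
        prob_space_imp_sigma_finite)
  have c: "carrier (integer_mod_group (m k)) = {0..<int (m k)}" for k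
    using m0 by (simp add: carrier_integer_mod_group)
  have "I n x = prod_emb UNIV ?U {..<n} (PiE {..<n} (\<lambda>j. {x j}))"
    by (auto simp: prod_emb_def mem_I PiE_iff G_eq c space_uniform_count_measure
        restrict_def extensional_def fun_eq_iff)
  moreover have "emeasure (Pi\<^sub>M UNIV ?U) (prod_emb UNIV ?U {..<n} (PiE {..<n} (\<lambda>j. {x j})))
      = (\<Prod>j<n. emeasure (?U j) {x j})"
    using assms by (intro emeasure_PiM_emb) (auto simp: sets_uniform_count_measure c G_iff)
  moreover have "emeasure (?U j) {x j} = ennreal (1 / real (m j))" for j
    using assms by (subst emeasure_uniform_count_measure) (auto simp: c G_iff)
  moreover have "(\<Prod>j<n. ennreal (1 / real (m j))) = ennreal (\<Prod>j<n. 1 / real (m j))"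
    by (rule prod_ennreal) simp
  moreover have "(\<Prod>j<n. 1 / real (m j)) = 1 / real (P n)"
    by (induction n) auto
  ultimately show ?thesis by (simp add: vilenkin_measure_def)
qed

lemma measure_I: "x \<in> G \<Longrightarrow> measure \<mu> (I n x) = 1 / real (P n)"
  by (simp add: emeasure_I measure_def)

lemma finite_cells: "finite (I n ` G)"
proof (rule finite_surj)
  show "finite (PiE {..<n} (\<lambda>k. {0..<int (m k)}))" by (intro finite_PiE) auto
  show "I n ` G \<subseteq> (\<lambda>z. {y \<in> G. \<forall>j<n. y j = z j}) ` PiE {..<n} (\<lambda>k. {0..<int (m k)})"
  proof (safe, rule image_eqI)
    fix x assume "x \<in> G"
    then show "restrict x {..<n} \<in> PiE {..<n} (\<lambda>k. {0..<int (m k)})"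
      by (auto simp: G_iff)
  qed (auto simp: mem_I)
qed

text \<open>Measurability with respect to \<open>\<F> n\<close> in pointwise form: the cells of
  level \<open>n\<close> are finitely many atoms of that algebra. Boundedness, integrability and
  measurability then follow from finiteness.\<close>

definition level :: "nat \<Rightarrow> ((nat \<Rightarrow> int) \<Rightarrow> 'a) \<Rightarrow> bool" where
  "level n f \<longleftrightarrow> (\<forall>x\<in>G. \<forall>y\<in>I n x. f y = f x)"

lemma levelD: "level n f \<Longrightarrow> x \<in> G \<Longrightarrow> y \<in> I n x \<Longrightarrow> f y = f x"
  by (simp add: level_def)

lemma level_mono: "level k f \<Longrightarrow> k \<le> n \<Longrightarrow> level n f"
  unfolding level_def using I_antimono by blast

lemma level_const [simp, intro]: "level n (\<lambda>x. c)"
  by (simp add: level_def)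

lemma level_comp: "level n f \<Longrightarrow> level n (\<lambda>x. h (f x))"
  by (simp add: level_def)

lemma level_comp2: "level n f \<Longrightarrow> level n g \<Longrightarrow> level n (\<lambda>x. h (f x) (g x))"
  by (simp add: level_def)

lemma level_sum: "(\<And>i. i \<in> A \<Longrightarrow> level n (f i)) \<Longrightarrow> level n (\<lambda>x. \<Sum>i\<in>A. f i x)"
  by (simp add: level_def)

lemma level_coord: "j < n \<Longrightarrow> level n (\<lambda>x. x j)"
  by (auto simp: level_def mem_I)

lemma level_I: "x \<in> G \<Longrightarrow> level n (\<lambda>y. y \<in> I n x)"
  by (auto simp: level_def mem_I)

lemma F_set_level:
  assumes "A \<in> sets (\<F> n)"
  shows "level n (\<lambda>x. x \<in> A)"
proof -
  have "A \<in> sigma_sets G (I n ` G)" using assms by (simp add: sets_F)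
  then show ?thesis
  proof induction
    case (Basic a)
    then show ?case by (auto simp: level_I)
  next
    case (Compl a)
    show ?case
      unfolding level_def
    proof (intro ballI)
      fix x y assume xy: "x \<in> G" "y \<in> I n x"
      then have "y \<in> G" using I_subset_G by blast
      with levelD[OF Compl.IH xy] xy(1) show "(y \<in> G - a) = (x \<in> G - a)"
        by blast
    qed
  next
    case (Union a)
    show ?case
      unfolding level_def
    proof (intro ballI)
      fix x y assume xy: "x \<in> G" "y \<in> I n x"
      have "(y \<in> a i) = (x \<in> a i)" for i by (rule levelD[OF Union.IH xy])
      then show "(y \<in> \<Union> (range a)) = (x \<in> \<Union> (range a))" by simp
    qed
  qed simp
qed

text \<open>The preimage of the single value \<open>f x\<close> lies in \<open>\<F> n\<close> and
  contains \<open>x\<close>, hence contains the whole cell of \<open>x\<close>.\<close>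

lemma F_measurable_level:
  fixes f :: "_ \<Rightarrow> complex"
  assumes "f \<in> borel_measurable (\<F> n)"
  shows "level n f"
  unfolding level_def
proof safe
  fix x y assume x: "x \<in> G" and y: "y \<in> I n x"
  have "f -` {f x} \<inter> space (\<F> n) \<in> sets (\<F> n)"
    using assms by (intro measurable_sets[of f _ borel]) auto
  from levelD[OF F_set_level[OF this] x y] x show "f y = f x" by simp
qed

lemma level_measurable_F:
  assumes "level n f" "space N = UNIV"
  shows "f \<in> measurable (\<F> n) N"
proof (rule measurableI)
  fix A
  have "f -` A \<inter> space (\<F> n) = \<Union> (I n ` (f -` A \<inter> G))"
  proof (intro equalityI subsetI)
    fix y assume "y \<in> \<Union> (I n ` (f -` A \<inter> G))"
    then obtain x where "x \<in> G" "f x \<in> A" "y \<in> I n x" by blast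
    with levelD[OF assms(1) this(1,3)] I_subset_G[of n x] show "y \<in> f -` A \<inter> space (\<F> n)"
      by auto
  qed (use self_mem_I in auto)
  also have "\<dots> \<in> sets (\<F> n)"
    using I_in_F by (intro sets.finite_Union finite_subset[OF _ finite_cells[of n]]) auto
  finally show "f -` A \<inter> space (\<F> n) \<in> sets (\<F> n)" .
qed (simp add: assms)

lemma level_measurable:
  assumes "level n f" "space N = UNIV"
  shows "f \<in> measurable \<mu> N"
  using level_measurable_F[OF assms] subalgebra_vilenkin_algebra by (rule measurable_from_subalg[rotated])

lemma level_set: "level n (\<lambda>x. Q x) \<Longrightarrow> {x \<in> G. Q x} \<in> sets \<mu>"
  using measurable_sets[OF level_measurable[of n Q "count_space UNIV"], of "{True}"]
  by (simp add: vimage_def Int_def conj_commute)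

lemma level_finite_range:
  assumes "level n f"
  shows "finite (f ` G)"
proof (rule finite_surj[OF finite_cells[of n]])
  show "f ` G \<subseteq> (\<lambda>C. f (SOME x. x \<in> C)) ` (I n ` G)"
  proof safe
    fix x assume x: "x \<in> G"
    then have "(SOME z. z \<in> I n x) \<in> I n x" by (metis self_mem_I someI)
    from levelD[OF assms x this] x
    show "f x \<in> (\<lambda>C. f (SOME x. x \<in> C)) ` (I n ` G)" by (metis imageI)
  qed
qed

lemma level_bounded:
  fixes f :: "_ \<Rightarrow> 'b::real_normed_vector"
  assumes "level n f"
  obtains B where "\<And>x. x \<in> G \<Longrightarrow> norm (f x) \<le> B"
proof
  have "finite ((\<lambda>x. norm (f x)) ` G)"
    by (rule level_finite_range[OF level_comp[of _ f norm, OF assms]])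
  then show "norm (f x) \<le> Max ((\<lambda>x. norm (f x)) ` G)" if "x \<in> G" for x
    using that by (intro Max_ge) auto
qed

lemma level_integrable:
  fixes f :: "_ \<Rightarrow> 'b::{banach, second_countable_topology}"
  assumes "level n f"
  shows "integrable \<mu> f"
proof -
  obtain B where "\<And>x. x \<in> G \<Longrightarrow> norm (f x) \<le> B" using level_bounded[OF assms] by blast
  then show ?thesis
    using level_measurable[OF assms, of borel] by (intro integrable_const_bound[of _ B]) auto
qed

lemma integral_cell:
  fixes f :: "_ \<Rightarrow> complex"
  assumes "x \<in> G" "\<And>y. y \<in> I n x \<Longrightarrow> f y = c"
  shows "(\<integral>y. indicator (I n x) y *\<^sub>R f y \<partial>\<mu>) = c / real (P n)"
proof -
  have "(\<integral>y. indicator (I n x) y *\<^sub>R f y \<partial>\<mu>) = (\<integral>y. indicator (I n x) y *\<^sub>R c \<partial>\<mu>)"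
    using assms(2) by (intro Bochner_Integration.integral_cong) (auto simp: indicator_def)
  also have "\<dots> = c / real (P n)"
    using assms(1) I_in_sets[OF assms(1), of n] I_subset_G[of n x]
    by (simp add: measure_I scaleR_conv_of_real Int_absorb2)
  finally show ?thesis .
qed

text \<open>On each cell of level \<open>n\<close> the factor \<open>g\<close> is a constant, so the
  integral is a finite combination of the cell integrals of \<open>u\<close>, all of which
  vanish.\<close>

lemma integral_mult_level_eq_0:
  fixes u g :: "_ \<Rightarrow> complex"
  assumes u: "level N u" and g: "level n g"
    and 0: "\<And>x. x \<in> G \<Longrightarrow> (\<integral>y. indicator (I n x) y *\<^sub>R u y \<partial>\<mu>) = 0"
  shows "(\<integral>y. u y * g y \<partial>\<mu>) = 0"
proof -
  have int: "integrable \<mu> (\<lambda>y. indicator C y *\<^sub>R (u y * g y))" if "C \<in> I n ` G" for C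
  proof -
    have "level (max n N) (\<lambda>y. u y * g y)"
      using level_mono[OF u, of "max n N"] level_mono[OF g, of "max n N"] by (auto intro: level_comp2)
    from level_integrable[OF this] show ?thesis
      using that by (intro integrable_mult_indicator) (auto intro: I_in_sets)
  qed
  have "(\<integral>y. u y * g y \<partial>\<mu>) = (\<integral>y. (\<Sum>C\<in>I n ` G. indicator C y *\<^sub>R (u y * g y)) \<partial>\<mu>)"
  proof (rule Bochner_Integration.integral_cong[OF refl])
    fix y assume y: "y \<in> space \<mu>"
    have "(\<Sum>C\<in>I n ` G. indicator C y *\<^sub>R (u y * g y)) = (\<Sum>C\<in>{I n y}. indicator C y *\<^sub>R (u y * g y))"
      using y by (intro sum.mono_neutral_right finite_cells) (auto simp: indicator_def dest: I_eq)
    moreover have "(\<Sum>C\<in>{I n y}. indicator C y *\<^sub>R (u y * g y)) = u y * g y"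
      using self_mem_I[of y n] y by (subst sum.insert) auto
    ultimately show "u y * g y = (\<Sum>C\<in>I n ` G. indicator C y *\<^sub>R (u y * g y))"
      by simp
  qed
  also have "\<dots> = (\<Sum>C\<in>I n ` G. \<integral>y. indicator C y *\<^sub>R (u y * g y) \<partial>\<mu>)"
    using int by (rule Bochner_Integration.integral_sum)
  also have "\<dots> = 0"
  proof (rule sum.neutral, safe)
    fix x assume x: "x \<in> G"
    have "(\<integral>y. indicator (I n x) y *\<^sub>R (u y * g y) \<partial>\<mu>) = (\<integral>y. (indicator (I n x) y *\<^sub>R u y) * g x \<partial>\<mu>)"
      using levelD[OF g x] by (intro Bochner_Integration.integral_cong) (auto simp: indicator_def)
    also have "\<dots> = (\<integral>y. indicator (I n x) y *\<^sub>R u y \<partial>\<mu>) * g x"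
      by (rule integral_mult_left_zero)
    finally show "(\<integral>y. indicator (I n x) y *\<^sub>R (u y * g y) \<partial>\<mu>) = 0"
      using 0[OF x] by simp
  qed
  finally show ?thesis .
qed

text \<open>Cells have positive measure, so on the cell-wise constant representatives the almost-everywhere
  conditional expectation identities become exact identities for cell averages.\<close>

definition cell_martingale :: "(nat \<Rightarrow> (nat \<Rightarrow> int) \<Rightarrow> complex) \<Rightarrow> bool" where
  "cell_martingale f \<longleftrightarrow> (\<forall>n. level n (f n)) \<and>
     (\<forall>n k. \<forall>x\<in>G. n \<le> k \<longrightarrow> (\<integral>y. indicator (I n x) y *\<^sub>R f k y \<partial>\<mu>) = f n x / real (P n))"

lemma martingale_imp_cell_martingale:
  assumes "vilenkin_martingale m f"
  shows "cell_martingale f"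
  unfolding cell_martingale_def
proof (intro conjI allI impI ballI)
  show lev: "level n (f n)" for n
    using assms by (auto simp: vilenkin_martingale_def intro: F_measurable_level)
  fix n k :: nat and x assume x: "x \<in> G" and nk: "n \<le> k"
  interpret sigma_finite_subalgebra \<mu> "\<F> n"
    using subalgebra_vilenkin_algebra[of m n]
    by (intro finite_measure_subalgebra_is_sigma_finite finite_measure_subalgebra.intro
        finite_measure_subalgebra_axioms.intro finite_measure_axioms)
  let ?C = "I n x"
  have sC [measurable]: "?C \<in> sets \<mu>" and sF: "?C \<in> sets (\<F> n)"
    using x by (rule I_in_sets, rule I_in_F)
  have int: "integrable \<mu> (f k)" using assms by (simp add: vilenkin_martingale_def)
  then have intRe: "integrable \<mu> (\<lambda>y. Re (f k y))" and intIm: "integrable \<mu> (\<lambda>y. Im (f k y))"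
    by auto
  have meas: "f n \<in> borel_measurable \<mu>" using level_measurable[OF lev] by simp
  have intC: "integrable \<mu> (\<lambda>y. indicator ?C y *\<^sub>R f j y)" for j
    by (rule integrable_mult_indicator[OF sC level_integrable[OF lev]])
  have ae: "AE y in \<mu>. f n y = Complex (real_cond_exp \<mu> (\<F> n) (\<lambda>y. Re (f k y)) y)
      (real_cond_exp \<mu> (\<F> n) (\<lambda>y. Im (f k y)) y)"
    using assms nk by (simp add: vilenkin_martingale_def)
  \<comment> \<open>The cell belongs to \<open>\<F> n\<close>, so it may serve as the test set in
    the defining identity of the conditional expectation; the exceptional null set is invisible to
    the integrals.\<close>
  have "Re (\<integral>y. indicator ?C y *\<^sub>R f k y \<partial>\<mu>) = (\<integral>y. indicator ?C y *\<^sub>R Re (f k y) \<partial>\<mu>)"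
    using integral_Re[OF intC] by simp
  also have "\<dots> = (\<integral>y. indicator ?C y *\<^sub>R real_cond_exp \<mu> (\<F> n) (\<lambda>y. Re (f k y)) y \<partial>\<mu>)"
    using real_cond_exp_intA[OF intRe sF] by (simp add: set_lebesgue_integral_def)
  also have "\<dots> = (\<integral>y. indicator ?C y *\<^sub>R Re (f n y) \<partial>\<mu>)"
    using ae meas by (intro integral_cong_AE) auto
  also have "\<dots> = Re (\<integral>y. indicator ?C y *\<^sub>R f n y \<partial>\<mu>)"
    using integral_Re[OF intC] by simp
  finally have 1: "Re (\<integral>y. indicator ?C y *\<^sub>R f k y \<partial>\<mu>) = Re (\<integral>y. indicator ?C y *\<^sub>R f n y \<partial>\<mu>)" .
  have "Im (\<integral>y. indicator ?C y *\<^sub>R f k y \<partial>\<mu>) = (\<integral>y. indicator ?C y *\<^sub>R Im (f k y) \<partial>\<mu>)"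
    using integral_Im[OF intC] by simp
  also have "\<dots> = (\<integral>y. indicator ?C y *\<^sub>R real_cond_exp \<mu> (\<F> n) (\<lambda>y. Im (f k y)) y \<partial>\<mu>)"
    using real_cond_exp_intA[OF intIm sF] by (simp add: set_lebesgue_integral_def)
  also have "\<dots> = (\<integral>y. indicator ?C y *\<^sub>R Im (f n y) \<partial>\<mu>)"
    using ae meas by (intro integral_cong_AE) auto
  also have "\<dots> = Im (\<integral>y. indicator ?C y *\<^sub>R f n y \<partial>\<mu>)"
    using integral_Im[OF intC] by simp
  finally have "Im (\<integral>y. indicator ?C y *\<^sub>R f k y \<partial>\<mu>) = Im (\<integral>y. indicator ?C y *\<^sub>R f n y \<partial>\<mu>)" .
  with 1 have "(\<integral>y. indicator ?C y *\<^sub>R f k y \<partial>\<mu>) = (\<integral>y. indicator ?C y *\<^sub>R f n y \<partial>\<mu>)"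
    by (rule complex_eqI)
  also have "\<dots> = f n x / real (P n)"
    using x levelD[OF lev] by (intro integral_cell) auto
  finally show "(\<integral>y. indicator ?C y *\<^sub>R f k y \<partial>\<mu>) = f n x / real (P n)" .
qed

section \<open>Characters on the group and at differences of points\<close>

lemma norm_rademacher [simp]: "norm (gen_rademacher m k x) = 1"
proof -
  have "2 * of_real pi * \<i> * of_int (x k) / of_nat (m k) = \<i> * of_real (2 * pi * x k / m k)"
    by simp
  then show ?thesis unfolding gen_rademacher_def by (simp only: norm_exp_i_times)
qed

lemma norm_vilenkin_fun [simp]: "norm (vilenkin_fun m n x) = 1"
  by (simp add: vilenkin_fun_chi norm_chi)

lemma level_rademacher: "k < n \<Longrightarrow> level n (gen_rademacher m k)"
  unfolding gen_rademacher_def by (rule level_comp[OF level_coord])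

lemma level_vilenkin_fun: "j < P n \<Longrightarrow> level n (vilenkin_fun m j)"
  unfolding level_def vilenkin_fun_chi
  by (intro ballI chi_cong[of j n]) (auto intro: levelD[OF level_rademacher])

text \<open>The pointwise ratio \<open>r\<^sub>k(x) / r\<^sub>k(t)\<close>; characters evaluated at the group difference
  \<open>x - t\<close> are the characters of this sequence.\<close>

definition ratio :: "(nat \<Rightarrow> int) \<Rightarrow> (nat \<Rightarrow> int) \<Rightarrow> nat \<Rightarrow> complex" where
  "ratio x t k = gen_rademacher m k x * cnj (gen_rademacher m k t)"

lemma ratio_exp: "ratio x t k = exp (2 * of_real pi * \<i> * of_int (x k - t k) / of_nat (m k))"
proof -
  have "cnj (gen_rademacher m k t) = exp (- (2 * of_real pi * \<i> * of_int (t k) / of_nat (m k)))"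
    unfolding gen_rademacher_def exp_cnj by simp
  then have "ratio x t k = exp (2 * of_real pi * \<i> * of_int (x k) / of_nat (m k)
      + - (2 * of_real pi * \<i> * of_int (t k) / of_nat (m k)))"
    unfolding ratio_def gen_rademacher_def by (simp only: exp_add)
  then show ?thesis
    by (simp add: diff_divide_distrib right_diff_distrib)
qed

lemma norm_ratio [simp]: "norm (ratio x t k) = 1"
  by (simp add: ratio_def norm_mult)

lemma ratio_power: "ratio x t k ^ m k = 1"
proof -
  have "m k \<noteq> 0" using m_ge[of k] by auto
  then have "ratio x t k ^ m k = exp (2 * of_real pi * \<i> * of_int (x k - t k))"
    unfolding ratio_exp exp_of_nat_mult[symmetric] by simp
  also have "\<dots> = 1" unfolding exp_eq_1 by (intro conjI exI[of _ "x k - t k"]) auto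
  finally show ?thesis .
qed

text \<open>Both coordinates lie in \<open>{0..<int (m k)}\<close>, so their difference is smaller
  than \<open>m k\<close> in modulus and cannot be a nonzero multiple of \<open>m k\<close>.\<close>

lemma ratio_neq_1:
  assumes "x \<in> G" "t \<in> G" "x k \<noteq> t k"
  shows "ratio x t k \<noteq> 1"
proof
  have m: "real (m k) > 0" using m_ge[of k] by auto
  assume "ratio x t k = 1"
  then obtain n :: int where "2 * pi * (x k - t k) / m k = of_int (2 * n) * pi"
    unfolding ratio_exp exp_eq_1 by auto
  then have "real_of_int (x k - t k) = real_of_int (n * int (m k))"
    using m pi_neq_zero by (simp add: divide_eq_eq mult.commute mult.left_commute)
  then have eq: "x k - t k = n * int (m k)" by linarith
  have bd: "\<bar>x k - t k\<bar> < int (m k)" using assms(1,2) unfolding G_iff by (smt (verit))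
  have "1 \<le> \<bar>n\<bar>" using eq assms(3) by (cases "n = 0") auto
  then have "1 * int (m k) \<le> \<bar>n\<bar> * int (m k)" by (intro mult_right_mono) auto
  with bd show False unfolding eq abs_mult by simp
qed

lemma chi_ratio: "vilenkin_fun m n x * cnj (vilenkin_fun m n t) = chi (ratio x t) n"
  by (simp add: vilenkin_fun_chi cnj_chi chi_mult ratio_def[abs_def])

section \<open>Logarithmic sums of partial sums\<close>

lemma two_power_le_P_real: "2 ^ k \<le> real (P k)"
  using two_power_le_P[of k] by (metis of_nat_le_iff of_nat_numeral of_nat_power)

lemma integral_norm_le_cell:
  fixes g :: "_ \<Rightarrow> complex"
  assumes c: "c \<in> G" and g: "\<And>t. t \<in> I n c \<Longrightarrow> norm (g t) \<le> B"
    and 0: "\<And>t. t \<in> G \<Longrightarrow> t \<notin> I n c \<Longrightarrow> g t = 0"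
  shows "norm (\<integral>t. g t \<partial>\<mu>) \<le> B / real (P n)"
proof -
  have B: "0 \<le> B" using g[OF self_mem_I[OF c]] norm_ge_zero order_trans by blast
  have "norm (\<integral>t. g t \<partial>\<mu>) \<le> (\<integral>t. norm (g t) \<partial>\<mu>)" by (rule integral_norm_bound)
  also have "\<dots> \<le> (\<integral>t. indicator (I n c) t * B \<partial>\<mu>)"
  proof (rule integral_mono')
    show "integrable \<mu> (\<lambda>t. indicator (I n c) t * B)"
      using I_in_sets[OF c, of n] by (intro integrable_mult_left integrable_real_indicator) (auto simp: less_top[symmetric])
  qed (use g 0 B in \<open>auto simp: indicator_def\<close>)
  also have "\<dots> = B / real (P n)"
    using c I_subset_G[of n c] by (simp add: measure_I Int_absorb2)
  finally show ?thesis .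
qed

section \<open>Partial sums and logarithmic sums of a cell-wise constant function\<close>

lemma level_dirichlet: "k \<le> P n \<Longrightarrow> level n (\<lambda>t. dirichlet (ratio x t) k)"
  unfolding dirichlet_def chi_ratio[symmetric]
  by (intro level_sum level_comp[where h = "\<lambda>z. _ * cnj z"] level_vilenkin_fun) auto

text \<open>The version of \<open>vilenkin_partial_sum\<close> for a function: coefficients are
  integrals instead of limits along a martingale. The two agree on \<open>f N\<close> up to order
  \<open>P N\<close>, see \<open>vilenkin_partial_sum_eq\<close>.\<close>

definition psum :: "((nat \<Rightarrow> int) \<Rightarrow> complex) \<Rightarrow> nat \<Rightarrow> (nat \<Rightarrow> int) \<Rightarrow> complex" where
  "psum F k x = (\<Sum>j<k. (\<integral>t. F t * cnj (vilenkin_fun m j t) \<partial>\<mu>) * vilenkin_fun m j x)"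

definition lsum :: "nat \<Rightarrow> ((nat \<Rightarrow> int) \<Rightarrow> complex) \<Rightarrow> (nat \<Rightarrow> int) \<Rightarrow> complex" where
  "lsum q F x = (\<Sum>k=1..q. psum F k x / of_nat k)"

lemma level_mult_cnj_vilenkin:
  fixes F :: "_ \<Rightarrow> complex"
  assumes "level N F"
  shows "level (max N j) (\<lambda>t. F t * cnj (vilenkin_fun m j t))"
proof -
  have "level (max N j) F" using assms by (rule level_mono) simp
  moreover have "level (max N j) (vilenkin_fun m j)"
    by (rule level_mono[OF level_vilenkin_fun[OF less_P]]) simp
  ultimately show ?thesis by (rule level_comp2)
qed

lemma psum_dirichlet:
  assumes "level N F"
  shows "psum F k x = (\<integral>t. F t * dirichlet (ratio x t) k \<partial>\<mu>)"
proof -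
  have "psum F k x = (\<Sum>j<k. \<integral>t. F t * cnj (vilenkin_fun m j t) * vilenkin_fun m j x \<partial>\<mu>)"
    by (simp add: psum_def)
  also have "\<dots> = (\<integral>t. (\<Sum>j<k. F t * cnj (vilenkin_fun m j t) * vilenkin_fun m j x) \<partial>\<mu>)"
    by (intro Bochner_Integration.integral_sum[symmetric] integrable_mult_left
        level_integrable[OF level_mult_cnj_vilenkin[OF assms]])
  also have "\<dots> = (\<integral>t. F t * dirichlet (ratio x t) k \<partial>\<mu>)"
    by (simp add: dirichlet_def chi_ratio[symmetric] sum_distrib_left mult.assoc mult.commute mult.left_commute)
  finally show ?thesis .
qed

lemma level_mult_dirichlet:
  fixes F :: "_ \<Rightarrow> complex"
  assumes "level N F"
  shows "level (max N k) (\<lambda>t. F t * dirichlet (ratio x t) k)"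
proof -
  have "level (max N k) F" using assms by (rule level_mono) simp
  moreover have "level (max N k) (\<lambda>t. dirichlet (ratio x t) k)"
    by (rule level_mono[OF level_dirichlet[of k k]]) (use less_P[of k] in auto)
  ultimately show ?thesis by (rule level_comp2)
qed

lemma psum_add:
  assumes "level N F" "level N H"
  shows "psum (\<lambda>t. F t + H t) k x = psum F k x + psum H k x"
proof -
  have "(\<integral>t. (F t + H t) * cnj (vilenkin_fun m j t) \<partial>\<mu>) =
      (\<integral>t. F t * cnj (vilenkin_fun m j t) \<partial>\<mu>) + (\<integral>t. H t * cnj (vilenkin_fun m j t) \<partial>\<mu>)" for j
    unfolding distrib_right
    by (intro Bochner_Integration.integral_add level_integrable[OF level_mult_cnj_vilenkin]; fact assms)
  then show ?thesis by (simp add: psum_def distrib_right sum.distrib)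
qed

lemma lsum_add:
  assumes "level N F" "level N H"
  shows "lsum q (\<lambda>t. F t + H t) x = lsum q F x + lsum q H x"
  by (simp add: lsum_def psum_add[OF assms] add_divide_distrib sum.distrib)

lemma lsum_zero [simp]: "lsum q (\<lambda>t. 0) x = 0"
  by (simp add: lsum_def psum_def)

lemma lsum_cong: "(\<And>t. t \<in> G \<Longrightarrow> F t = F' t) \<Longrightarrow> lsum q F x = lsum q F' x"
  unfolding lsum_def psum_def
  by (intro sum.cong arg_cong2[where f = "(/)"] arg_cong2[where f = "(*)"] refl Bochner_Integration.integral_cong) auto

lemma lsum_sum:
  assumes "finite A" "\<And>i. i \<in> A \<Longrightarrow> level N (F i)"
  shows "lsum q (\<lambda>t. \<Sum>i\<in>A. F i t) x = (\<Sum>i\<in>A. lsum q (F i) x)"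
  using assms
proof (induction A rule: finite_induct)
  case (insert i A)
  then have "level N (\<lambda>t. \<Sum>i\<in>A. F i t)" by (intro level_sum) auto
  with insert show ?case by (simp add: lsum_add[of N])
qed simp

lemma level_lsum: "q \<le> P N \<Longrightarrow> level N (lsum q F)"
  unfolding lsum_def psum_def
  by (intro level_sum level_comp[where h = "\<lambda>z. z / _"] level_comp[where h = "\<lambda>z. _ * z"] level_vilenkin_fun) auto

lemma norm_dirichlet_ratio_le:
  assumes "x \<in> G" "t \<in> G" "x s \<noteq> t s"
  shows "norm (dirichlet (ratio x t) k) \<le> real R * real (P s)"
proof -
  have "norm (dirichlet (ratio x t) k) \<le> real (P (Suc s))"
    using ratio_neq_1[OF assms] by (intro norm_dirichlet_le_P) (auto simp: ratio_power)
  also have "\<dots> \<le> real R * real (P s)"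
    using P_Suc_le[of s] by (metis of_nat_le_iff of_nat_mult)
  finally show ?thesis .
qed

text \<open>The factor 2 comes from writing a sum that starts at \<open>Suc a\<close> as the
  difference of two initial sums.\<close>

lemma norm_sum_dirichlet_ratio_le:
  assumes "x \<in> G" "t \<in> G" "x s \<noteq> t s" "x u \<noteq> t u" "s < u"
  shows "norm (\<Sum>j=Suc a..k. dirichlet (ratio x t) j) \<le> 2 * (real R)\<^sup>2 * real (P s) * real (P u)"
proof -
  have *: "norm (\<Sum>j<k. dirichlet (ratio x t) j) \<le> (real R)\<^sup>2 * real (P s) * real (P u)" for k
  proof -
    have "norm (\<Sum>j<k. dirichlet (ratio x t) j) \<le> real (P (Suc s)) * real (P (Suc u))"
      using ratio_neq_1[OF assms(1-3)] ratio_neq_1[OF assms(1,2,4)] assms(5)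
      by (intro norm_sum_dirichlet_le) (auto simp: ratio_power)
    also have "\<dots> \<le> (real R * real (P s)) * (real R * real (P u))"
      using P_Suc_le[of s] P_Suc_le[of u] unfolding of_nat_mult[symmetric] of_nat_le_iff by (rule mult_le_mono)
    finally show ?thesis by (simp add: power2_eq_square mult_ac)
  qed
  show ?thesis
  proof (cases "Suc a \<le> k")
    case True
    have split: "{..<Suc k} = {..<Suc a} \<union> {Suc a..k}" using True by auto
    have "(\<Sum>j=Suc a..k. dirichlet (ratio x t) j) =
        (\<Sum>j<Suc k. dirichlet (ratio x t) j) - (\<Sum>j<Suc a. dirichlet (ratio x t) j)"
      unfolding split by (subst sum.union_disjoint) auto
    show ?thesis
      unfolding \<open>(\<Sum>j=Suc a..k. dirichlet (ratio x t) j) = _\<close>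
      using norm_triangle_ineq4[of "\<Sum>j<Suc k. dirichlet (ratio x t) j" "\<Sum>j<Suc a. dirichlet (ratio x t) j"]
        *[of "Suc k"] *[of "Suc a"] by linarith
  qed simp
qed

text \<open>Where \<open>t\<close> first leaves the coordinates of \<open>x\<close> at
  \<open>s\<close>, the kernel is at most both \<open>k\<close> and \<open>R * P s\<close>.
  Interpolating these bounds and using the measure \<open>1 / P s\<close> of the cell leaves the
  convergent series of \<open>P s powr - d\<close>. Any small power of \<open>k\<close> suffices
  later, so no logarithmic bound is sought.\<close>

lemma dirichlet_L1_bound:
  assumes d: "0 < d" "d \<le> 1" and x: "x \<in> G" and k: "1 \<le> k"
  shows "(\<integral>t. norm (dirichlet (ratio x t) k) \<partial>\<mu>) \<le> (real R / (1 - 2 powr - d) + 1) * real k powr d"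
proof -
  let ?z = "2 powr - d :: real"
  have z: "0 \<le> ?z" "?z < 1" using d by (auto simp: powr_less_one)
  let ?b = "\<lambda>s. real R * real k powr d * real (P s) powr (1 - d)"
  \<comment> \<open>The kernel index \<open>k\<close> also serves as cut-off depth: the innermost
    cell \<open>I k x\<close> has measure \<open>1 / P k\<close>, less than \<open>1 / k\<close>, so
    the trivial bound \<open>k\<close> on it contributes at most 1.\<close>
  have pt: "norm (dirichlet (ratio x t) k) \<le> (\<Sum>s<k. indicator (I s x) t * ?b s) + indicator (I k x) t * real k"
    if t: "t \<in> G" for t
  proof (cases "t \<in> I k x")
    case True
    have "norm (dirichlet (ratio x t) k) \<le> real k" by (rule norm_dirichlet_le) simp
    also have "\<dots> \<le> (\<Sum>s<k. indicator (I s x) t * ?b s) + real k" by (simp add: sum_nonneg)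
    finally show ?thesis using True by simp
  next
    case False
    then have ex: "\<exists>s. s < k \<and> t s \<noteq> x s" using t by (auto simp: mem_I)
    define s where "s = (LEAST s. s < k \<and> t s \<noteq> x s)"
    have s: "s < k" "t s \<noteq> x s" using LeastI_ex[OF ex] by (auto simp: s_def)
    have "t j = x j" if "j < s" for j
      using not_less_Least[of j "\<lambda>s. s < k \<and> t s \<noteq> x s"] that s(1) by (auto simp: s_def)
    then have tI: "t \<in> I s x" using t by (simp add: mem_I)
    let ?D = "norm (dirichlet (ratio x t) k)"
    have D1: "?D \<le> real k" by (rule norm_dirichlet_le) simp
    have D2: "?D \<le> real R * real (P s)" using norm_dirichlet_ratio_le[OF x t] s(2) by metis
    have "?D \<le> ?b s"
    proof (cases "?D = 0")
      case False
      \<comment> \<open>Interpolation: the exponent \<open>d\<close> is spent on the bound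
        \<open>k\<close> and the exponent \<open>1 - d\<close> on the bound
        \<open>R * P s\<close>.\<close>
      then have "?D = ?D powr d * ?D powr (1 - d)" by (simp add: powr_add[symmetric])
      also have "\<dots> \<le> real k powr d * (real R * real (P s)) powr (1 - d)"
        using D1 D2 d by (intro mult_mono powr_mono2) auto
      also have "\<dots> = real k powr d * (real R powr (1 - d) * real (P s) powr (1 - d))"
        by (simp add: powr_mult)
      also have "\<dots> \<le> real k powr d * (real R * real (P s) powr (1 - d))"
        using R_ge d powr_mono[of "1 - d" 1 "real R"] by (intro mult_left_mono mult_right_mono) auto
      finally show ?thesis by (simp add: mult_ac)
    qed simp
    also have "?b s = indicator (I s x) t * ?b s" using tI by simp
    also have "\<dots> \<le> (\<Sum>s<k. indicator (I s x) t * ?b s)"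
      using s(1) by (intro member_le_sum[of s "{..<k}" "\<lambda>s. indicator (I s x) t * ?b s"]) auto
    finally show ?thesis using False by simp
  qed
  have intI: "integrable \<mu> (\<lambda>t. indicator (I s x) t * (c::real))" for s c
    using I_in_sets[OF x, of s] by (intro integrable_mult_left integrable_real_indicator) (auto simp: less_top[symmetric])
  have "(\<integral>t. norm (dirichlet (ratio x t) k) \<partial>\<mu>) \<le>
      (\<integral>t. (\<Sum>s<k. indicator (I s x) t * ?b s) + indicator (I k x) t * real k \<partial>\<mu>)"
  proof (rule integral_mono')
    show "integrable \<mu> (\<lambda>t. (\<Sum>s<k. indicator (I s x) t * ?b s) + indicator (I k x) t * real k)"
      by (intro Bochner_Integration.integrable_add Bochner_Integration.integrable_sum intI)
  qed (use pt in \<open>auto intro!: add_nonneg_nonneg sum_nonneg simp del: sum_indicator_mult\<close>)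
  also have "\<dots> = (\<Sum>s<k. ?b s / real (P s)) + real k / real (P k)"
  proof -
    have "(\<integral>t. indicator (I s x) t * c \<partial>\<mu>) = c / real (P s)" for s and c :: real
      using x I_subset_G[of s x] by (simp add: measure_I Int_absorb2)
    then show ?thesis
      by (simp only: Bochner_Integration.integral_add Bochner_Integration.integral_sum
          Bochner_Integration.integrable_sum intI)
  qed
  also have "\<dots> \<le> (\<Sum>s<k. real R * real k powr d * ?z ^ s) + 1"
  proof (intro add_mono sum_mono)
    fix s
    have "real (P s) powr (1 - d) / real (P s) = real (P s) powr ((1 - d) - 1)"
      unfolding powr_diff[of _ "1 - d" 1] by simp
    also have "\<dots> = real (P s) powr - d" by simp
    also have "\<dots> \<le> (2 ^ s) powr - d"
      using two_power_le_P_real[of s] d by (intro powr_mono2') auto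
    also have "\<dots> = ?z ^ s" by (simp add: powr_powr powr_realpow[symmetric] mult.commute)
    finally have "real (P s) powr (1 - d) / real (P s) \<le> ?z ^ s" .
    then have "(real R * real k powr d) * (real (P s) powr (1 - d) / real (P s)) \<le> (real R * real k powr d) * ?z ^ s"
      by (rule mult_left_mono) simp
    then show "?b s / real (P s) \<le> real R * real k powr d * ?z ^ s" by simp
    show "real k / real (P k) \<le> 1" using less_P[of k] by simp
  qed
  also have "\<dots> \<le> real R * real k powr d * (1 / (1 - ?z)) + 1 * real k powr d"
    unfolding sum_distrib_left[symmetric] using k d sum_power_le[OF z, of "{..<k}"]
    by (intro add_mono mult_left_mono) (auto simp: ge_one_powr_ge_zero)
  finally show ?thesis by (simp add: algebra_simps)
qed

text \<open>This bound for bounded functions handles the two places without cancellation, the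
  support of an atom and the initial term \<open>f 0\<close>; with exponent \<open>eps\<close> the
  weight absorbs the growth exactly.\<close>

lemma lsum_bounded:
  assumes e: "0 < e"
  obtains C where "0 < C" and "\<And>N F A x q. \<lbrakk>level N F; \<And>t. t \<in> G \<Longrightarrow> norm (F t) \<le> A; x \<in> G; 1 \<le> q\<rbrakk>
    \<Longrightarrow> norm (lsum q F x) \<le> C * A * (real q + 1) powr e"
proof -
  \<comment> \<open>One share \<open>d\<close> pays for the L1 norm of the kernel and one for the
    harmonic sum, whence \<open>2 * d \<le> e\<close>; the interpolation in
    \<open>dirichlet_L1_bound\<close> requires \<open>d \<le> 1\<close>.\<close>
  define d where "d = min (e / 2) 1"
  have d: "0 < d" "d \<le> 1" "2 * d \<le> e" using e by (auto simp: d_def)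
  define C0 where "C0 = real R / (1 - 2 powr - d) + 1"
  have "2 powr - d < (1::real)" using d by (simp add: powr_less_one)
  then have C0: "0 < C0" unfolding C0_def by (intro add_nonneg_pos divide_nonneg_pos) auto
  have bound: "norm (lsum q F x) \<le> C0 * (1 + 1 / d) * A * (real q + 1) powr e"
    if F: "level N F" "\<And>t. t \<in> G \<Longrightarrow> norm (F t) \<le> A" and x: "x \<in> G" and q: "1 \<le> q" for N F A x q
  proof -
    have A: "0 \<le> A" using F(2)[OF x] norm_ge_zero order_trans by blast
    have ps: "norm (psum F k x) \<le> A * (C0 * real k powr d)" if k: "1 \<le> k" for k
    proof -
      have "norm (psum F k x) \<le> (\<integral>t. norm (F t * dirichlet (ratio x t) k) \<partial>\<mu>)"
        unfolding psum_dirichlet[OF F(1)] by (rule integral_norm_bound)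
      also have "\<dots> \<le> (\<integral>t. A * norm (dirichlet (ratio x t) k) \<partial>\<mu>)"
        using F(2) A level_integrable[OF level_dirichlet[OF less_imp_le[OF less_P[of k]], of x]]
        by (intro integral_mono') (auto simp: norm_mult mult_right_mono)
      also have "\<dots> \<le> A * (C0 * real k powr d)"
        using dirichlet_L1_bound[OF d(1,2) x k] A by (simp add: C0_def mult_left_mono)
      finally show ?thesis .
    qed
    have q0: "0 < real q" using q by simp
    have "norm (lsum q F x) \<le> (\<Sum>k=1..q. norm (psum F k x / of_nat k))"
      unfolding lsum_def by (rule norm_sum)
    also have "\<dots> \<le> (\<Sum>k=1..q. A * C0 * real q powr d * (1 / real k))"
    proof (rule sum_mono)
      fix k assume k: "k \<in> {1..q}"
      have "norm (psum F k x) \<le> A * (C0 * real k powr d)" using ps k by simp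
      also have "\<dots> \<le> A * (C0 * real q powr d)"
        using A C0 d k by (intro mult_left_mono powr_mono2) auto
      finally show "norm (psum F k x / of_nat k) \<le> A * C0 * real q powr d * (1 / real k)"
        by (simp add: norm_divide divide_right_mono mult.assoc)
    qed
    also have "\<dots> = A * C0 * real q powr d * harm q"
      by (simp add: harm_def sum_distrib_left inverse_eq_divide)
    also have "\<dots> \<le> A * C0 * real q powr d * ((1 + 1 / d) * real q powr d)"
    proof (rule mult_left_mono)
      have "harm q \<le> 1 + real q powr d / d"
        using harm_le_ln[OF q] ln_powr_bound[of "real q" d] q d by simp
      also have "1 \<le> real q powr d" using q d by (simp add: ge_one_powr_ge_zero)
      finally show "harm q \<le> (1 + 1 / d) * real q powr d" by (simp add: algebra_simps)
    qed (use A C0 in simp)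
    also have "\<dots> = C0 * (1 + 1 / d) * A * real q powr (2 * d)"
      by (simp add: powr_add[symmetric] mult_ac)
    also have "\<dots> \<le> C0 * (1 + 1 / d) * A * (real q + 1) powr e"
    proof (rule mult_left_mono)
      have "real q powr (2 * d) \<le> (real q + 1) powr (2 * d)" using d by (intro powr_mono2) auto
      also have "\<dots> \<le> (real q + 1) powr e" using d by (intro powr_mono) auto
      finally show "real q powr (2 * d) \<le> (real q + 1) powr e" .
    qed (use A C0 d in simp)
    finally show ?thesis .
  qed
  have "0 < C0 * (1 + 1 / d)" using C0 d by (intro mult_pos_pos add_pos_pos) auto
  from that[OF this bound] show thesis .
qed

section \<open>Atoms\<close>

text \<open>The height \<open>A\<close> is a free parameter and not normalised to the measure of the
  cell, so the pieces of a martingale are atoms without rescaling.\<close>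

definition atom :: "nat \<Rightarrow> (nat \<Rightarrow> int) \<Rightarrow> real \<Rightarrow> ((nat \<Rightarrow> int) \<Rightarrow> complex) \<Rightarrow> bool" where
  "atom n c A a \<longleftrightarrow> c \<in> G \<and> (\<exists>N. level N a) \<and> (\<forall>t\<in>G. t \<notin> I n c \<longrightarrow> a t = 0) \<and>
     (\<forall>t\<in>G. norm (a t) \<le> A) \<and> (\<integral>t. a t \<partial>\<mu>) = 0"

text \<open>Characters of index below \<open>P n\<close> are constant on the supporting cell, so
  their coefficients are multiples of the mean of the atom.\<close>

lemma atom_psum_eq_0:
  assumes a: "atom n c A a" and k: "k \<le> P n"
  shows "psum a k x = 0"
proof -
  have "(\<integral>t. a t * cnj (vilenkin_fun m j t) \<partial>\<mu>) = 0" if "j < k" for j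
  proof -
    have "level n (vilenkin_fun m j)" using that k by (intro level_vilenkin_fun) simp
    then have "(\<integral>t. a t * cnj (vilenkin_fun m j t) \<partial>\<mu>) = (\<integral>t. a t * cnj (vilenkin_fun m j c) \<partial>\<mu>)"
      using a by (intro Bochner_Integration.integral_cong) (auto simp: atom_def level_def)
    also have "\<dots> = 0" using a by (simp add: atom_def)
    finally show ?thesis .
  qed
  then show ?thesis by (simp add: psum_def)
qed

lemma atom_lsum:
  assumes a: "atom n c A a"
  shows "lsum q a x = (\<integral>t. a t * (\<Sum>k=Suc (P n)..q. dirichlet (ratio x t) k / of_nat k) \<partial>\<mu>)"
proof -
  obtain N where N: "level N a" using a by (auto simp: atom_def)
  have "lsum q a x = (\<Sum>k=Suc (P n)..q. psum a k x / of_nat k)"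
    unfolding lsum_def using atom_psum_eq_0[OF a] by (intro sum.mono_neutral_right) (auto simp: not_less_eq_eq)
  also have "\<dots> = (\<Sum>k=Suc (P n)..q. \<integral>t. a t * dirichlet (ratio x t) k / of_nat k \<partial>\<mu>)"
    by (simp add: psum_dirichlet[OF N])
  also have "\<dots> = (\<integral>t. (\<Sum>k=Suc (P n)..q. a t * dirichlet (ratio x t) k / of_nat k) \<partial>\<mu>)"
    by (intro Bochner_Integration.integral_sum[symmetric] integrable_divide
        level_integrable[OF level_mult_dirichlet[OF N]])
  finally show ?thesis by (simp add: sum_distrib_left)
qed

lemma atom_lsum_bound:
  assumes a: "atom n c A a"
    and X: "\<And>t. t \<in> I n c \<Longrightarrow> norm (\<Sum>k=Suc (P n)..q. dirichlet (ratio x t) k / of_nat k) \<le> X"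
  shows "norm (lsum q a x) \<le> A * X / real (P n)"
  unfolding atom_lsum[OF a]
proof (rule integral_norm_le_cell)
  show c: "c \<in> G" using a by (simp add: atom_def)
  fix t assume t: "t \<in> I n c"
  then have "norm (a t) \<le> A" using a subsetD[OF I_subset_G, of t n c] by (auto simp: atom_def)
  then show "norm (a t * (\<Sum>k=Suc (P n)..q. dirichlet (ratio x t) k / of_nat k)) \<le> A * X"
    unfolding norm_mult using X[OF t] by (intro mult_mono) (auto intro: order_trans[OF norm_ge_zero])
qed (use a in \<open>auto simp: atom_def\<close>)

text \<open>An outer approximation of the points whose first two differences from \<open>c\<close>
  are at \<open>s\<close> and \<open>t\<close>: membership does not force a difference at either
  place.\<close>

definition Eset :: "nat \<Rightarrow> nat \<Rightarrow> (nat \<Rightarrow> int) \<Rightarrow> (nat \<Rightarrow> int) set" where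
  "Eset s t c = {x \<in> G. \<forall>j<t. j \<noteq> s \<longrightarrow> x j = c j}"

lemma Eset_sets: "Eset s t c \<in> sets \<mu>"
  unfolding Eset_def by (rule level_set[of t]) (auto simp: level_def mem_I)

text \<open>Fixing the free coordinate \<open>s\<close> in its \<open>m s \<le> R\<close> possible
  ways covers the set by that many cells of level \<open>t\<close>.\<close>

lemma emeasure_Eset:
  assumes c: "c \<in> G" and st: "s < t"
  shows "emeasure \<mu> (Eset s t c) \<le> ennreal (real R / real (P t))"
proof -
  have upd: "c(s := int u) \<in> G" if "u < m s" for u
    using c that by (auto simp: G_iff)
  have sub: "Eset s t c \<subseteq> (\<Union>u<m s. I t (c(s := int u)))"
  proof
    fix x assume x: "x \<in> Eset s t c"
    then have "0 \<le> x s" "x s < int (m s)" by (auto simp: Eset_def G_iff)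
    then have "nat (x s) < m s" "x \<in> I t (c(s := int (nat (x s))))"
      using x by (auto simp: Eset_def mem_I)
    then show "x \<in> (\<Union>u<m s. I t (c(s := int u)))" by blast
  qed
  have "emeasure \<mu> (Eset s t c) \<le> emeasure \<mu> (\<Union>u<m s. I t (c(s := int u)))"
    using upd I_in_sets by (intro emeasure_mono sub) auto
  also have "\<dots> \<le> (\<Sum>u<m s. emeasure \<mu> (I t (c(s := int u))))"
    using upd I_in_sets by (intro emeasure_subadditive_finite) auto
  also have "\<dots> = (\<Sum>u<m s. ennreal (1 / real (P t)))"
    using upd by (intro sum.cong) (auto simp: emeasure_I)
  also have "\<dots> = ennreal (real (m s) / real (P t))"
    by (simp add: ennreal_of_nat_eq_real_of_nat ennreal_mult'[symmetric])
  also have "\<dots> \<le> ennreal (real R / real (P t))"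
    using m_le[of s] by (intro ennreal_leI divide_right_mono) auto
  finally show ?thesis .
qed

end

section \<open>The weighted operator on a single atom\<close>

locale vilenkin_exponent = vilenkin +
  fixes p :: real
  assumes p_pos: "0 < p" and p_less: "p < 1 / 2"
begin

abbreviation eps :: real where "eps \<equiv> 1 / p - 2"

lemma eps_pos: "0 < eps"
  using p_pos p_less by (simp add: field_simps)

text \<open>Neither the logarithm nor the normalisation \<open>1 / l\<^sub>n\<close> of the Riesz mean appears here or in
  \<open>lsum\<close>: since \<open>ln (n + 1) \<le> l\<^sub>n\<close>, the two cancel.\<close>

definition weight :: "nat \<Rightarrow> real" where
  "weight q = (real q + 1) powr - eps"

lemma weight_nonneg [simp]: "0 \<le> weight q"
  by (simp add: weight_def)

text \<open>The summand for the pair \<open>(s, t)\<close> is attained where \<open>x - c\<close> has its first two nonzero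
  coordinates at \<open>s < t\<close>; the index \<open>t = n\<close> stands for the absence of a second one below \<open>n\<close>.\<close>

definition atom_majorant :: "nat \<Rightarrow> (nat \<Rightarrow> int) \<Rightarrow> (nat \<Rightarrow> int) \<Rightarrow> real" where
  "atom_majorant n c x = indicator (I n c) x +
     (\<Sum>(s, t)\<in>(SIGMA s:{..<n}. {s<..n}). real (P s) * real (P t) * real (P n) powr (- 1 / p) * indicator (Eset s t c) x)"

text \<open>All points of the support share the first \<open>n\<close> coordinates of
  \<open>c\<close>, so \<open>x\<close> differs from each of them first at the same places below
  \<open>n\<close>; kernel bounds are therefore uniform over the support. The two summands of the
  constant belong to the two cases: a second difference below \<open>n\<close>, or none.\<close>

lemma atom_off_support:
  assumes a: "atom n c A a" and x: "x \<in> G" "x \<notin> I n c"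
  obtains s t where "s < t" "t \<le> n" "x \<in> Eset s t c"
    "\<And>q. weight q * norm (lsum q a x) \<le>
       (2 * (real R)\<^sup>2 + real R / eps) * A * (real (P s) * real (P t) * real (P n) powr (- 1 / p))"
proof -
  have c: "c \<in> G" using a by (simp add: atom_def)
  have A: "0 \<le> A" using a c norm_ge_zero order_trans unfolding atom_def by blast
  have ex: "\<exists>s. s < n \<and> x s \<noteq> c s" using x by (auto simp: mem_I)
  define s where "s = (LEAST s. s < n \<and> x s \<noteq> c s)"
  have s: "s < n" "x s \<noteq> c s" using LeastI_ex[OF ex] by (auto simp: s_def)
  have s_min: "x j = c j" if "j < s" for j
    using not_less_Least[of j "\<lambda>s. s < n \<and> x s \<noteq> c s"] that s(1) by (auto simp: s_def)
  have cG: "t \<in> G" "\<And>j. j < n \<Longrightarrow> t j = c j" if "t \<in> I n c" for t using that by (auto simp: mem_I)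
  let ?C = "2 * (real R)\<^sup>2 + real R / eps"
  have q_small: "weight q * norm (lsum q a x) \<le> ?C * A * (real (P s) * real (P t) * real (P n) powr (- 1 / p))"
    if "q \<le> P n" for q t
  proof -
    have "lsum q a x = 0" using that unfolding atom_lsum[OF a] by simp
    then show ?thesis using A eps_pos by simp
  qed
  define B where "B = real (P n)"
  have B: "B \<ge> 1" "B > 0" using P_ge_1[of n] by (auto simp: B_def)
  show thesis
  proof (cases "\<exists>t. s < t \<and> t < n \<and> x t \<noteq> c t")
    case True
    define t where "t = (LEAST t. s < t \<and> t < n \<and> x t \<noteq> c t)"
    have t: "s < t" "t < n" "x t \<noteq> c t" using LeastI_ex[OF True] by (auto simp: t_def)
    have t_min: "x j = c j" if "s < j" "j < t" for j
      using not_less_Least[of j "\<lambda>t. s < t \<and> t < n \<and> x t \<noteq> c t"] that t(2) by (auto simp: t_def)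
    show thesis
    proof (rule that[of s t])
      show "x \<in> Eset s t c" using x(1) s_min t_min by (auto simp: Eset_def neq_iff)
      fix q
      show "weight q * norm (lsum q a x) \<le> ?C * A * (real (P s) * real (P t) * real (P n) powr (- 1 / p))"
      proof (cases "q \<le> P n")
        case False
        let ?X = "2 * (real R)\<^sup>2 * real (P s) * real (P t)"
        have "norm (\<Sum>k=Suc (P n)..q. dirichlet (ratio x \<tau>) k / of_nat k) \<le> ?X / B" if "\<tau> \<in> I n c" for \<tau>
        proof -
          have "norm (\<Sum>k=Suc (P n)..q. dirichlet (ratio x \<tau>) k / of_nat k) \<le> ?X / real (Suc (P n))"
            using cG[OF that] s t x(1)
            by (intro abel_bound norm_sum_dirichlet_ratio_le) auto
          also have "\<dots> \<le> ?X / B" using B by (intro divide_left_mono) (auto simp: B_def)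
          finally show ?thesis .
        qed
        from atom_lsum_bound[OF a this] have "norm (lsum q a x) \<le> A * (?X / B) / B" by (simp add: B_def)
        \<comment> \<open>Only \<open>q > P n\<close> is left here, so the decreasing weight is at
          most its size at \<open>P n\<close>.\<close>
        moreover have "weight q \<le> B powr - eps"
          unfolding weight_def using False eps_pos B by (intro powr_mono2') (auto simp: B_def)
        ultimately have "weight q * norm (lsum q a x) \<le> B powr - eps * (A * (?X / B) / B)"
          by (intro mult_mono) auto
        also have "\<dots> = 2 * (real R)\<^sup>2 * A * (real (P s) * real (P t) * (B powr - eps / B / B))"
          by simp
        also have "B powr - eps / B / B = B powr (- eps - 1 - 1)"
          unfolding powr_diff using B by simp
        also have "- eps - 1 - 1 = - 1 / p" by simp
        also have "2 * (real R)\<^sup>2 * A * (real (P s) * real (P t) * B powr (- 1 / p))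
            \<le> ?C * A * (real (P s) * real (P t) * B powr (- 1 / p))"
          using A eps_pos by (intro mult_right_mono) auto
        finally show ?thesis by (simp add: B_def)
      qed (rule q_small)
    qed (use t in auto)
  next
    case False
    show thesis
    proof (rule that[of s n])
      show "x \<in> Eset s n c" using x(1) s_min False by (auto simp: Eset_def neq_iff)
      fix q
      show "weight q * norm (lsum q a x) \<le> ?C * A * (real (P s) * real (P n) * real (P n) powr (- 1 / p))"
      proof (cases "q \<le> P n")
        case q: False
        let ?X = "real R * real (P s) * ((real q / B) powr eps / eps)"
        have "norm (\<Sum>k=Suc (P n)..q. dirichlet (ratio x \<tau>) k / of_nat k) \<le> ?X" if "\<tau> \<in> I n c" for \<tau>
        proof -
          have "norm (\<Sum>k=Suc (P n)..q. dirichlet (ratio x \<tau>) k / of_nat k)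
              \<le> (\<Sum>k=Suc (P n)..q. real R * real (P s) * (1 / real k))"
          proof (rule order_trans[OF norm_sum sum_mono])
            fix k
            have "norm (dirichlet (ratio x \<tau>) k) \<le> real R * real (P s)"
              using cG[OF that] s x(1) by (intro norm_dirichlet_ratio_le) auto
            then show "norm (dirichlet (ratio x \<tau>) k / of_nat k) \<le> real R * real (P s) * (1 / real k)"
              by (simp add: norm_divide divide_right_mono)
          qed
          also have "\<dots> = real R * real (P s) * (\<Sum>k=Suc (P n)..q. 1 / real k)"
            by (simp add: sum_distrib_left)
          also have "\<dots> \<le> real R * real (P s) * ((real q / B) powr eps / eps)"
          proof (rule mult_left_mono)
            have "(\<Sum>k=Suc (P n)..q. 1 / real k) \<le> ln (real q) - ln B"
              unfolding B_def using q P_ge_1 by (intro sum_inverse_le_ln) auto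
            also have "\<dots> = ln (real q / B)" using q B by (simp add: ln_div B_def)
            \<comment> \<open>The logarithm is traded for the power of \<open>q\<close> that the
              weight carries, at the price of the constant \<open>1 / eps\<close>.\<close>
            also have "\<dots> \<le> (real q / B) powr eps / eps"
              using q B eps_pos by (intro ln_powr_bound) (auto simp: B_def field_simps)
            finally show "(\<Sum>k=Suc (P n)..q. 1 / real k) \<le> (real q / B) powr eps / eps" .
          qed simp
          finally show ?thesis .
        qed
        from atom_lsum_bound[OF a this] have "norm (lsum q a x) \<le> A * ?X / B" by (simp add: B_def)
        then have "weight q * norm (lsum q a x) \<le> weight q * (A * ?X / B)"
          by (intro mult_left_mono) auto
        also have "\<dots> = (weight q * real q powr eps) * (real R / eps * A * (real (P s) * (B powr - eps / B)))"
          using B by (simp add: powr_divide powr_minus divide_simps)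
        also have "\<dots> \<le> 1 * (real R / eps * A * (real (P s) * (B powr - eps / B)))"
        proof (rule mult_right_mono)
          have "real q powr eps \<le> (real q + 1) powr eps" using eps_pos by (intro powr_mono2) auto
          then show "weight q * real q powr eps \<le> 1"
            unfolding weight_def powr_minus by (simp add: field_simps)
        qed (use A eps_pos B in simp)
        also have "B powr - eps / B = B powr (- eps - 1)"
          unfolding powr_diff using B by simp
        \<comment> \<open>Compared with the other case one factor \<open>1 / B\<close> is missing.
          The surplus \<open>B = P n\<close> plays the part of \<open>P t\<close> for
          \<open>t = n\<close>, so both cases get the same form.\<close>
        also have "- eps - 1 = 1 + - 1 / p" by simp
        also have "B powr (1 + - 1 / p) = B * B powr (- 1 / p)"
          unfolding powr_add using B by simp
        also have "1 * (real R / eps * A * (real (P s) * (B * B powr (- 1 / p))))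
            \<le> ?C * A * (real (P s) * (B * B powr (- 1 / p)))"
          unfolding mult_1_left using A eps_pos B by (intro mult_right_mono) auto
        finally show ?thesis by (simp add: B_def mult.assoc)
      qed (rule q_small)
    qed (use s in auto)
  qed
qed

lemma atom_pointwise:
  obtains C where "0 < C"
    and "\<And>n c A a q x. \<lbrakk>atom n c A a; x \<in> G; 1 \<le> q\<rbrakk> \<Longrightarrow> weight q * norm (lsum q a x) \<le> C * A * atom_majorant n c x"
proof -
  obtain C1 where C1: "0 < C1" and bdd: "\<And>N F A x q. \<lbrakk>level N F; \<And>t. t \<in> G \<Longrightarrow> norm (F t) \<le> A; x \<in> G; 1 \<le> q\<rbrakk>
      \<Longrightarrow> norm (lsum q F x) \<le> C1 * A * (real q + 1) powr eps"
    using lsum_bounded[OF eps_pos] by blast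
  let ?C2 = "2 * (real R)\<^sup>2 + real R / eps"
  have C2: "0 \<le> ?C2" using eps_pos by simp
  have "weight q * norm (lsum q a x) \<le> (C1 + ?C2) * A * atom_majorant n c x"
    if a: "atom n c A a" and x: "x \<in> G" and q: "1 \<le> q" for n c A a q x
  proof -
    have A: "0 \<le> A" using a norm_ge_zero order_trans unfolding atom_def by blast
    let ?T = "SIGMA s:{..<n}. {s<..n}"
    let ?b = "\<lambda>(s, t). real (P s) * real (P t) * real (P n) powr (- 1 / p) * indicator (Eset s t c) x"
    have maj: "atom_majorant n c x = indicator (I n c) x + (\<Sum>i\<in>?T. ?b i)"
      by (simp add: atom_majorant_def)
    have nn: "0 \<le> ?b i" for i by (simp split: prod.split)
    show ?thesis
    proof (cases "x \<in> I n c")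
      case True
      obtain N where "level N a" using a by (auto simp: atom_def)
      from bdd[OF this _ x q, of A] have "norm (lsum q a x) \<le> C1 * A * (real q + 1) powr eps"
        using a by (auto simp: atom_def)
      then have "weight q * norm (lsum q a x) \<le> weight q * (C1 * A * (real q + 1) powr eps)"
        by (rule mult_left_mono) simp
      also have "\<dots> = C1 * A * 1"
        unfolding weight_def powr_minus by simp
      also have "\<dots> \<le> (C1 + ?C2) * A * atom_majorant n c x"
      proof (rule mult_mono)
        show "1 \<le> atom_majorant n c x" unfolding maj using True nn by (simp add: sum_nonneg)
      qed (use A C1 C2 in \<open>auto intro: mult_right_mono\<close>)
      finally show ?thesis .
    next
      case False
      obtain s t where st: "s < t" "t \<le> n" "x \<in> Eset s t c"
        "\<And>q. weight q * norm (lsum q a x) \<le> ?C2 * A * (real (P s) * real (P t) * real (P n) powr (- 1 / p))"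
        using atom_off_support[OF a x False] by blast
      note st(4)[of q]
      also have "real (P s) * real (P t) * real (P n) powr (- 1 / p) = ?b (s, t)"
        using st(3) by simp
      also have "?C2 * A * ?b (s, t) \<le> (C1 + ?C2) * A * atom_majorant n c x"
      proof (rule mult_mono)
        have "?b (s, t) \<le> (\<Sum>i\<in>?T. ?b i)"
          using st(1,2) nn by (intro member_le_sum) auto
        then show "?b (s, t) \<le> atom_majorant n c x" unfolding maj by (simp add: indicator_def)
      qed (use A C1 C2 nn in \<open>auto intro: mult_right_mono\<close>)
      finally show ?thesis .
    qed
  qed
  moreover have "0 < C1 + ?C2" using C1 C2 by simp
  ultimately show thesis using that by blast
qed

text \<open>Because \<open>s \<le> t\<close>, part of the power of \<open>P s\<close> can be shifted
  to \<open>P t\<close> until both exponents are negative, which leaves a product of two geometric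
  series.\<close>

lemma sum_P_bound:
  obtains K where "0 \<le> K"
    and "\<And>n. (\<Sum>(s, t)\<in>(SIGMA s:{..<n}. {s<..n}). (real (P s) * real (P t)) powr p / real (P t)) \<le> K"
proof -
  \<comment> \<open>Half of the available room: after shifting, the exponent of \<open>P t\<close>
    is \<open>2 * p - 1 + h = - h\<close>, equal to that left on \<open>P s\<close>. Positivity of
    \<open>h\<close> is the condition \<open>p < 1 / 2\<close>.\<close>
  define h where "h = (1 - 2 * p) / 2"
  have h: "0 < h" using p_less by (simp add: h_def)
  define z :: real where "z = 2 powr - h"
  have z: "0 \<le> z" "z < 1" using h by (auto simp: z_def powr_less_one)
  have pz: "real (P t) powr - h \<le> z ^ t" for t
  proof -
    have "real (P t) powr - h \<le> (2 ^ t) powr - h"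
      using two_power_le_P_real[of t] h by (intro powr_mono2') auto
    also have "\<dots> = z ^ t" by (simp add: z_def powr_powr powr_realpow[symmetric] mult.commute)
    finally show ?thesis .
  qed
  have summand: "(real (P s) * real (P t)) powr p / real (P t) \<le> z ^ s * z ^ t" if "s \<le> t" for s t
  proof -
    have st: "real (P s) \<le> real (P t)" using P_mono[OF that] by simp
    have "(real (P s) * real (P t)) powr p / real (P t) = real (P s) powr p * real (P t) powr (p - 1)"
      by (simp add: powr_mult powr_diff)
    also have "\<dots> = real (P s) powr - h * real (P s) powr (p + h) * real (P t) powr (p - 1)"
      by (simp add: powr_add[symmetric])
    also have "\<dots> \<le> real (P s) powr - h * real (P t) powr (p + h) * real (P t) powr (p - 1)"
      using st p_pos h by (intro mult_left_mono mult_right_mono powr_mono2) auto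
    also have "\<dots> = real (P s) powr - h * real (P t) powr ((p + h) + (p - 1))"
      unfolding mult.assoc powr_add ..
    also have "(p + h) + (p - 1) = - h" by (simp add: h_def field_simps)
    also have "real (P s) powr - h * real (P t) powr - h \<le> z ^ s * z ^ t" using pz z by (intro mult_mono) auto
    finally show ?thesis .
  qed
  have "(\<Sum>(s, t)\<in>(SIGMA s:{..<n}. {s<..n}). (real (P s) * real (P t)) powr p / real (P t))
      \<le> 1 / (1 - z) * (1 / (1 - z))" for n
  proof -
    have "(\<Sum>(s, t)\<in>(SIGMA s:{..<n}. {s<..n}). (real (P s) * real (P t)) powr p / real (P t))
      \<le> (\<Sum>(s, t)\<in>(SIGMA s:{..<n}. {s<..n}). z ^ s * z ^ t)"
      using summand by (intro sum_mono) auto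
    also have "\<dots> \<le> (\<Sum>(s, t)\<in>{..<n} \<times> {..n}. z ^ s * z ^ t)"
      using z by (intro sum_mono2) auto
    also have "\<dots> = (\<Sum>s<n. z ^ s) * (\<Sum>t\<le>n. z ^ t)"
      by (simp add: sum_product sum.cartesian_product)
    also have "\<dots> \<le> 1 / (1 - z) * (1 / (1 - z))"
      using z by (intro mult_mono sum_power_le) (auto intro: sum_nonneg)
    finally show ?thesis .
  qed
  from that[OF _ this] show thesis using z by simp
qed

text \<open>By p-subadditivity each summand may be integrated alone. The p-th power turns
  \<open>P n powr (- 1 / p)\<close> into \<open>1 / P n\<close>, and the measure of
  \<open>Eset s t c\<close> supplies the \<open>1 / P t\<close> that \<open>sum_P_bound\<close>
  needs.\<close>

lemma nn_integral_atom_majorant: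
  obtains K where "0 \<le> K"
    and "\<And>n c. c \<in> G \<Longrightarrow> (\<integral>\<^sup>+x. ennreal (atom_majorant n c x powr p) \<partial>\<mu>) \<le> ennreal (K / real (P n))"
proof -
  obtain K where K: "0 \<le> K"
    "\<And>n. (\<Sum>(s, t)\<in>(SIGMA s:{..<n}. {s<..n}). (real (P s) * real (P t)) powr p / real (P t)) \<le> K"
    using sum_P_bound by blast
  have "(\<integral>\<^sup>+x. ennreal (atom_majorant n c x powr p) \<partial>\<mu>) \<le> ennreal ((1 + real R * K) / real (P n))"
    if c: "c \<in> G" for n c
  proof -
    let ?T = "SIGMA s:{..<n}. {s<..n}"
    define g where "g i = (case i of (s, t) \<Rightarrow> (real (P s) * real (P t)) powr p / real (P n))" for i
    define E where "E i = (case i of (s, t) \<Rightarrow> Eset s t c)" for i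
    have g0: "0 \<le> g i" for i by (simp add: g_def split: prod.split)
    have finT: "finite ?T" by simp
    have pt: "ennreal (atom_majorant n c x powr p)
        \<le> indicator (I n c) x + (\<Sum>i\<in>?T. ennreal (g i) * indicator (E i) x)" for x
    proof -
      define b where "b i = (case i of (s, t) \<Rightarrow>
        real (P s) * real (P t) * real (P n) powr (- 1 / p) * indicator (Eset s t c) x)" for i
      have b0: "0 \<le> b i" for i by (simp add: b_def split: prod.split)
      have b: "b i powr p = g i * indicator (E i) x" for i
        using p_pos
        by (auto simp: b_def g_def E_def indicator_def powr_mult powr_divide powr_powr powr_minus_divide split: prod.split)
      have "atom_majorant n c x powr p = (indicator (I n c) x + (\<Sum>i\<in>?T. b i)) powr p"
        by (simp add: atom_majorant_def b_def)
      also have "\<dots> \<le> indicator (I n c) x powr p + (\<Sum>i\<in>?T. b i) powr p"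
        using p_pos p_less by (intro powr_add_le sum_nonneg b0) auto
      also have "\<dots> \<le> indicator (I n c) x powr p + (\<Sum>i\<in>?T. b i powr p)"
        using p_pos p_less by (intro add_left_mono powr_sum_le finT b0) auto
      also have "\<dots> = indicator (I n c) x + (\<Sum>i\<in>?T. g i * indicator (E i) x)"
        unfolding b by (simp add: indicator_def)
      finally have "ennreal (atom_majorant n c x powr p)
          \<le> ennreal (indicator (I n c) x + (\<Sum>i\<in>?T. g i * indicator (E i) x))"
        by (rule ennreal_leI)
      also have "\<dots> = ennreal (indicator (I n c) x) + ennreal (\<Sum>i\<in>?T. g i * indicator (E i) x)"
        by (intro ennreal_plus sum_nonneg mult_nonneg_nonneg g0) auto
      also have "ennreal (\<Sum>i\<in>?T. g i * indicator (E i) x) = (\<Sum>i\<in>?T. ennreal (g i * indicator (E i) x))"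
        by (intro sum_ennreal[symmetric] mult_nonneg_nonneg g0) auto
      also have "\<dots> = (\<Sum>i\<in>?T. ennreal (g i) * indicator (E i) x)"
        by (intro sum.cong refl) (simp add: indicator_def)
      finally show ?thesis by (simp add: ennreal_indicator)
    qed
    have I_meas [measurable]: "I n c \<in> sets \<mu>" using c by (rule I_in_sets)
    have E_meas [measurable]: "E i \<in> sets \<mu>" for i by (simp add: E_def Eset_sets split: prod.split)
    have "(\<integral>\<^sup>+x. ennreal (atom_majorant n c x powr p) \<partial>\<mu>)
        \<le> (\<integral>\<^sup>+x. indicator (I n c) x + (\<Sum>i\<in>?T. ennreal (g i) * indicator (E i) x) \<partial>\<mu>)"
      by (intro nn_integral_mono pt)
    also have "\<dots> = (\<integral>\<^sup>+x. indicator (I n c) x \<partial>\<mu>) + (\<integral>\<^sup>+x. (\<Sum>i\<in>?T. ennreal (g i) * indicator (E i) x) \<partial>\<mu>)"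
      by (rule nn_integral_add) measurable
    also have "(\<integral>\<^sup>+x. (\<Sum>i\<in>?T. ennreal (g i) * indicator (E i) x) \<partial>\<mu>) =
        (\<Sum>i\<in>?T. \<integral>\<^sup>+x. ennreal (g i) * indicator (E i) x \<partial>\<mu>)"
      by (rule nn_integral_sum) measurable
    also have "\<dots> = (\<Sum>i\<in>?T. ennreal (g i) * emeasure \<mu> (E i))"
      by (simp only: nn_integral_cmult_indicator E_meas)
    also have "(\<integral>\<^sup>+x. indicator (I n c) x \<partial>\<mu>) + \<dots>
        \<le> ennreal (1 / real (P n)) + (\<Sum>i\<in>?T. ennreal (g i * (real R / real (P (snd i)))))"
    proof (intro add_mono sum_mono)
      show "(\<integral>\<^sup>+x. indicator (I n c) x \<partial>\<mu>) \<le> ennreal (1 / real (P n))"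
        using c by (simp add: emeasure_I)
      fix i assume "i \<in> ?T"
      then have "emeasure \<mu> (E i) \<le> ennreal (real R / real (P (snd i)))"
        using c emeasure_Eset by (auto simp: E_def)
      then have "ennreal (g i) * emeasure \<mu> (E i) \<le> ennreal (g i) * ennreal (real R / real (P (snd i)))"
        by (rule mult_left_mono) simp
      then show "ennreal (g i) * emeasure \<mu> (E i) \<le> ennreal (g i * (real R / real (P (snd i))))"
        by (simp only: ennreal_mult'[OF g0])
    qed
    also have "\<dots> = ennreal (1 / real (P n)) + ennreal (\<Sum>i\<in>?T. g i * (real R / real (P (snd i))))"
      by (intro arg_cong2[where f = "(+)"] refl sum_ennreal mult_nonneg_nonneg g0) auto
    also have "\<dots> = ennreal (1 / real (P n) + (\<Sum>i\<in>?T. g i * (real R / real (P (snd i)))))"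
      by (intro ennreal_plus[symmetric] sum_nonneg mult_nonneg_nonneg g0) auto
    also have "\<dots> \<le> ennreal ((1 + real R * K) / real (P n))"
    proof (rule ennreal_leI)
      have "(\<Sum>i\<in>?T. g i * (real R / real (P (snd i)))) =
          real R / real (P n) * (\<Sum>(s, t)\<in>?T. (real (P s) * real (P t)) powr p / real (P t))"
        unfolding sum_distrib_left by (intro sum.cong) (auto simp: g_def mult.commute)
      also have "\<dots> \<le> real R / real (P n) * K" using K(2)[of n] by (intro mult_left_mono) auto
      finally show "1 / real (P n) + (\<Sum>i\<in>?T. g i * (real R / real (P (snd i)))) \<le> (1 + real R * K) / real (P n)"
        by (simp add: add_divide_distrib)
    qed
    finally show ?thesis .
  qed
  from that[OF _ this] K(1) show thesis by simp
qed

text \<open>A finite range of \<open>q\<close> keeps the maximal function cell-wise constant, hence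
  measurable; the full supremum is recovered by monotone convergence.\<close>

definition maxop :: "nat \<Rightarrow> ((nat \<Rightarrow> int) \<Rightarrow> complex) \<Rightarrow> (nat \<Rightarrow> int) \<Rightarrow> real" where
  "maxop Q F x = Max ((\<lambda>q. weight q * norm (lsum q F x)) ` {1..Q})"

lemma maxop_le: "1 \<le> Q \<Longrightarrow> (\<And>q. 1 \<le> q \<Longrightarrow> q \<le> Q \<Longrightarrow> weight q * norm (lsum q F x) \<le> B) \<Longrightarrow> maxop Q F x \<le> B"
  unfolding maxop_def by (intro Max.boundedI) auto

lemma maxop_ge: "1 \<le> q \<Longrightarrow> q \<le> Q \<Longrightarrow> weight q * norm (lsum q F x) \<le> maxop Q F x"
  unfolding maxop_def by (intro Max_ge) auto

lemma maxop_nonneg: "1 \<le> Q \<Longrightarrow> 0 \<le> maxop Q F x"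
  using maxop_ge[of 1 Q F x] by (meson mult_nonneg_nonneg norm_ge_zero order_refl order_trans weight_nonneg)

lemma level_maxop: "Q \<le> P N \<Longrightarrow> level N (maxop Q F)"
  unfolding level_def maxop_def
proof (intro ballI arg_cong[where f = Max] image_cong refl)
  fix x y q assume "Q \<le> P N" "x \<in> G" "y \<in> I N x" "q \<in> {1..Q}"
  then have "lsum q F y = lsum q F x" by (intro levelD[OF level_lsum]) auto
  then show "weight q * norm (lsum q F y) = weight q * norm (lsum q F x)" by simp
qed

lemma maxop_measurable: "maxop Q F \<in> borel_measurable \<mu>"
  using level_measurable[OF level_maxop[OF less_imp_le[OF less_P[of Q]]]] by simp

lemma atom_maxop:
  obtains C where "0 < C"
    and "\<And>n c A a Q. \<lbrakk>atom n c A a; 1 \<le> Q\<rbrakk> \<Longrightarrow>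
      (\<integral>\<^sup>+x. ennreal (maxop Q a x powr p) \<partial>\<mu>) \<le> ennreal (C * A powr p / real (P n))"
proof -
  obtain C where C: "0 < C" "\<And>n c A a q x. \<lbrakk>atom n c A a; x \<in> G; 1 \<le> q\<rbrakk>
      \<Longrightarrow> weight q * norm (lsum q a x) \<le> C * A * atom_majorant n c x"
    using atom_pointwise by blast
  obtain K where K: "0 \<le> K"
    "\<And>n c. c \<in> G \<Longrightarrow> (\<integral>\<^sup>+x. ennreal (atom_majorant n c x powr p) \<partial>\<mu>) \<le> ennreal (K / real (P n))"
    using nn_integral_atom_majorant by blast
  \<comment> \<open>Taking \<open>K + 1\<close> instead of \<open>K\<close> makes the final constant
    strictly positive.\<close>
  have "(\<integral>\<^sup>+x. ennreal (maxop Q a x powr p) \<partial>\<mu>) \<le> ennreal ((C powr p * (K + 1)) * A powr p / real (P n))"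
    if a: "atom n c A a" and Q: "1 \<le> Q" for n c A a Q
  proof -
    have c: "c \<in> G" using a by (simp add: atom_def)
    have A: "0 \<le> A" using a norm_ge_zero order_trans unfolding atom_def by blast
    have maj0: "0 \<le> atom_majorant n c x" for x
      unfolding atom_majorant_def by (intro add_nonneg_nonneg sum_nonneg) auto
    have "(\<integral>\<^sup>+x. ennreal (maxop Q a x powr p) \<partial>\<mu>)
        \<le> (\<integral>\<^sup>+x. ennreal ((C * A) powr p) * ennreal (atom_majorant n c x powr p) \<partial>\<mu>)"
    proof (rule nn_integral_mono)
      fix x assume "x \<in> space \<mu>"
      then have "maxop Q a x \<le> C * A * atom_majorant n c x"
        using C(2)[OF a] Q by (intro maxop_le) auto
      then have "maxop Q a x powr p \<le> (C * A * atom_majorant n c x) powr p"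
        using p_pos maxop_nonneg[OF Q] by (intro powr_mono2) auto
      also have "\<dots> = (C * A) powr p * atom_majorant n c x powr p"
        using C A maj0 by (simp add: powr_mult)
      finally show "ennreal (maxop Q a x powr p) \<le> ennreal ((C * A) powr p) * ennreal (atom_majorant n c x powr p)"
        by (simp add: ennreal_mult'[symmetric] ennreal_leI)
    qed
    also have "\<dots> = ennreal ((C * A) powr p) * (\<integral>\<^sup>+x. ennreal (atom_majorant n c x powr p) \<partial>\<mu>)"
    proof (rule nn_integral_cmult)
      have "level n (atom_majorant n c)"
        unfolding atom_majorant_def level_def
        by (auto simp: mem_I Eset_def indicator_def intro!: arg_cong2[where f = "(+)"] sum.cong)
      then show "(\<lambda>x. ennreal (atom_majorant n c x powr p)) \<in> borel_measurable \<mu>"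
        using level_measurable[of n "atom_majorant n c" borel] by simp
    qed
    also have "\<dots> \<le> ennreal ((C * A) powr p) * ennreal (K / real (P n))"
      by (intro mult_left_mono K(2) c) simp
    also have "\<dots> = ennreal ((C * A) powr p * (K / real (P n)))"
      by (simp add: ennreal_mult'[symmetric])
    also have "\<dots> \<le> ennreal ((C powr p * (K + 1)) * A powr p / real (P n))"
    proof (rule ennreal_leI)
      have "(C * A) powr p * (K / real (P n)) \<le> (C * A) powr p * ((K + 1) / real (P n))"
        by (intro mult_left_mono divide_right_mono) auto
      then show "(C * A) powr p * (K / real (P n)) \<le> (C powr p * (K + 1)) * A powr p / real (P n)"
        using C A by (simp add: powr_mult mult_ac)
    qed
    finally show ?thesis .
  qed
  moreover have "0 < C powr p * (K + 1)" using C K by simp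
  ultimately show thesis using that by blast
qed

end

section \<open>Atomic decomposition\<close>

context vilenkin begin

lemma level_indicator: "c \<in> G \<Longrightarrow> level n (indicator (I n c) :: _ \<Rightarrow> real)"
  using level_I[of c n] by (simp add: level_def indicator_def)

definition star :: "(nat \<Rightarrow> (nat \<Rightarrow> int) \<Rightarrow> complex) \<Rightarrow> nat \<Rightarrow> (nat \<Rightarrow> int) \<Rightarrow> real" where
  "star f N x = Max ((\<lambda>i. norm (f i x)) ` {..N})"

lemma star_ge: "i \<le> N \<Longrightarrow> norm (f i x) \<le> star f N x"
  unfolding star_def by (intro Max_ge) auto

lemma star_nonneg: "0 \<le> star f N x"
  using star_ge[of 0 N f x] norm_ge_zero order_trans by blast

text \<open>A predictable nondecreasing majorant: its value on a cell of level \<open>n\<close> already dominates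
  the martingale at time \<open>n + 1\<close>.\<close>

definition maj_set :: "(nat \<Rightarrow> (nat \<Rightarrow> int) \<Rightarrow> complex) \<Rightarrow> nat \<Rightarrow> (nat \<Rightarrow> int) \<Rightarrow> real set" where
  "maj_set f n x = (\<Union>j\<le>n. \<Union>i\<le>Suc j. (\<lambda>y. norm (f i y)) ` I j x)"

definition maj :: "(nat \<Rightarrow> (nat \<Rightarrow> int) \<Rightarrow> complex) \<Rightarrow> nat \<Rightarrow> (nat \<Rightarrow> int) \<Rightarrow> real" where
  "maj f n x = Max (maj_set f n x)"

section \<open>Dyadic stopping of one martingale\<close>

context
  fixes f :: "nat \<Rightarrow> (nat \<Rightarrow> int) \<Rightarrow> complex"
  assumes mart: "cell_martingale f"
begin

lemma level_f: "level n (f n)"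
  using mart by (simp add: cell_martingale_def)

lemma level_f': "n \<le> k \<Longrightarrow> level k (f n)"
  by (rule level_mono[OF level_f])

lemma level_star: "level N (star f N)"
  unfolding level_def star_def
proof (intro ballI arg_cong[where f = Max] image_cong refl)
  fix x y i assume "x \<in> G" "y \<in> I N x" "i \<in> {..N}"
  then have "f i y = f i x" by (intro levelD[OF level_f'[of i N]]) auto
  then show "norm (f i y) = norm (f i x)" by simp
qed

lemma finite_maj_set: "finite (maj_set f n x)"
proof -
  have "finite ((\<lambda>y. norm (f i y)) ` I j x)" for i j
    by (rule finite_subset[OF image_mono[OF I_subset_G] level_finite_range[OF level_comp[where h = norm, OF level_f]]])
  then show ?thesis by (simp add: maj_set_def)
qed

lemma maj_ge: "j \<le> n \<Longrightarrow> i \<le> Suc j \<Longrightarrow> y \<in> I j x \<Longrightarrow> norm (f i y) \<le> maj f n x"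
  unfolding maj_def by (rule Max_ge[OF finite_maj_set]) (auto simp: maj_set_def)

lemma maj_ge_self: "x \<in> G \<Longrightarrow> i \<le> Suc n \<Longrightarrow> norm (f i x) \<le> maj f n x"
  by (rule maj_ge[OF order_refl _ self_mem_I])

lemma maj_set_nonempty: "x \<in> G \<Longrightarrow> maj_set f n x \<noteq> {}"
  unfolding maj_set_def using self_mem_I by blast

lemma maj_mono:
  assumes "x \<in> G" "n \<le> k"
  shows "maj f n x \<le> maj f k x"
  unfolding maj_def
proof (rule Max_mono[OF _ maj_set_nonempty[OF assms(1)] finite_maj_set])
  show "maj_set f n x \<subseteq> maj_set f k x"
    unfolding maj_set_def using assms(2) by (intro UN_mono) auto
qed

lemma maj_attained:
  assumes "x \<in> G"
  obtains i j y where "j \<le> n" "i \<le> Suc j" "y \<in> I j x" "maj f n x = norm (f i y)"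
  using Max_in[OF finite_maj_set maj_set_nonempty[OF assms], of n] that
  unfolding maj_def[symmetric] by (auto simp: maj_set_def)

lemma level_maj: "level n (maj f n)"
  unfolding level_def maj_def
proof (intro ballI arg_cong[where f = Max])
  fix x y assume "x \<in> G" "y \<in> I n x"
  then have "I j y = I j x" if "j \<le> n" for j
    using I_eq[of y j x] I_antimono[OF that] by blast
  then show "maj_set f n y = maj_set f n x" by (simp add: maj_set_def)
qed

definition band :: "int \<Rightarrow> nat \<Rightarrow> (nat \<Rightarrow> int) \<Rightarrow> bool" where
  "band k n x \<longleftrightarrow> 2 powr real_of_int k \<le> maj f n x \<and> maj f n x < 2 powr real_of_int (k + 1)"

text \<open>The difference of the martingale stopped at levels \<open>2 powr (k + 1)\<close> and
  \<open>2 powr k\<close> of the majorant, written as a sum of increments with predictable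
  coefficients; this form makes cancellation visible.\<close>

definition piece :: "nat \<Rightarrow> int \<Rightarrow> (nat \<Rightarrow> int) \<Rightarrow> complex" where
  "piece N k x = (\<Sum>n<N. if band k n x then f (Suc n) x - f n x else 0)"

definition first :: "int \<Rightarrow> nat \<Rightarrow> (nat \<Rightarrow> int) \<Rightarrow> bool" where
  "first k n x \<longleftrightarrow> 2 powr real_of_int k \<le> maj f n x \<and> (\<forall>j<n. maj f j x < 2 powr real_of_int k)"

definition bands :: "nat \<Rightarrow> int set" where
  "bands N = (\<Union>n<N. (\<lambda>x. \<lfloor>log 2 (maj f n x)\<rfloor>) ` G)"

text \<open>Indexing by cells as sets counts a cell once, whatever its representatives; the level
  \<open>n\<close> is carried along because the atom and measure bounds refer to it.\<close>

definition cells :: "nat \<Rightarrow> int \<Rightarrow> (nat \<times> (nat \<Rightarrow> int) set) set" where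
  "cells N k = (SIGMA n:{..<N}. I n ` {x \<in> G. first k n x})"

lemma finite_bands: "finite (bands N)"
  unfolding bands_def
  using level_finite_range[OF level_comp[OF level_maj, where h = "\<lambda>v. \<lfloor>log 2 v\<rfloor>"]] by blast

lemma finite_mcells: "finite (cells N k)"
  unfolding cells_def by (intro finite_SigmaI finite_subset[OF _ finite_cells]) auto

lemma level_band: "n \<le> N \<Longrightarrow> level N (band k n)"
  unfolding band_def by (rule level_mono[OF level_comp[OF level_maj, where h = "\<lambda>v. _ \<le> v \<and> v < _"]])

lemma level_first: "level n (first k n)"
  unfolding level_def
proof (intro ballI)
  fix x y assume "x \<in> G" "y \<in> I n x"
  then have "maj f j y = maj f j x" if "j \<le> n" for j
    by (rule levelD[OF level_mono[OF level_maj that]])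
  then show "first k n y = first k n x" by (simp add: first_def)
qed

lemma first_unique: "first k n x \<Longrightarrow> first k n' x \<Longrightarrow> n = n'"
  unfolding first_def by (meson not_less_iff_gr_or_eq linorder_not_less)

lemma level_diff: "level (Suc n) (\<lambda>x. f (Suc n) x - f n x)"
  by (rule level_comp2[OF level_f level_f']) simp

lemma level_piece: "level N (piece N k)"
  unfolding piece_def
proof (rule level_sum)
  fix n assume "n \<in> {..<N}"
  then have n: "n \<le> N" "Suc n \<le> N" by auto
  show "level N (\<lambda>x. if band k n x then f (Suc n) x - f n x else 0)"
    by (rule level_comp2[where h = "\<lambda>b v. if b then v else 0", OF level_band[OF n(1)] level_mono[OF level_diff n(2)]])
qed

text \<open>Each increment with positive majorant belongs to exactly one dyadic band, the integer
  part of the logarithm of the majorant.\<close>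

lemma sum_pieces:
  assumes x: "x \<in> G"
  shows "f N x = f 0 x + (\<Sum>k\<in>bands N. piece N k x)"
proof -
  have "(\<Sum>k\<in>bands N. if band k n x then f (Suc n) x - f n x else 0) = f (Suc n) x - f n x"
    if n: "n < N" for n
  proof (cases "maj f n x = 0")
    case True
    \<comment> \<open>A vanishing majorant forces both ends of the increment to vanish, so the value
      of the logarithm at 0 does not affect the sum.\<close>
    then have "f (Suc n) x = 0" "f n x = 0"
      using maj_ge_self[OF x, of "Suc n" n] maj_ge_self[OF x, of n n] by auto
    then show ?thesis by (auto intro!: sum.neutral)
  next
    case False
    then have pos: "0 < maj f n x"
      using maj_ge_self[OF x, of n n] norm_ge_zero[of "f n x"] by linarith
    have eq: "band k n x \<longleftrightarrow> k = \<lfloor>log 2 (maj f n x)\<rfloor>" for k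
      unfolding band_def using pos floor_eq_iff[of "log 2 (maj f n x)" k]
      by (auto simp: le_log_iff log_less_iff)
    have "\<lfloor>log 2 (maj f n x)\<rfloor> \<in> bands N"
      unfolding bands_def using x n by blast
    then show ?thesis unfolding eq using finite_bands by simp
  qed
  then have "(\<Sum>n<N. \<Sum>k\<in>bands N. if band k n x then f (Suc n) x - f n x else 0)
      = (\<Sum>n<N. f (Suc n) x - f n x)"
    by (intro sum.cong) auto
  also have "\<dots> = f N x - f 0 x" by (rule sum_lessThan_telescope)
  finally show ?thesis unfolding piece_def by (subst sum.swap) simp
qed

text \<open>The majorant is nondecreasing in time, so a band is an interval of times and the piece
  telescopes to \<open>f b x - f a x\<close>. Each term is below \<open>2 powr (k + 1)\<close>,
  which gives the factor 4.\<close>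

lemma norm_piece_le:
  assumes x: "x \<in> G"
  shows "norm (piece N k x) \<le> 4 * 2 powr real_of_int k"
proof -
  \<comment> \<open>The alternative \<open>N \<le> n\<close> caps the stopping time at
    \<open>N\<close> and makes the minimum exist.\<close>
  define stop where "stop l = (LEAST n. N \<le> n \<or> l \<le> maj f n x)" for l :: real
  have stop: "N \<le> stop l \<or> l \<le> maj f (stop l) x" for l
    unfolding stop_def by (rule LeastI[of _ N]) simp
  have stop_less: "maj f j x < l" if "j < stop l" for j l
    using not_less_Least[OF that[unfolded stop_def]] by auto
  have stop_le: "stop l \<le> N" for l unfolding stop_def by (rule Least_le) simp
  have iff: "j < stop l \<longleftrightarrow> maj f j x < l" if "j < N" for j l
    using stop_less[of j l] stop[of l] that maj_mono[OF x, of "stop l" j] by (meson leD leI less_le_trans)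
  define a where "a = stop (2 powr real_of_int k)"
  define b where "b = stop (2 powr real_of_int (k + 1))"
  have eq: "piece N k x = (\<Sum>j\<in>{a..<b}. f (Suc j) x - f j x)"
  proof -
    have band: "band k j x \<longleftrightarrow> j \<in> {a..<b}" if "j < N" for j
      using iff[OF that, of "2 powr real_of_int k"] iff[OF that, of "2 powr real_of_int (k + 1)"]
      unfolding band_def a_def b_def atLeastLessThan_iff by linarith
    have "piece N k x = (\<Sum>j<N. if j \<in> {a..<b} then f (Suc j) x - f j x else 0)"
      unfolding piece_def using band by (intro sum.cong) auto
    also have "\<dots> = (\<Sum>j\<in>{a..<b}. f (Suc j) x - f j x)"
      using stop_le[of "2 powr real_of_int (k + 1)"] by (intro sum.mono_neutral_cong_right) (auto simp: b_def)
    finally show ?thesis .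
  qed
  show ?thesis
  proof (cases "a < b")
    case True
    then have "piece N k x = f b x - f a x"
      unfolding eq by (intro sum_Suc_diff') simp
    \<comment> \<open>Predictability pays off here: the majorant at the last time before stopping
      already controls the value at the stopping time \<open>b\<close>.\<close>
    moreover have "maj f (b - 1) x < 2 powr real_of_int (k + 1)"
      using True by (intro stop_less) (auto simp: b_def)
    moreover have "norm (f b x) \<le> maj f (b - 1) x" "norm (f a x) \<le> maj f (b - 1) x"
      using True by (auto intro!: maj_ge_self[OF x])
    moreover have "(2::real) powr real_of_int (k + 1) = 2 * 2 powr real_of_int k"
      by (simp add: powr_add)
    ultimately show ?thesis
      using norm_triangle_ineq4[of "f b x" "f a x"] by simp
  qed (simp add: eq)
qed

text \<open>A nonzero piece at \<open>t\<close> has an active time, hence a first time at which the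
  majorant reaches \<open>2 powr k\<close>; that time is unique, so \<open>t\<close> lies in exactly
  one stopping cell.\<close>

lemma piece_cells:
  assumes t: "t \<in> G"
  shows "piece N k t = (\<Sum>(n, C)\<in>cells N k. indicator C t *\<^sub>R piece N k t)"
proof (cases "piece N k t = 0")
  case False
  have "\<exists>j<N. band k j t"
  proof (rule ccontr)
    assume "\<not> (\<exists>j<N. band k j t)"
    then have "piece N k t = 0" unfolding piece_def by (intro sum.neutral) auto
    with False show False by contradiction
  qed
  then obtain j where j: "j < N" "band k j t" by blast
  define n where "n = (LEAST n. 2 powr real_of_int k \<le> maj f n t)"
  have n1: "2 powr real_of_int k \<le> maj f n t"
    unfolding n_def by (rule LeastI[of _ j]) (use j in \<open>simp add: band_def\<close>)
  have "n \<le> j" unfolding n_def by (rule Least_le) (use j in \<open>simp add: band_def\<close>)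
  have fn: "first k n t"
    unfolding first_def
  proof (intro conjI n1 allI impI)
    fix j assume "j < n"
    from not_less_Least[OF this[unfolded n_def]] show "maj f j t < 2 powr real_of_int k" by simp
  qed
  have mem: "(n, I n t) \<in> cells N k"
    using fn t j(1) \<open>n \<le> j\<close> by (auto simp: cells_def)
  have zero: "t \<notin> C" if "(n', C) \<in> cells N k" "(n', C) \<noteq> (n, I n t)" for n' C
  proof
    assume tC: "t \<in> C"
    obtain x where x: "x \<in> G" "first k n' x" "C = I n' x" using \<open>(n', C) \<in> cells N k\<close> by (auto simp: cells_def)
    have "first k n' t" using levelD[OF level_first x(1), of t n'] tC x by simp
    then have "n' = n" using first_unique fn by blast
    with that(2) I_eq[of t n' x] tC x show False by simp
  qed
  have "(\<Sum>(n, C)\<in>cells N k. indicator C t *\<^sub>R piece N k t) = (\<Sum>(n, C)\<in>{(n, I n t)}. indicator C t *\<^sub>R piece N k t)"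
  proof (intro sum.mono_neutral_right finite_mcells ballI)
    fix i assume i: "i \<in> cells N k - {(n, I n t)}"
    obtain n' C where "i = (n', C)" by (cases i)
    with i zero[of n' C] show "(case i of (n, C) \<Rightarrow> indicator C t *\<^sub>R piece N k t) = 0" by simp
  qed (use mem in simp)
  then show ?thesis using self_mem_I[OF t, of n] by simp
qed simp

lemma diff_mult_level:
  fixes g :: "_ \<Rightarrow> complex"
  assumes "level n g" "n \<le> k"
  shows "(\<integral>y. (f k y - f n y) * g y \<partial>\<mu>) = 0"
proof (rule integral_mult_level_eq_0[OF _ assms(1)])
  show "level k (\<lambda>y. f k y - f n y)"
    by (rule level_comp2[OF level_f level_f'[OF assms(2)]])
  fix x assume x: "x \<in> G"
  have int: "integrable \<mu> (\<lambda>y. indicator (I n x) y *\<^sub>R f j y)" for j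
    by (rule integrable_mult_indicator[OF I_in_sets[OF x] level_integrable[OF level_f]])
  have "(\<integral>y. indicator (I n x) y *\<^sub>R f j y \<partial>\<mu>) = f n x / real (P n)" if "n \<le> j" for j
    using mart x that by (auto simp: cell_martingale_def)
  then show "(\<integral>y. indicator (I n x) y *\<^sub>R (f k y - f n y) \<partial>\<mu>) = 0"
    using assms(2) int by (simp add: scaleR_diff_right)
qed

text \<open>On the cell no increment before time \<open>n\<close> is active, as the majorant is
  still too small. Each later increment is multiplied by a coefficient known one step earlier, so it
  integrates to zero.\<close>

lemma atom_piece:
  assumes c: "c \<in> G" and n: "n < N" and first: "first k n c"
  shows "atom n c (4 * 2 powr real_of_int k) (\<lambda>t. indicator (I n c) t *\<^sub>R piece N k t)"
  unfolding atom_def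
proof (intro conjI c)
  have "level N (indicator (I n c) :: _ \<Rightarrow> real)"
    using n by (intro level_mono[OF level_indicator[OF c]]) simp
  then show "\<exists>N'. level N' (\<lambda>t. indicator (I n c) t *\<^sub>R piece N k t)"
    using level_comp2[OF _ level_piece] by blast
  show "\<forall>t\<in>G. norm (indicator (I n c) t *\<^sub>R piece N k t) \<le> 4 * 2 powr real_of_int k"
    using norm_piece_le by (auto simp: indicator_def)
  let ?g = "\<lambda>j t. (indicator (I n c) t *\<^sub>R (if band k j t then 1 else 0)) :: complex"
  have lev: "level j (?g j)" if "n \<le> j" for j
    by (rule level_comp2[where h = "\<lambda>u v. u *\<^sub>R v", OF level_mono[OF level_indicator[OF c] that]
          level_comp[where h = "\<lambda>b. if b then 1 else 0", OF level_band[OF order_refl]]])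
  have "(\<integral>t. indicator (I n c) t *\<^sub>R piece N k t \<partial>\<mu>) = (\<integral>t. (\<Sum>j\<in>{n..<N}. (f (Suc j) t - f j t) * ?g j t) \<partial>\<mu>)"
  proof (rule Bochner_Integration.integral_cong[OF refl])
    fix t assume "t \<in> space \<mu>"
    show "indicator (I n c) t *\<^sub>R piece N k t = (\<Sum>j\<in>{n..<N}. (f (Suc j) t - f j t) * ?g j t)"
    proof (cases "t \<in> I n c")
      case True
      have "\<not> band k j t" if "j < n" for j
      proof -
        have "maj f j t = maj f j c"
          using that by (intro levelD[OF level_mono[OF level_maj] c True]) simp
        then show ?thesis using first that by (auto simp: band_def first_def)
      qed
      then have "piece N k t = (\<Sum>j\<in>{n..<N}. if band k j t then f (Suc j) t - f j t else 0)"
        unfolding piece_def by (intro sum.mono_neutral_right) (auto simp: not_le)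
      then show ?thesis using True by (auto intro!: sum.cong)
    qed simp
  qed
  also have "\<dots> = (\<Sum>j\<in>{n..<N}. \<integral>t. (f (Suc j) t - f j t) * ?g j t \<partial>\<mu>)"
  proof (rule Bochner_Integration.integral_sum)
    fix j assume "j \<in> {n..<N}"
    then have "level (Suc j) (?g j)" by (intro level_mono[OF lev]) auto
    then show "integrable \<mu> (\<lambda>t. (f (Suc j) t - f j t) * ?g j t)"
      by (rule level_integrable[OF level_comp2[where h = "(*)", OF level_diff]])
  qed
  also have "\<dots> = 0"
    using lev by (intro sum.neutral ballI diff_mult_level) auto
  finally show "(\<integral>t. indicator (I n c) t *\<^sub>R piece N k t \<partial>\<mu>) = 0" .
qed simp

text \<open>The majorant exceeds \<open>star\<close> in general, but its value on a stopping cell is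
  attained by some \<open>f i\<close> with \<open>i \<le> Suc n\<close>. That function is constant
  on a child of the cell, so \<open>star\<close> is large on the whole child, at least the fraction
  \<open>1 / R\<close> of the cell. Stopping cells of one \<open>k\<close> are disjoint.\<close>

lemma sum_cells_le:
  "(\<Sum>(n, C)\<in>cells N k. ennreal (1 / real (P n)))
    \<le> ennreal (real R) * emeasure \<mu> {z \<in> G. 2 powr real_of_int k \<le> star f N z}"
proof -
  let ?\<Omega> = "{z \<in> G. 2 powr real_of_int k \<le> star f N z}"
  have \<Omega>: "?\<Omega> \<in> sets \<mu>"
    by (rule level_set[OF level_comp[OF level_star, where h = "\<lambda>v. _ \<le> v"]])
  have each: "ennreal (1 / real (P n)) \<le> ennreal (real R) * emeasure \<mu> (C \<inter> ?\<Omega>)"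
    and meas: "C \<inter> ?\<Omega> \<in> sets \<mu>"
    if nC: "(n, C) \<in> cells N k" for n C
  proof -
    obtain x where x: "n < N" "x \<in> G" "first k n x" "C = I n x"
      using nC by (auto simp: cells_def)
    show meas: "C \<inter> ?\<Omega> \<in> sets \<mu>" unfolding x(4) by (intro sets.Int I_in_sets x(2) \<Omega>)
    obtain i j y where ijy: "j \<le> n" "i \<le> Suc j" "y \<in> I j x" "maj f n x = norm (f i y)"
      by (rule maj_attained[OF x(2)])
    \<comment> \<open>Were the maximum attained on a larger cell, of level \<open>j < n\<close>, the
      majorant would have reached \<open>2 powr k\<close> before time \<open>n\<close>.\<close>
    have "maj f n x \<le> maj f j x" unfolding ijy(4) by (rule maj_ge[OF order_refl ijy(2,3)])
    with x(3) ijy(1) have "j = n" unfolding first_def by (metis le_neq_implies_less leD order_trans)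
    with ijy have y: "y \<in> I n x" "i \<le> Suc n" by auto
    have yG: "y \<in> G" using y I_subset_G by blast
    have "I (Suc n) y \<subseteq> C \<inter> ?\<Omega>"
    proof
      fix z assume z: "z \<in> I (Suc n) y"
      then have "z \<in> I n x" using I_antimono[of n "Suc n" y] I_eq[OF y(1)] by auto
      have "norm (f i z) = norm (f i y)"
        using levelD[OF level_f'[OF y(2)] yG z] by simp
      moreover have "norm (f i z) \<le> star f N z" using y(2) x(1) by (intro star_ge) simp
      ultimately have "2 powr real_of_int k \<le> star f N z"
        using x(3) ijy(4) by (simp add: first_def)
      then show "z \<in> C \<inter> ?\<Omega>" using \<open>z \<in> I n x\<close> x(4) z I_subset_G by blast
    qed
    then have "emeasure \<mu> (I (Suc n) y) \<le> emeasure \<mu> (C \<inter> ?\<Omega>)"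
      by (rule emeasure_mono[OF _ meas])
    then have "ennreal (real R) * ennreal (1 / real (P (Suc n))) \<le> ennreal (real R) * emeasure \<mu> (C \<inter> ?\<Omega>)"
      unfolding emeasure_I[OF yG] by (rule mult_left_mono) simp
    moreover have "1 / real (P n) \<le> real R * (1 / real (P (Suc n)))"
      using P_Suc_le[of n] P_pos[of n] P_pos[of "Suc n"] by (simp add: field_simps del: gen_pow.simps flip: of_nat_mult)
    ultimately show "ennreal (1 / real (P n)) \<le> ennreal (real R) * emeasure \<mu> (C \<inter> ?\<Omega>)"
      by (simp add: ennreal_mult'[symmetric] order_trans[OF ennreal_leI] del: gen_pow.simps)
  qed
  have disj: "disjoint_family_on (\<lambda>(n, C). C \<inter> ?\<Omega>) (cells N k)"
  proof (clarsimp simp: disjoint_family_on_def disjoint_iff)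
    fix n C n' C' t assume C: "(n, C) \<in> cells N k" "(n', C') \<in> cells N k" "n = n' \<longrightarrow> C \<noteq> C'"
      and t: "t \<in> C" "t \<in> C'"
    obtain x where x: "x \<in> G" "first k n x" "C = I n x" using C(1) by (auto simp: cells_def)
    obtain x' where x': "x' \<in> G" "first k n' x'" "C' = I n' x'" using C(2) by (auto simp: cells_def)
    have "first k n t" using levelD[OF level_first x(1), of t n] t x by simp
    moreover have "first k n' t" using levelD[OF level_first x'(1), of t n'] t x' by simp
    ultimately have "n = n'" by (rule first_unique)
    then show False using C(3) t x(3) x'(3) I_eq[of t n x] I_eq[of t n x'] by simp
  qed
  have "(\<Sum>(n, C)\<in>cells N k. ennreal (1 / real (P n)))
      \<le> (\<Sum>(n, C)\<in>cells N k. ennreal (real R) * emeasure \<mu> (C \<inter> ?\<Omega>))"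
    using each by (intro sum_mono) auto
  also have "\<dots> = ennreal (real R) * (\<Sum>i\<in>cells N k. emeasure \<mu> ((\<lambda>(n, C). C \<inter> ?\<Omega>) i))"
    by (simp add: sum_distrib_left case_prod_unfold)
  also have "(\<Sum>i\<in>cells N k. emeasure \<mu> ((\<lambda>(n, C). C \<inter> ?\<Omega>) i)) = emeasure \<mu> (\<Union>i\<in>cells N k. (\<lambda>(n, C). C \<inter> ?\<Omega>) i)"
    using meas by (intro sum_emeasure disj finite_mcells) auto
  also have "\<dots> \<le> emeasure \<mu> ?\<Omega>" by (intro emeasure_mono \<Omega>) auto
  finally show ?thesis by (simp add: mult_left_mono)
qed

end
end

context vilenkin_exponent begin

text \<open>Atoms enter only through their heights and levels; summing levels within one band gives
  a distribution function of \<open>star\<close>, and summing bands restores its p-th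
  moment.\<close>

lemma maxop_martingale:
  obtains K where "0 < K"
    and "\<And>f N Q. \<lbrakk>cell_martingale f; 1 \<le> Q\<rbrakk> \<Longrightarrow>
      (\<integral>\<^sup>+x. ennreal (maxop Q (f N) x powr p) \<partial>\<mu>) \<le> ennreal K * (\<integral>\<^sup>+x. ennreal (star f N x powr p) \<partial>\<mu>)"
proof -
  obtain C1 where C1: "0 < C1" and bdd: "\<And>N F A x q. \<lbrakk>level N F; \<And>t. t \<in> G \<Longrightarrow> norm (F t) \<le> A; x \<in> G; 1 \<le> q\<rbrakk>
      \<Longrightarrow> norm (lsum q F x) \<le> C1 * A * (real q + 1) powr eps"
    using lsum_bounded[OF eps_pos] by blast
  obtain Ca where Ca: "0 < Ca" and atom: "\<And>n c A a Q. \<lbrakk>atom n c A a; 1 \<le> Q\<rbrakk> \<Longrightarrow>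
      (\<integral>\<^sup>+x. ennreal (maxop Q a x powr p) \<partial>\<mu>) \<le> ennreal (Ca * A powr p / real (P n))"
    using atom_maxop by blast
  define Kp where "Kp = 1 / (1 - 2 powr - p)"
  have Kp: "0 \<le> Kp" using p_pos by (simp add: Kp_def powr_less_one less_imp_le)
  \<comment> \<open>The factors are the atom constant, the height \<open>4 * 2 powr k\<close>
    without its dyadic part, and the loss \<open>R\<close> from \<open>sum_cells_le\<close>.\<close>
  define K2 where "K2 = Ca * 4 powr p * real R"
  have K2: "0 \<le> K2" using Ca by (simp add: K2_def)
  define K where "K = C1 powr p + K2 * Kp"
  have K: "0 < K" unfolding K_def using C1 Kp K2 by (intro add_pos_nonneg) auto
  have "(\<integral>\<^sup>+x. ennreal (maxop Q (f N) x powr p) \<partial>\<mu>) \<le> ennreal K * (\<integral>\<^sup>+x. ennreal (star f N x powr p) \<partial>\<mu>)"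
    if f: "cell_martingale f" and Q: "1 \<le> Q" for f N Q
  proof -
    define J where "J = (SIGMA k:bands f N. cells f N k)"
    define a :: "int \<times> nat \<times> (nat \<Rightarrow> int) set \<Rightarrow> (nat \<Rightarrow> int) \<Rightarrow> complex"
      where "a j t = (case j of (k, n, C) \<Rightarrow> indicator C t *\<^sub>R piece f N k t)" for j t
    have finJ: "finite J"
      unfolding J_def by (intro finite_SigmaI finite_bands[OF f] finite_mcells[OF f])
    have decomp: "f N t = f 0 t + (\<Sum>j\<in>J. a j t)" if "t \<in> G" for t
    proof -
      have "f N t = f 0 t + (\<Sum>k\<in>bands f N. \<Sum>i\<in>cells f N k. a (k, i) t)"
        using sum_pieces[OF f that, of N] piece_cells[OF f that, of N]
        by (simp add: a_def case_prod_unfold)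
      also have "(\<Sum>k\<in>bands f N. \<Sum>i\<in>cells f N k. a (k, i) t) = (\<Sum>j\<in>J. a j t)"
        unfolding J_def using finite_bands[OF f] finite_mcells[OF f] by (simp add: sum.Sigma)
      finally show ?thesis .
    qed
    have at: "atom n c (4 * 2 powr real_of_int k) (a (k, n, C))"
      if "(n, C) \<in> cells f N k" "c \<in> G" "first f k n c" "C = I n c" "n < N" for k n C c
      using atom_piece[OF f that(2,5,3)] that(4) by (simp add: a_def[abs_def])
    have cellE: "\<exists>c. c \<in> G \<and> first f k n c \<and> C = I n c \<and> n < N" if "(n, C) \<in> cells f N k" for k n C
      using that unfolding cells_def[OF f] by auto
    have lev0: "level N (f 0)" by (rule level_f'[OF f]) simp
    have leva: "level N (a j)" if j: "j \<in> J" for j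
    proof -
      obtain k n C where knC: "j = (k, n, C)" "(n, C) \<in> cells f N k" using j by (auto simp: J_def)
      then obtain c where c: "c \<in> G" "C = I n c" "n < N" using cellE by blast
      have "level N (\<lambda>t. indicator (I n c) t *\<^sub>R piece f N k t)"
        by (rule level_comp2[where h = "(*\<^sub>R)", OF level_mono[OF level_indicator[OF c(1)] less_imp_le[OF c(3)]]
              level_piece[OF f]])
      then show ?thesis using knC c by (simp add: a_def[abs_def])
    qed
    have lsum: "lsum q (f N) x = lsum q (f 0) x + (\<Sum>j\<in>J. lsum q (a j) x)" for q x
    proof -
      have "lsum q (f N) x = lsum q (\<lambda>t. f 0 t + (\<Sum>j\<in>J. a j t)) x"
        by (rule lsum_cong[OF decomp])
      also have "\<dots> = lsum q (f 0) x + lsum q (\<lambda>t. \<Sum>j\<in>J. a j t) x"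
        by (rule lsum_add[OF lev0 level_sum[OF leva]])
      also have "lsum q (\<lambda>t. \<Sum>j\<in>J. a j t) x = (\<Sum>j\<in>J. lsum q (a j) x)"
        by (rule lsum_sum[OF finJ leva])
      finally show ?thesis .
    qed
    \<comment> \<open>The initial term need not have mean zero, so it is no atom; it is constant on
      the group and \<open>lsum_bounded\<close> suffices.\<close>
    have f0: "maxop Q (f 0) x \<le> C1 * star f N x" if x: "x \<in> G" for x
    proof (rule maxop_le[OF Q])
      fix q :: nat assume q: "1 \<le> q"
      have "norm (f 0 t) \<le> norm (f 0 x)" if "t \<in> G" for t
        using levelD[OF level_f[OF f, of 0] x, of t] that by (simp add: mem_I)
      from bdd[OF lev0 this x q] have "norm (lsum q (f 0) x) \<le> C1 * norm (f 0 x) * (real q + 1) powr eps" .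
      then have "weight q * norm (lsum q (f 0) x) \<le> weight q * (C1 * norm (f 0 x) * (real q + 1) powr eps)"
        by (rule mult_left_mono) simp
      also have "\<dots> = C1 * norm (f 0 x)" unfolding weight_def powr_minus by simp
      also have "\<dots> \<le> C1 * star f N x" using C1 by (intro mult_left_mono star_ge) auto
      finally show "weight q * norm (lsum q (f 0) x) \<le> C1 * star f N x" .
    qed
    have pt: "maxop Q (f N) x powr p \<le> C1 powr p * star f N x powr p + (\<Sum>j\<in>J. maxop Q (a j) x powr p)"
      if x: "x \<in> G" for x
    proof -
      have "maxop Q (f N) x \<le> C1 * star f N x + (\<Sum>j\<in>J. maxop Q (a j) x)"
      proof (rule maxop_le[OF Q])
        fix q assume q: "1 \<le> q" "q \<le> Q"
        have "weight q * norm (lsum q (f N) x) \<le> weight q * (norm (lsum q (f 0) x) + (\<Sum>j\<in>J. norm (lsum q (a j) x)))"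
          unfolding lsum by (intro mult_left_mono order_trans[OF norm_triangle_ineq] add_left_mono norm_sum) simp
        also have "\<dots> = weight q * norm (lsum q (f 0) x) + (\<Sum>j\<in>J. weight q * norm (lsum q (a j) x))"
          by (simp add: distrib_left sum_distrib_left)
        also have "\<dots> \<le> C1 * star f N x + (\<Sum>j\<in>J. maxop Q (a j) x)"
          using order_trans[OF maxop_ge[OF q] f0[OF x]] by (intro add_mono sum_mono maxop_ge q) auto
        finally show "weight q * norm (lsum q (f N) x) \<le> C1 * star f N x + (\<Sum>j\<in>J. maxop Q (a j) x)" .
      qed
      then have "maxop Q (f N) x powr p \<le> (C1 * star f N x + (\<Sum>j\<in>J. maxop Q (a j) x)) powr p"
        using p_pos maxop_nonneg[OF Q] by (intro powr_mono2) auto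
      also have "\<dots> \<le> (C1 * star f N x) powr p + (\<Sum>j\<in>J. maxop Q (a j) x) powr p"
        using C1 p_pos p_less by (intro powr_add_le sum_nonneg maxop_nonneg Q mult_nonneg_nonneg star_nonneg) auto
      also have "\<dots> \<le> (C1 * star f N x) powr p + (\<Sum>j\<in>J. maxop Q (a j) x powr p)"
        using p_pos p_less by (intro add_left_mono powr_sum_le finJ maxop_nonneg Q) auto
      also have "(C1 * star f N x) powr p = C1 powr p * star f N x powr p"
        using C1 star_nonneg by (simp add: powr_mult)
      finally show ?thesis .
    qed
    have star_meas: "star f N \<in> borel_measurable \<mu>"
      by (rule level_measurable[OF level_star[OF f]]) simp
    note [measurable] = star_meas maxop_measurable
    let ?S = "\<integral>\<^sup>+x. ennreal (star f N x powr p) \<partial>\<mu>"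
    have "(\<integral>\<^sup>+x. ennreal (maxop Q (f N) x powr p) \<partial>\<mu>)
        \<le> (\<integral>\<^sup>+x. ennreal (C1 powr p) * ennreal (star f N x powr p) + (\<Sum>j\<in>J. ennreal (maxop Q (a j) x powr p)) \<partial>\<mu>)"
    proof (rule nn_integral_mono)
      fix x assume "x \<in> space \<mu>"
      then have "ennreal (maxop Q (f N) x powr p) \<le>
          ennreal (C1 powr p * star f N x powr p + (\<Sum>j\<in>J. maxop Q (a j) x powr p))"
        by (intro ennreal_leI pt) simp
      also have "\<dots> = ennreal (C1 powr p * star f N x powr p) + ennreal (\<Sum>j\<in>J. maxop Q (a j) x powr p)"
        by (intro ennreal_plus sum_nonneg) auto
      also have "\<dots> = ennreal (C1 powr p) * ennreal (star f N x powr p) + (\<Sum>j\<in>J. ennreal (maxop Q (a j) x powr p))"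
        by (simp add: ennreal_mult' sum_ennreal)
      finally show "ennreal (maxop Q (f N) x powr p) \<le>
          ennreal (C1 powr p) * ennreal (star f N x powr p) + (\<Sum>j\<in>J. ennreal (maxop Q (a j) x powr p))" .
    qed
    also have "\<dots> = (\<integral>\<^sup>+x. ennreal (C1 powr p) * ennreal (star f N x powr p) \<partial>\<mu>)
        + (\<integral>\<^sup>+x. (\<Sum>j\<in>J. ennreal (maxop Q (a j) x powr p)) \<partial>\<mu>)"
      by (rule nn_integral_add) measurable
    also have "(\<integral>\<^sup>+x. ennreal (C1 powr p) * ennreal (star f N x powr p) \<partial>\<mu>) = ennreal (C1 powr p) * ?S"
      by (rule nn_integral_cmult) measurable
    also have "(\<integral>\<^sup>+x. (\<Sum>j\<in>J. ennreal (maxop Q (a j) x powr p)) \<partial>\<mu>) =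
        (\<Sum>j\<in>J. \<integral>\<^sup>+x. ennreal (maxop Q (a j) x powr p) \<partial>\<mu>)"
      by (rule nn_integral_sum) measurable
    also have "\<dots> \<le> ennreal (K2 * Kp) * ?S"
    proof -
      have "(\<Sum>j\<in>J. \<integral>\<^sup>+x. ennreal (maxop Q (a j) x powr p) \<partial>\<mu>) =
          (\<Sum>k\<in>bands f N. \<Sum>i\<in>cells f N k. \<integral>\<^sup>+x. ennreal (maxop Q (a (k, i)) x powr p) \<partial>\<mu>)"
        unfolding J_def using finite_bands[OF f] finite_mcells[OF f] by (simp add: sum.Sigma)
      also have "\<dots> \<le> (\<Sum>k\<in>bands f N. ennreal (K2 * (2 powr real_of_int k) powr p) *
          emeasure \<mu> {z \<in> G. 2 powr real_of_int k \<le> star f N z})"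
      proof (rule sum_mono)
        fix k
        let ?c = "Ca * (4 * 2 powr real_of_int k) powr p"
        have "(\<Sum>i\<in>cells f N k. \<integral>\<^sup>+x. ennreal (maxop Q (a (k, i)) x powr p) \<partial>\<mu>)
            \<le> (\<Sum>(n, C)\<in>cells f N k. ennreal ?c * ennreal (1 / real (P n)))"
        proof (rule sum_mono)
          fix i assume i: "i \<in> cells f N k"
          obtain n C where nC: "i = (n, C)" by (cases i)
          then obtain c where c: "c \<in> G" "first f k n c" "C = I n c" "n < N" using cellE i by blast
          have "(\<integral>\<^sup>+x. ennreal (maxop Q (a (k, i)) x powr p) \<partial>\<mu>) \<le> ennreal (?c / real (P n))"
            using atom[OF at Q] i nC c by blast
          then show "(\<integral>\<^sup>+x. ennreal (maxop Q (a (k, i)) x powr p) \<partial>\<mu>) \<le> (case i of (n, C) \<Rightarrow> ennreal ?c * ennreal (1 / real (P n)))"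
            using Ca by (simp add: nC ennreal_mult'[symmetric])
        qed
        also have "\<dots> = ennreal ?c * (\<Sum>(n, C)\<in>cells f N k. ennreal (1 / real (P n)))"
          by (simp only: sum_distrib_left case_prod_unfold)
        also have "\<dots> \<le> ennreal ?c * (ennreal (real R) * emeasure \<mu> {z \<in> G. 2 powr real_of_int k \<le> star f N z})"
          by (intro mult_left_mono sum_cells_le[OF f]) simp
        also have "\<dots> = ennreal (?c * real R) * emeasure \<mu> {z \<in> G. 2 powr real_of_int k \<le> star f N z}"
          using Ca by (simp add: ennreal_mult' mult.assoc)
        also have "?c * real R = K2 * (2 powr real_of_int k) powr p"
          by (simp add: K2_def powr_mult)
        finally show "(\<Sum>i\<in>cells f N k. \<integral>\<^sup>+x. ennreal (maxop Q (a (k, i)) x powr p) \<partial>\<mu>)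
            \<le> ennreal (K2 * (2 powr real_of_int k) powr p) * emeasure \<mu> {z \<in> G. 2 powr real_of_int k \<le> star f N z}" .
      qed
      \<comment> \<open>Returning from measures to an integral of indicators allows
        \<open>dyadic_sum_le\<close> to be applied at each point with
        \<open>v = star f N x\<close>.\<close>
      also have "\<dots> = (\<integral>\<^sup>+x. (\<Sum>k\<in>bands f N. ennreal (K2 * (2 powr real_of_int k) powr p) *
          indicator {z \<in> G. 2 powr real_of_int k \<le> star f N z} x) \<partial>\<mu>)"
      proof -
        have meas: "{z \<in> G. 2 powr real_of_int k \<le> star f N z} \<in> sets \<mu>" for k
          by (rule level_set[OF level_comp[OF level_star[OF f], where h = "\<lambda>v. _ \<le> v"]])
        show ?thesis
          by (subst nn_integral_sum; (intro borel_measurable_times_ennreal borel_measurable_const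
                borel_measurable_indicator meas)?) (simp only: nn_integral_cmult_indicator meas)
      qed
      also have "\<dots> \<le> (\<integral>\<^sup>+x. ennreal (K2 * Kp) * ennreal (star f N x powr p) \<partial>\<mu>)"
      proof (rule nn_integral_mono)
        fix x assume x: "x \<in> space \<mu>"
        have "(\<Sum>k\<in>bands f N. ennreal (K2 * (2 powr real_of_int k) powr p) *
            indicator {z \<in> G. 2 powr real_of_int k \<le> star f N z} x) =
          (\<Sum>k\<in>bands f N. ennreal (K2 * (if 2 powr real_of_int k \<le> star f N x then (2 powr real_of_int k) powr p else 0)))"
          using x by (intro sum.cong) (auto simp: indicator_def)
        also have "\<dots> = ennreal (K2 * (\<Sum>k\<in>bands f N. if 2 powr real_of_int k \<le> star f N x then (2 powr real_of_int k) powr p else 0))"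
          using K2 by (simp add: sum_ennreal sum_distrib_left)
        also have "\<dots> \<le> ennreal (K2 * (star f N x powr p / (1 - 2 powr - p)))"
          by (intro ennreal_leI mult_left_mono dyadic_sum_le star_nonneg p_pos finite_bands[OF f] K2)
        also have "\<dots> = ennreal (K2 * Kp) * ennreal (star f N x powr p)"
          using K2 Kp by (simp add: Kp_def ennreal_mult'[symmetric])
        finally show "(\<Sum>k\<in>bands f N. ennreal (K2 * (2 powr real_of_int k) powr p) *
            indicator {z \<in> G. 2 powr real_of_int k \<le> star f N z} x) \<le> ennreal (K2 * Kp) * ennreal (star f N x powr p)" .
      qed
      also have "\<dots> = ennreal (K2 * Kp) * ?S"
        by (rule nn_integral_cmult) measurable
      finally show ?thesis .
    qed
    finally have "(\<integral>\<^sup>+x. ennreal (maxop Q (f N) x powr p) \<partial>\<mu>) \<le> ennreal (C1 powr p) * ?S + ennreal (K2 * Kp) * ?S"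
      by (simp add: add_left_mono)
    also have "\<dots> = ennreal K * ?S"
      using K2 Kp by (simp add: K_def distrib_right[symmetric] ennreal_plus[symmetric] del: ennreal_plus)
    finally show ?thesis .
  qed
  with K that show thesis by blast
qed

end

section \<open>The weighted maximal operator\<close>

context vilenkin begin

text \<open>Later increments are orthogonal to a character that is constant on cells of level
  \<open>N\<close>, so the sequence in the limit is constant from \<open>N\<close> on.\<close>

lemma vilenkin_coeff_eq:
  assumes f: "cell_martingale f" and j: "j < P N"
  shows "vilenkin_coeff m f j = (\<integral>t. f N t * cnj (vilenkin_fun m j t) \<partial>\<mu>)"
  unfolding vilenkin_coeff_def
proof (rule limI, rule tendsto_eventually, rule eventually_sequentiallyI)
  fix k assume k: "N \<le> k"
  have lev: "level N (\<lambda>t. cnj (vilenkin_fun m j t))"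
    by (rule level_comp[OF level_vilenkin_fun[OF j]])
  have int: "integrable \<mu> (\<lambda>t. f i t * cnj (vilenkin_fun m j t))" for i
    by (rule level_integrable[OF level_mult_cnj_vilenkin[OF level_f[OF f]]])
  show "(\<integral>t. f k t * cnj (vilenkin_fun m j t) \<partial>\<mu>) = (\<integral>t. f N t * cnj (vilenkin_fun m j t) \<partial>\<mu>)"
    using diff_mult_level[OF f lev k] int by (simp add: left_diff_distrib)
qed

lemma vilenkin_partial_sum_eq:
  assumes f: "cell_martingale f" and k: "k \<le> P N"
  shows "vilenkin_partial_sum m k f x = psum (f N) k x"
  unfolding vilenkin_partial_sum_def psum_def
  using k by (intro sum.cong) (auto simp: vilenkin_coeff_eq[OF f])

lemma riesz_mean_eq:
  assumes f: "cell_martingale f" and q: "q \<le> P N"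
  shows "riesz_mean m q f x = lsum q (f N) x / of_real (harm q)"
  unfolding riesz_mean_def lsum_def
  using q by (intro arg_cong2[where f = "(/)"] sum.cong refl vilenkin_partial_sum_eq f) auto

lemma lsum_martingale_eq:
  assumes f: "cell_martingale f" and "q \<le> P N" "N \<le> N'"
  shows "lsum q (f N') x = lsum q (f N) x"
  unfolding lsum_def using assms P_mono[OF assms(3)]
  by (intro sum.cong refl) (simp add: vilenkin_partial_sum_eq[OF f, symmetric])

end

context vilenkin_exponent begin

lemma riesz_maximal_bounded:
  "\<exists>c::real. \<forall>f\<in>hardy_space m p.
     Lp_qnorm \<mu> p (\<lambda>x. SUP n\<in>{1..}.
       ennreal (ln (real n + 1) * cmod (riesz_mean m n f x) / (real n + 1) powr eps))
     \<le> ennreal c * Hp_qnorm m p f"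
proof -
  obtain K where K: "0 < K" and main: "\<And>f N Q. \<lbrakk>cell_martingale f; 1 \<le> Q\<rbrakk> \<Longrightarrow>
      (\<integral>\<^sup>+x. ennreal (maxop Q (f N) x powr p) \<partial>\<mu>) \<le> ennreal K * (\<integral>\<^sup>+x. ennreal (star f N x powr p) \<partial>\<mu>)"
    using maxop_martingale by blast
  show ?thesis
  proof (intro exI[of _ "K powr (1 / p)"] ballI)
    fix f assume "f \<in> hardy_space m p"
    then have f: "cell_martingale f"
      by (simp add: hardy_space_def martingale_imp_cell_martingale)
    let ?T = "\<lambda>x. SUP n\<in>{1..}. ennreal (ln (real n + 1) * cmod (riesz_mean m n f x) / (real n + 1) powr eps)"
    \<comment> \<open>A diagonal choice: the range \<open>q \<le> P N\<close> is exactly the one for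
      which \<open>f N\<close> determines the Riesz means of \<open>f\<close>.\<close>
    let ?h = "\<lambda>N x. maxop (P N) (f N) x"
    have h0: "0 \<le> ?h N x" for N x by (rule maxop_nonneg[OF P_ge_1])
    have T: "?T x \<le> (SUP N. ennreal (?h N x))" for x
    proof (rule SUP_least)
      fix n :: nat assume "n \<in> {1..}"
      then have n: "1 \<le> n" by simp
      have nP: "n \<le> P n" using less_P[of n] by simp
      have harm: "0 < (harm n :: real)" using n by (intro harm_pos) auto
      have w: "weight n = 1 / (real n + 1) powr eps" unfolding weight_def by (rule powr_minus_divide)
      have "ln (real n + 1) / harm n \<le> 1"
        using ln_le_harm[of n] harm by simp
      then have "ln (real n + 1) / harm n * (weight n * norm (lsum n (f n) x)) \<le> 1 * (weight n * norm (lsum n (f n) x))"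
        by (rule mult_right_mono) simp
      also have "\<dots> \<le> ?h n x" using maxop_ge[OF n nP] by simp
      also have "ln (real n + 1) / harm n * (weight n * norm (lsum n (f n) x))
          = ln (real n + 1) * cmod (riesz_mean m n f x) / (real n + 1) powr eps"
        using harm by (simp add: riesz_mean_eq[OF f nP] norm_divide w)
      finally have "ennreal (ln (real n + 1) * cmod (riesz_mean m n f x) / (real n + 1) powr eps) \<le> ennreal (?h n x)"
        by (rule ennreal_leI)
      also have "\<dots> \<le> (SUP N. ennreal (?h N x))" by (rule SUP_upper) simp
      finally show "ennreal (ln (real n + 1) * cmod (riesz_mean m n f x) / (real n + 1) powr eps)
          \<le> (SUP N. ennreal (?h N x))" .
    qed
    \<comment> \<open>Both the function and the range change with \<open>N\<close>, but for old
      \<open>q\<close> the sums stay the same, so the maximum can only grow.\<close>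
    have inc: "?h N x \<le> ?h N' x" if "N \<le> N'" for N N' x
    proof (rule maxop_le[OF P_ge_1])
      fix q assume q: "1 \<le> q" "q \<le> P N"
      have "q \<le> P N'" using q P_mono[OF that] by simp
      from maxop_ge[OF q(1) this, of "f N'" x]
      show "weight q * norm (lsum q (f N) x) \<le> ?h N' x"
        using lsum_martingale_eq[OF f q(2) that] by simp
    qed
    note [measurable] = maxop_measurable
    have "(\<integral>\<^sup>+x. enn_powr (?T x) p \<partial>\<mu>) \<le> (\<integral>\<^sup>+x. (SUP N. ennreal (?h N x powr p)) \<partial>\<mu>)"
    proof (rule nn_integral_mono)
      fix x
      have "enn_powr (?T x) p \<le> enn_powr (SUP N. ennreal (?h N x)) p"
        by (rule enn_powr_mono[OF T p_pos])
      also have "\<dots> \<le> (SUP N. enn_powr (ennreal (?h N x)) p)"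
        by (rule enn_powr_SUP_le[OF p_pos])
      finally show "enn_powr (?T x) p \<le> (SUP N. ennreal (?h N x powr p))"
        by (simp add: enn_powr_ennreal h0)
    qed
    also have "\<dots> = (SUP N. \<integral>\<^sup>+x. ennreal (?h N x powr p) \<partial>\<mu>)"
    proof (rule nn_integral_monotone_convergence_SUP)
      show "incseq (\<lambda>N x. ennreal (?h N x powr p))"
        using inc h0 p_pos by (auto simp: incseq_def le_fun_def intro!: ennreal_leI powr_mono2)
    qed measurable
    also have "\<dots> \<le> ennreal K * (\<integral>\<^sup>+x. enn_powr (mart_maximal f x) p \<partial>\<mu>)"
    proof (rule SUP_least)
      fix N
      have "(\<integral>\<^sup>+x. ennreal (?h N x powr p) \<partial>\<mu>) \<le> ennreal K * (\<integral>\<^sup>+x. ennreal (star f N x powr p) \<partial>\<mu>)"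
        by (rule main[OF f P_ge_1])
      also have "\<dots> \<le> ennreal K * (\<integral>\<^sup>+x. enn_powr (mart_maximal f x) p \<partial>\<mu>)"
      proof (intro mult_left_mono nn_integral_mono)
        fix x
        have "star f N x \<in> (\<lambda>i. norm (f i x)) ` {..N}" unfolding star_def by (intro Max_in) auto
        then obtain i where i: "star f N x = norm (f i x)" by auto
        have "ennreal (star f N x) \<le> mart_maximal f x"
          unfolding mart_maximal_def i by (rule SUP_upper) simp
        from enn_powr_mono[OF this p_pos]
        show "ennreal (star f N x powr p) \<le> enn_powr (mart_maximal f x) p"
          by (simp add: enn_powr_ennreal star_nonneg)
      qed simp
      finally show "(\<integral>\<^sup>+x. ennreal (?h N x powr p) \<partial>\<mu>) \<le> ennreal K * (\<integral>\<^sup>+x. enn_powr (mart_maximal f x) p \<partial>\<mu>)" .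
    qed
    finally have "enn_powr (\<integral>\<^sup>+x. enn_powr (?T x) p \<partial>\<mu>) (1 / p)
        \<le> enn_powr (ennreal K * (\<integral>\<^sup>+x. enn_powr (mart_maximal f x) p \<partial>\<mu>)) (1 / p)"
      using p_pos by (intro enn_powr_mono) auto
    also have "\<dots> = ennreal (K powr (1 / p)) * Hp_qnorm m p f"
      using K p_pos by (simp add: enn_powr_cmult Hp_qnorm_def Lp_qnorm_def)
    finally show "Lp_qnorm \<mu> p ?T \<le> ennreal (K powr (1 / p)) * Hp_qnorm m p f"
      by (simp add: Lp_qnorm_def)
  qed
qed

end

section \<open>Sharpness of the weight\<close>

context vilenkin begin

abbreviation origin :: "nat \<Rightarrow> int" where "origin \<equiv> (\<lambda>_. 0)"

definition bump :: "nat \<Rightarrow> (nat \<Rightarrow> int) \<Rightarrow> complex" where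
  "bump K x = indicator (I K origin) x *\<^sub>R (of_nat (P K) * gen_rademacher m K x)"

definition bump_martingale :: "nat \<Rightarrow> nat \<Rightarrow> (nat \<Rightarrow> int) \<Rightarrow> complex" where
  "bump_martingale K n = (if n \<le> K then (\<lambda>_. 0) else bump K)"

lemma origin_G: "origin \<in> G"
proof -
  have "0 < m k" for k using m_ge[of k] by auto
  then show ?thesis by (simp add: G_iff)
qed

lemma level_bump: "level (Suc K) (bump K)"
  unfolding bump_def
  by (rule level_comp2[where h = "\<lambda>u v. u *\<^sub>R (of_nat (P K) * v)",
        OF level_mono[OF level_indicator[OF origin_G]] level_rademacher]) auto

lemma level_bump_martingale: "level n (bump_martingale K n)"
  using level_mono[OF level_bump, of K n] by (auto simp: bump_martingale_def)

text \<open>The cell splits into \<open>m K\<close> children of equal measure, on which the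
  Rademacher factor runs through all \<open>m K\<close>-th roots of unity.\<close>

lemma integral_bump: "(\<integral>t. bump K t \<partial>\<mu>) = 0"
proof -
  define c where "c u = origin(K := int u)" for u
  define z where "z = exp (2 * of_real pi * \<i> / of_nat (m K))"
  have cG: "c u \<in> G" if "u < m K" for u
    using that origin_G by (auto simp: c_def G_iff)
  have rc: "gen_rademacher m K (c u) = z ^ u" for u
    unfolding gen_rademacher_def z_def c_def exp_of_nat_mult[symmetric] by (simp add: field_simps)
  have m1: "1 < m K" using m_ge[of K] by simp
  have zr: "z = ratio (c 1) origin K" by (simp add: z_def ratio_exp c_def)
  have z: "z ^ m K = 1" "z \<noteq> 1"
    unfolding zr using ratio_neq_1[OF cG[OF m1] origin_G, of K] by (auto simp: ratio_power c_def)
  have "(\<integral>t. bump K t \<partial>\<mu>) = (\<integral>t. (\<Sum>u<m K. indicator (I (Suc K) (c u)) t *\<^sub>R bump K t) \<partial>\<mu>)"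
  proof (rule Bochner_Integration.integral_cong[OF refl])
    fix t assume "t \<in> space \<mu>"
    then have t: "t \<in> G" by simp
    show "bump K t = (\<Sum>u<m K. indicator (I (Suc K) (c u)) t *\<^sub>R bump K t)"
    proof (cases "t \<in> I K origin")
      case True
      have tK: "0 \<le> t K" "t K < int (m K)" using t by (auto simp: G_iff)
      have mem: "t \<in> I (Suc K) (c u) \<longleftrightarrow> u = nat (t K)" for u
        using True tK by (auto simp: mem_I c_def less_Suc_eq)
      have "(\<Sum>u<m K. indicator (I (Suc K) (c u)) t *\<^sub>R bump K t) = (\<Sum>u<m K. if u = nat (t K) then bump K t else 0)"
        by (intro sum.cong) (auto simp: indicator_def mem)
      then show ?thesis using tK by simp
    qed (simp add: bump_def)
  qed
  also have "\<dots> = (\<Sum>u<m K. \<integral>t. indicator (I (Suc K) (c u)) t *\<^sub>R bump K t \<partial>\<mu>)"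
    using cG by (intro Bochner_Integration.integral_sum integrable_mult_indicator level_integrable[OF level_bump] I_in_sets) auto
  also have "\<dots> = (\<Sum>u<m K. (of_nat (P K) * z ^ u) / of_nat (P (Suc K)))"
  proof (rule sum.cong[OF refl])
    fix u assume "u \<in> {..<m K}"
    then have u: "c u \<in> G" using cG by simp
    have "c u \<in> I K origin" using u by (auto simp: mem_I c_def)
    then have "bump K (c u) = of_nat (P K) * z ^ u" by (simp add: bump_def rc)
    then show "(\<integral>t. indicator (I (Suc K) (c u)) t *\<^sub>R bump K t \<partial>\<mu>) = (of_nat (P K) * z ^ u) / of_nat (P (Suc K))"
      using integral_cell[OF u, of "Suc K" "bump K" "of_nat (P K) * z ^ u"] levelD[OF level_bump u]
      by (simp del: gen_pow.simps)
  qed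
  also have "\<dots> = 0"
    using geometric_root_sum[OF z] unfolding sum_divide_distrib[symmetric] sum_distrib_left[symmetric] by simp
  finally show ?thesis .
qed

lemma integral_bump_mult:
  assumes "level K (g :: _ \<Rightarrow> complex)"
  shows "(\<integral>t. bump K t * g t \<partial>\<mu>) = 0"
proof -
  have "(\<integral>t. bump K t * g t \<partial>\<mu>) = (\<integral>t. bump K t * g origin \<partial>\<mu>)"
    using levelD[OF assms origin_G]
    by (intro Bochner_Integration.integral_cong) (auto simp: bump_def indicator_def)
  then show ?thesis by (simp add: integral_bump)
qed

text \<open>Only \<open>n \<le> K < k\<close> needs an argument: sets of \<open>\<F> n\<close> are
  then unions of cells of level \<open>K\<close>, and the bump has mean zero against each of
  them.\<close>

lemma vilenkin_martingale_bump: "vilenkin_martingale m (bump_martingale K)"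
  unfolding vilenkin_martingale_def
proof (intro conjI allI impI)
  fix n show "bump_martingale K n \<in> borel_measurable (\<F> n)"
    by (rule level_measurable_F[OF level_bump_martingale]) simp
  show int: "integrable \<mu> (bump_martingale K n)" for n
    by (rule level_integrable[OF level_bump_martingale])
  fix k assume nk: "n \<le> k"
  interpret sigma_finite_subalgebra \<mu> "\<F> n"
    using subalgebra_vilenkin_algebra[of m n]
    by (intro finite_measure_subalgebra_is_sigma_finite finite_measure_subalgebra.intro
        finite_measure_subalgebra_axioms.intro finite_measure_axioms)
  have meas: "(\<lambda>y. Re (bump_martingale K n y)) \<in> borel_measurable (\<F> n)"
    "(\<lambda>y. Im (bump_martingale K n y)) \<in> borel_measurable (\<F> n)"
    by (rule level_measurable_F[OF level_comp[OF level_bump_martingale]]; simp)+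
  have 0: "(\<integral>y. indicator A y *\<^sub>R bump_martingale K k y \<partial>\<mu>) = (\<integral>y. indicator A y *\<^sub>R bump_martingale K n y \<partial>\<mu>)"
    if A: "A \<in> sets (\<F> n)" for A
  proof (cases "n \<le> K \<and> K < k")
    case True
    have "level K (\<lambda>y. y \<in> A)" using True by (intro level_mono[OF F_set_level[OF A]]) simp
    then have "level K (\<lambda>y. if y \<in> A then 1 else 0 :: complex)" by (rule level_comp)
    note integral_bump_mult[OF this]
    also have "(\<lambda>y. bump K y * (if y \<in> A then 1 else 0)) = (\<lambda>y. indicator A y *\<^sub>R bump K y)"
      by (auto simp: fun_eq_iff indicator_def)
    finally have "(\<integral>y. indicator A y *\<^sub>R bump K y \<partial>\<mu>) = 0" .
    then show ?thesis using True by (simp add: bump_martingale_def)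
  next
    case False
    then have "bump_martingale K k = bump_martingale K n" using nk by (auto simp: bump_martingale_def)
    then show ?thesis by simp
  qed
  have intA: "integrable \<mu> (\<lambda>y. indicator A y *\<^sub>R bump_martingale K j y)" if "A \<in> sets (\<F> n)" for A j
    by (rule integrable_mult_indicator[OF sets_F_subset[OF that] int])
  have "AE x in \<mu>. real_cond_exp \<mu> (\<F> n) (\<lambda>y. Re (bump_martingale K k y)) x = Re (bump_martingale K n x)"
  proof (rule real_cond_exp_charact)
    fix A assume A: "A \<in> sets (\<F> n)"
    show "(\<integral>x\<in>A. Re (bump_martingale K k x) \<partial>\<mu>) = (\<integral>x\<in>A. Re (bump_martingale K n x) \<partial>\<mu>)"
      using arg_cong[where f = Re, OF 0[OF A]] integral_Re[OF intA[OF A]]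
      by (simp add: set_lebesgue_integral_def)
  qed (use int meas in auto)
  moreover have "AE x in \<mu>. real_cond_exp \<mu> (\<F> n) (\<lambda>y. Im (bump_martingale K k y)) x = Im (bump_martingale K n x)"
  proof (rule real_cond_exp_charact)
    fix A assume A: "A \<in> sets (\<F> n)"
    show "(\<integral>x\<in>A. Im (bump_martingale K k x) \<partial>\<mu>) = (\<integral>x\<in>A. Im (bump_martingale K n x) \<partial>\<mu>)"
      using arg_cong[where f = Im, OF 0[OF A]] integral_Im[OF intA[OF A]]
      by (simp add: set_lebesgue_integral_def)
  qed (use int meas in auto)
  ultimately show "AE x in \<mu>. bump_martingale K n x =
      Complex (real_cond_exp \<mu> (\<F> n) (\<lambda>y. Re (bump_martingale K k y)) x)
        (real_cond_exp \<mu> (\<F> n) (\<lambda>y. Im (bump_martingale K k y)) x)"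
    by eventually_elim (simp add: complex_eq_iff)
qed

lemma norm_riesz_mean_bump: "norm (riesz_mean m (Suc (P K)) (bump_martingale K) x) = 1 / (real (Suc (P K)) * harm (Suc (P K)))"
proof -
  have f: "cell_martingale (bump_martingale K)"
    by (rule martingale_imp_cell_martingale[OF vilenkin_martingale_bump])
  have fS: "bump_martingale K (Suc K) = bump K" by (simp add: bump_martingale_def)
  \<comment> \<open>Level \<open>Suc K\<close>, where the martingale equals the bump, therefore
    already determines the mean of order \<open>P K + 1\<close>.\<close>
  have le: "Suc (P K) \<le> P (Suc K)"
  proof -
    have "2 * P K \<le> m K * P K" using m_ge by (rule mult_le_mono1)
    then show ?thesis using P_ge_1[of K] unfolding gen_pow.simps by linarith
  qed
  have low: "(\<integral>t. bump K t * cnj (vilenkin_fun m j t) \<partial>\<mu>) = 0" if "j < P K" for j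
    by (rule integral_bump_mult[OF level_comp[OF level_vilenkin_fun[OF that]]])
  have top: "(\<integral>t. bump K t * cnj (vilenkin_fun m (P K) t) \<partial>\<mu>) = 1"
  proof -
    have "bump K t * cnj (vilenkin_fun m (P K) t) = indicator (I K origin) t *\<^sub>R of_nat (P K)" for t
      using complex_norm_square[of "gen_rademacher m K t"]
      by (simp add: bump_def vilenkin_fun_chi chi_P indicator_def)
    then show ?thesis
      using integral_cell[OF origin_G, of K "\<lambda>_. of_nat (P K)" "of_nat (P K)"] P_pos[of K] by simp
  qed
  have ps0: "psum (bump K) k x = 0" if "k \<le> P K" for k
    using low that by (simp add: psum_def)
  have ps1: "psum (bump K) (Suc (P K)) x = vilenkin_fun m (P K) x"
    using low top by (simp add: psum_def)
  have "lsum (Suc (P K)) (bump K) x = vilenkin_fun m (P K) x / of_nat (Suc (P K))"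
    unfolding lsum_def by (simp add: ps0 ps1 del: of_nat_Suc)
  then show ?thesis
    using riesz_mean_eq[OF f le, of x] harm_nonneg[of "Suc (P K)", where 'a = real]
    by (simp add: fS norm_divide norm_mult norm_of_nat del: of_nat_Suc)
qed

end

context vilenkin_exponent begin

lemma Hp_qnorm_bump: "Hp_qnorm m p (bump_martingale K) \<le> ennreal (real (P K) powr (1 - 1 / p))"
proof -
  have "(\<integral>\<^sup>+x. enn_powr (mart_maximal (bump_martingale K) x) p \<partial>\<mu>)
      \<le> (\<integral>\<^sup>+x. ennreal (real (P K) powr p) * indicator (I K origin) x \<partial>\<mu>)"
  proof (rule nn_integral_mono)
    fix x
    have "mart_maximal (bump_martingale K) x \<le> ennreal (real (P K) * indicator (I K origin) x)"
      unfolding mart_maximal_def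
      by (rule SUP_least) (auto simp: bump_martingale_def bump_def norm_mult indicator_def intro!: ennreal_leI)
    from enn_powr_mono[OF this p_pos]
    show "enn_powr (mart_maximal (bump_martingale K) x) p \<le> ennreal (real (P K) powr p) * indicator (I K origin) x"
      using p_pos by (auto simp: enn_powr_ennreal indicator_def split: if_splits)
  qed
  also have "\<dots> = ennreal (real (P K) powr p) * ennreal (1 / real (P K))"
    by (simp add: nn_integral_cmult_indicator I_in_sets origin_G emeasure_I)
  also have "\<dots> = ennreal (real (P K) powr p / real (P K))"
    by (simp add: ennreal_mult'[symmetric])
  also have "real (P K) powr p / real (P K) = real (P K) powr (p - 1)"
    unfolding powr_diff by simp
  finally have "enn_powr (\<integral>\<^sup>+x. enn_powr (mart_maximal (bump_martingale K) x) p \<partial>\<mu>) (1 / p)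
      \<le> enn_powr (ennreal (real (P K) powr (p - 1))) (1 / p)"
    using p_pos by (intro enn_powr_mono) auto
  also have "\<dots> = ennreal (real (P K) powr ((p - 1) * (1 / p)))"
    by (simp add: enn_powr_ennreal powr_powr)
  also have "(p - 1) * (1 / p) = 1 - 1 / p" using p_pos by (simp add: field_simps)
  finally show ?thesis by (simp add: Hp_qnorm_def Lp_qnorm_def)
qed

text \<open>The weak norm uses a strict inequality, so the threshold \<open>v\<close> itself might
  give the empty set; at \<open>v / 2\<close> the whole group qualifies.\<close>

lemma weak_Lp_qnorm_ge:
  assumes "0 < v" "\<And>x. x \<in> G \<Longrightarrow> ennreal v \<le> g x"
  shows "ennreal (v / 2) \<le> weak_Lp_qnorm \<mu> p g"
proof -
  have "ennreal (v / 2) < g x" if "x \<in> G" for x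
    using assms(1) by (intro less_le_trans[OF _ assms(2)[OF that]] ennreal_lessI) auto
  then have "{x \<in> space \<mu>. g x > ennreal (v / 2)} = space \<mu>" by auto
  then have "emeasure \<mu> {x \<in> space \<mu>. g x > ennreal (v / 2)} = 1"
    using emeasure_space_1 by simp
  moreover have "enn_powr 1 (1 / p) = 1" using enn_powr_ennreal[of 1 "1 / p"] by simp
  ultimately have "ennreal (v / 2) = ennreal (v / 2) * enn_powr (emeasure \<mu> {x \<in> space \<mu>. g x > ennreal (v / 2)}) (1 / p)"
    by simp
  also have "\<dots> \<le> weak_Lp_qnorm \<mu> p g"
    unfolding weak_Lp_qnorm_def using assms(1) by (intro SUP_upper) auto
  finally show ?thesis .
qed

lemma riesz_maximal_unbounded:
  fixes \<phi> :: "nat \<Rightarrow> real"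
  assumes \<phi>1: "\<And>n. 1 \<le> n \<Longrightarrow> 1 \<le> \<phi> n" and mono: "mono_on {1..} \<phi>"
    and limsup: "limsup (\<lambda>n. ereal ((real n + 1) powr eps / (ln (real n + 1) * \<phi> n))) = \<infinity>"
    and C: "\<And>f. f \<in> hardy_space m p \<Longrightarrow>
      weak_Lp_qnorm \<mu> p (\<lambda>x. SUP n\<in>{1..}. ennreal (cmod (riesz_mean m n f x) / \<phi> n)) \<le> ennreal C * Hp_qnorm m p f"
  shows False
proof -
  \<comment> \<open>The constant \<open>C\<close> may be negative, in which case
    \<open>ennreal\<close> truncates it to 0.\<close>
  define C' where "C' = max C 0"
  have C': "0 \<le> C'" by (simp add: C'_def)
  \<comment> \<open>The factor 4 combines the halved threshold of the weak norm with
    \<open>P K + 1 \<le> 2 * P K\<close>.\<close>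
  have key: "real (P K) powr eps \<le> 4 * C' * harm (Suc (P K)) * \<phi> (Suc (P K))" for K
  proof -
    let ?n = "Suc (P K)"
    define M where "M = real (P K)"
    have M: "1 \<le> M" using P_ge_1[of K] by (simp add: M_def)
    define v where "v = 1 / (real ?n * harm ?n) / \<phi> ?n"
    have harm: "0 < (harm ?n :: real)" by (rule harm_pos) simp
    have \<phi>: "0 < \<phi> ?n" using \<phi>1[of ?n] by simp
    have v: "0 < v" unfolding v_def using harm \<phi> by simp
    let ?f = "bump_martingale K"
    have Hp: "Hp_qnorm m p ?f \<le> ennreal (M powr (1 - 1 / p))" unfolding M_def by (rule Hp_qnorm_bump)
    then have "?f \<in> hardy_space m p"
      using vilenkin_martingale_bump by (auto simp: hardy_space_def intro: le_less_trans)
    from C[OF this]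
    have "weak_Lp_qnorm \<mu> p (\<lambda>x. SUP n\<in>{1..}. ennreal (cmod (riesz_mean m n ?f x) / \<phi> n)) \<le> ennreal C * Hp_qnorm m p ?f" .
    moreover have "ennreal (v / 2) \<le> weak_Lp_qnorm \<mu> p (\<lambda>x. SUP n\<in>{1..}. ennreal (cmod (riesz_mean m n ?f x) / \<phi> n))"
    proof (rule weak_Lp_qnorm_ge[OF v])
      fix x
      have "ennreal v = ennreal (cmod (riesz_mean m ?n ?f x) / \<phi> ?n)"
        by (simp add: v_def norm_riesz_mean_bump del: of_nat_Suc)
      also have "\<dots> \<le> (SUP n\<in>{1..}. ennreal (cmod (riesz_mean m n ?f x) / \<phi> n))"
        by (rule SUP_upper) simp
      finally show "ennreal v \<le> (SUP n\<in>{1..}. ennreal (cmod (riesz_mean m n ?f x) / \<phi> n))" .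
    qed
    ultimately have "ennreal (v / 2) \<le> ennreal C * Hp_qnorm m p ?f" by (rule order_trans[rotated])
    also have "\<dots> \<le> ennreal C' * ennreal (M powr (1 - 1 / p))"
      using Hp by (intro mult_mono ennreal_leI) (auto simp: C'_def)
    also have "\<dots> = ennreal (C' * M powr (1 - 1 / p))" using C' by (simp add: ennreal_mult'[symmetric])
    finally have "v / 2 \<le> C' * M powr (1 - 1 / p)" using C' by (simp add: ennreal_le_iff)
    then have "1 \<le> 2 * C' * M powr (1 - 1 / p) * (real ?n * harm ?n * \<phi> ?n)"
      unfolding v_def using harm \<phi> by (simp add: field_simps del: of_nat_Suc)
    also have "\<dots> \<le> 2 * C' * M powr (1 - 1 / p) * ((2 * M) * harm ?n * \<phi> ?n)"
      using C' \<phi> M by (intro mult_left_mono mult_right_mono) (auto simp: M_def harm_nonneg)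
    also have "\<dots> = 4 * C' * harm ?n * \<phi> ?n * (M powr (1 - 1 / p) * M)"
      by simp
    also have "M powr (1 - 1 / p) * M = M powr (- eps)"
    proof -
      have "M powr (1 - 1 / p) * M powr 1 = M powr (1 - 1 / p + 1)" by (rule powr_add[symmetric])
      then show ?thesis using M by simp
    qed
    finally have "1 \<le> 4 * C' * harm ?n * \<phi> ?n * M powr (- eps)" .
    then have "M powr eps * 1 \<le> M powr eps * (4 * C' * harm ?n * \<phi> ?n * M powr (- eps))"
      by (rule mult_left_mono) simp
    also have "\<dots> = 4 * C' * harm ?n * \<phi> ?n"
      unfolding powr_minus using M by simp
    finally show ?thesis by (simp add: M_def)
  qed
  \<comment> \<open>The first factor comes from \<open>n + 1 \<le> 2 * R * P K\<close>; the 8 is the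
    4 of \<open>key\<close> times the 2 from bounding the harmonic number by
    \<open>2 * ln (n + 1)\<close>.\<close>
  define D where "D = (2 * real R) powr eps * (8 * C')"
  have bound: "(real n + 1) powr eps / (ln (real n + 1) * \<phi> n) \<le> D" if n: "2 \<le> n" for n
  proof -
    have "\<exists>K. n \<le> P (Suc K)" using less_P[of "Suc n"] by (intro exI[of _ n]) simp
    \<comment> \<open>The unique level with \<open>P K < n \<le> P (Suc K)\<close>; the left
      inequality lets monotonicity of \<open>\<phi>\<close> apply, the right one bounds
      \<open>n\<close> by \<open>R * P K\<close>.\<close>
    define K where "K = (LEAST K. n \<le> P (Suc K))"
    have K1: "n \<le> P (Suc K)" unfolding K_def by (rule LeastI_ex) fact
    have K2: "Suc (P K) \<le> n"
    proof (cases K)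
      case 0
      then show ?thesis using n by simp
    next
      case (Suc L)
      have "\<not> n \<le> P (Suc L)"
      proof
        assume "n \<le> P (Suc L)"
        then have "K \<le> L" unfolding K_def by (rule Least_le)
        with Suc show False by simp
      qed
      then show ?thesis unfolding Suc by linarith
    qed
    \<comment> \<open>From \<open>n \<ge> 2\<close> one gets \<open>n + 1 \<ge> 3\<close>, which
      exceeds \<open>exp 1\<close>; the additive 1 in the harmonic bound is then absorbed by the
      logarithm.\<close>
    have ln1: "1 \<le> ln (real n + 1)"
      using n exp_le by (subst ln_ge_iff) auto
    have \<phi>n: "0 < \<phi> n" using \<phi>1[of n] n by simp
    have "harm (Suc (P K)) \<le> 1 + ln (real (Suc (P K)))" by (rule harm_le_ln) simp
    also have "\<dots> \<le> 2 * ln (real n + 1)" using K2 ln1 by (smt (verit) ln_mono of_nat_0_less_iff of_nat_mono zero_less_Suc)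
    finally have harm: "harm (Suc (P K)) \<le> 2 * ln (real n + 1)" .
    have \<phi>: "\<phi> (Suc (P K)) \<le> \<phi> n" using mono_onD[OF mono, of "Suc (P K)" n] K2 by simp
    have "real n + 1 \<le> 2 * real R * real (P K)"
    proof -
      have "n + 1 \<le> 2 * (R * P K)" using K1 P_Suc_le[of K] P_ge_1[of K] R_ge K2 by linarith
      then have "real (n + 1) \<le> real (2 * (R * P K))" by (simp only: of_nat_le_iff)
      then show ?thesis by simp
    qed
    then have "(real n + 1) powr eps \<le> (2 * real R * real (P K)) powr eps"
      using eps_pos by (intro powr_mono2) auto
    also have "\<dots> = (2 * real R) powr eps * real (P K) powr eps" by (simp add: powr_mult)
    also have "\<dots> \<le> (2 * real R) powr eps * (4 * C' * harm (Suc (P K)) * \<phi> (Suc (P K)))"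
      by (intro mult_left_mono key) simp
    also have "\<dots> \<le> (2 * real R) powr eps * (4 * C' * (2 * ln (real n + 1)) * \<phi> n)"
      using harm \<phi> C' \<phi>1[of "Suc (P K)"] ln1 by (intro mult_left_mono mult_mono) auto
    also have "\<dots> = D * (ln (real n + 1) * \<phi> n)" by (simp add: D_def)
    finally have le: "(real n + 1) powr eps \<le> D * (ln (real n + 1) * \<phi> n)" .
    have "0 < ln (real n + 1) * \<phi> n" using ln1 \<phi>n by (intro mult_pos_pos) linarith+
    with le show ?thesis by (simp only: pos_divide_le_eq)
  qed
  have "limsup (\<lambda>n. ereal ((real n + 1) powr eps / (ln (real n + 1) * \<phi> n))) \<le> ereal D"
    by (rule Limsup_bounded) (use bound in \<open>auto simp: eventually_sequentially\<close>)
  with limsup show False by simp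
qed

end

theorem theorem3:
  fixes m :: "nat \<Rightarrow> nat" and p :: real
  assumes "\<And>k. m k \<ge> 2" and "bdd_above (range m)"
    and "0 < p" and "p < 1 / 2"
  shows
    "(\<exists>c::real. \<forall>f\<in>hardy_space m p.
        Lp_qnorm (vilenkin_measure m) p
          (\<lambda>x. SUP n\<in>{1..}.
             ennreal (ln (real n + 1) * cmod (riesz_mean m n f x) / (real n + 1) powr (1 / p - 2)))
        \<le> ennreal c * Hp_qnorm m p f)
     \<and>
     (\<forall>\<phi> :: nat \<Rightarrow> real.
        (\<forall>n\<ge>1. \<phi> n \<ge> 1) \<longrightarrow> mono_on {1..} \<phi> \<longrightarrow>
        limsup (\<lambda>n. ereal ((real n + 1) powr (1 / p - 2) / (ln (real n + 1) * \<phi> n))) = \<infinity> \<longrightarrow>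
        \<not> (\<exists>C::real. \<forall>f\<in>hardy_space m p.
             weak_Lp_qnorm (vilenkin_measure m) p
               (\<lambda>x. SUP n\<in>{1..}. ennreal (cmod (riesz_mean m n f x) / \<phi> n))
             \<le> ennreal C * Hp_qnorm m p f))"
proof -
  obtain R where "\<And>k. m k \<le> R" using assms(2) by (auto simp: bdd_above_def)
  then interpret vilenkin_exponent m R p
    using assms by unfold_locales auto
  show ?thesis
    using riesz_maximal_bounded riesz_maximal_unbounded by blast
qed

end
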